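(* Let $(M=G/H,ds^2)$ be a connected Lorentz $G$-geodesic orbit nilmanifold, where $G=N\rtimes H$ with $N$ nilpotent. Let $\langle\cdot,\cdot\rangle$ denote the inner product on the Lie algebra $\mathfrak n$ of $N$ induced by $ds^2$. If the restriction of $\langle\cdot,\cdot\rangle$ to $[\mathfrak n,\mathfrak n]$ is nondegenerate, then $N$ is abelian or $2$-step nilpotent.
   Context: Setting. A pseudo-Riemannian nilmanifold is a pseudo-Riemannian manifold admitting a transitive nilpotent Lie group of isometries; it is Lorentz if its metric has signature $(\dim M-1,1)$. Here $G\subset I(M,ds^2)$ is a Lie group of isometries of the form $G=N\rtimes H$, where $N$ is a nilpotent Lie group acting simply transitively on $M$ (so $M$ is identified with $N$ with a left-invariant Lorentz metric) and $H$ is the isotropy subgroup at the base point, acting by isometric automorphisms of $N$. The Lie algebras are $\mathfrak g,\mathfrak h,\mathfrak n$, and $\mathfrak g=\mathfrak h\oplus\mathfrak n$ is a reductive decomposition (vector space direct sum with $[\mathfrak h,\mathfrak n]\subset\mathfrak n$). The space $\mathfrak n$ is identified with the tangent space of $M$ at the base point, so $ds^2$ induces a nondegenerate symmetric bilinear form ("inner product") $\langle\cdot,\cdot\rangle$ on $\mathfrak n$; $\mathfrak h$ acts on $\mathfrak n$ by skew-symmetric derivations. $G$-geodesic orbit. $(M=G/H,ds^2)$ is $G$-geodesic orbit ($G$-GO) if every geodesic of $M$ is, up to reparametrization, an orbit of a $1$-parameter subgroup of $G$. By the Geodesic Lemma this holds if and only if for every $T\in\mathfrak n$ there exist $A=A(T)\in\mathfrak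 h$ and $k=k(T)\in\mathbb R$ such that $\langle[T+A,T']_{\mathfrak n},T\rangle=k\langle T,T'\rangle$ for all $T'\in\mathfrak n$, where the subscript $\mathfrak n$ denotes the $\mathfrak n$-component in $\mathfrak g=\mathfrak h\oplus\mathfrak n$. "$2$-step nilpotent" means $[\mathfrak n,[\mathfrak n,\mathfrak n]]=0$ and $[\mathfrak n,\mathfrak n]\neq0$. *)

theory Defs
  imports "HOL-Analysis.Analysis" "HOL-Algebra.Bij" "HOL-Algebra.Generated_Groups"
begin

section \<open>Smooth maps and smooth manifolds\<close>

text \<open>Differentiability classes on open subsets of finite-dimensional spaces.\<close>

primrec Ck_on ::
  "nat \<Rightarrow> 'e::real_normed_vector set \<Rightarrow> ('e \<Rightarrow> 'f::real_normed_vector) \<Rightarrow> bool" where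
  "Ck_on 0 S f \<longleftrightarrow> continuous_on S f"
| "Ck_on (Suc k) S f \<longleftrightarrow>
     (\<forall>x\<in>S. f differentiable (at x)) \<and> (\<forall>v. Ck_on k S (\<lambda>x. frechet_derivative f (at x) v))"

definition smooth_on ::
  "'e::real_normed_vector set \<Rightarrow> ('e \<Rightarrow> 'f::real_normed_vector) \<Rightarrow> bool" where
  "smooth_on S f \<longleftrightarrow> (\<forall>k. Ck_on k S f)"

type_synonym ('a, 'e) chart = "'a set \<times> ('a \<Rightarrow> 'e)"

definition chart_inv :: "('a, 'e) chart \<Rightarrow> 'e \<Rightarrow> 'a" where
  "chart_inv c = inv_into (fst c) (snd c)"

definition smooth_atlas ::
  "('a::topological_space, 'e::euclidean_space) chart set \<Rightarrow> bool" where
  "smooth_atlas A \<longleftrightarrow>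
     (\<forall>c\<in>A. open (fst c) \<and> open (snd c ` fst c) \<and>
             homeomorphism (fst c) (snd c ` fst c) (snd c) (chart_inv c)) \<and>
     (\<Union>c\<in>A. fst c) = UNIV \<and>
     (\<forall>c\<in>A. \<forall>d\<in>A. smooth_on (snd c ` (fst c \<inter> fst d)) (snd d \<circ> chart_inv c))"

definition smooth_map ::
  "('a::topological_space, 'e::euclidean_space) chart set \<Rightarrow>
   ('b::topological_space, 'f::euclidean_space) chart set \<Rightarrow> ('a \<Rightarrow> 'b) \<Rightarrow> bool" where
  "smooth_map A B f \<longleftrightarrow> continuous_on UNIV f \<and>
     (\<forall>c\<in>A. \<forall>d\<in>B. smooth_on (snd c ` (fst c \<inter> f -` fst d)) (snd d \<circ> f \<circ> chart_inv c))"

definition prod_atlas ::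
  "('a, 'e) chart set \<Rightarrow> ('b, 'f) chart set \<Rightarrow> ('a \<times> 'b, 'e \<times> 'f) chart set" where
  "prod_atlas A B = {(fst c \<times> fst d, map_prod (snd c) (snd d)) |c d. c \<in> A \<and> d \<in> B}"

definition real_atlas :: "(real, real) chart set" where
  "real_atlas = {(UNIV, id)}"

text \<open>
  Tangent vectors at a point are represented by their coordinates in a chart around it;
  \<open>tangent_map c d f p\<close> is the differential of \<open>f\<close> at \<open>p\<close> with respect to a chart \<open>c\<close> around
  \<open>p\<close> and a chart \<open>d\<close> around \<open>f p\<close>.
\<close>

definition tangent_map ::
  "('a, 'e::euclidean_space) chart \<Rightarrow> ('b, 'f::euclidean_space) chart \<Rightarrow> ('a \<Rightarrow> 'b) \<Rightarrow>
   'a \<Rightarrow> 'e \<Rightarrow> 'f" where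
  "tangent_map c d f p = frechet_derivative (snd d \<circ> f \<circ> chart_inv c) (at (snd c p))"


section \<open>Metrics, isometries and geodesics\<close>

text \<open>
  For a metric tensor \<open>g\<close>, the number \<open>g c p u v\<close> is the inner product of the tangent vectors at
  \<open>p\<close> whose coordinates in the chart \<open>c\<close> are \<open>u\<close> and \<open>v\<close>.
\<close>

type_synonym ('a, 'e) metric_tensor = "('a, 'e) chart \<Rightarrow> 'a \<Rightarrow> 'e \<Rightarrow> 'e \<Rightarrow> real"

definition isometry_of ::
  "('a::topological_space, 'e::euclidean_space) chart set \<Rightarrow> ('a, 'e) metric_tensor \<Rightarrow>
   ('a \<Rightarrow> 'a) \<Rightarrow> bool" where
  "isometry_of A g f \<longleftrightarrow>
     bij f \<and> smooth_map A A f \<and> smooth_map A A (inv_into UNIV f) \<and>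
     (\<forall>p. \<forall>c\<in>A. \<forall>d\<in>A. p \<in> fst c \<longrightarrow> f p \<in> fst d \<longrightarrow>
        (\<forall>u v. g d (f p) (tangent_map c d f p u) (tangent_map c d f p v) = g c p u v))"

text \<open>
  The Christoffel symbols of the first kind,
  \<open>\<Gamma>(u, v; w) = (D\<^sub>u g(v, w) + D\<^sub>v g(u, w) - D\<^sub>w g(u, v)) / 2\<close>.
\<close>

definition christoffel ::
  "('a, 'e::euclidean_space) metric_tensor \<Rightarrow> ('a, 'e) chart \<Rightarrow> 'a \<Rightarrow> 'e \<Rightarrow> 'e \<Rightarrow> 'e \<Rightarrow> real" where
  "christoffel g c p u v w =
     (frechet_derivative (\<lambda>y. g c (chart_inv c y) v w) (at (snd c p)) u
      + frechet_derivative (\<lambda>y. g c (chart_inv c y) u w) (at (snd c p)) v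
      - frechet_derivative (\<lambda>y. g c (chart_inv c y) u v) (at (snd c p)) w) / 2"

text \<open>
  The geodesic equation \<open>\<nabla>\<^bsub>\<gamma>'\<^esub> \<gamma>' = 0\<close> of the Levi-Civita connection, with the index lowered:
  in coordinates, \<open>g(x'', w) + \<Gamma>(x', x'; w) = 0\<close> for all \<open>w\<close>. As the equation does not depend on
  the chart, it is enough to ask for it in one chart around each point of the curve.
\<close>

definition geodesic_on ::
  "('a::topological_space, 'e::euclidean_space) chart set \<Rightarrow> ('a, 'e) metric_tensor \<Rightarrow>
   real set \<Rightarrow> (real \<Rightarrow> 'a) \<Rightarrow> bool" where
  "geodesic_on A g I \<gamma> \<longleftrightarrow> continuous_on I \<gamma> \<and>
     (\<forall>t\<in>I. \<exists>c\<in>A. \<gamma> t \<in> fst c \<and>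
        (\<exists>x' x''. (\<forall>\<^sub>F s in nhds t. ((\<lambda>r. snd c (\<gamma> r)) has_vector_derivative x' s) (at s)) \<and>
           (x' has_vector_derivative x'') (at t) \<and>
           (\<forall>w. g c (\<gamma> t) x'' w + christoffel g c (\<gamma> t) (x' t) (x' t) w = 0)))"

text \<open>One-parameter subgroups of a group \<open>G\<close> of diffeomorphisms of a manifold.\<close>

definition one_parameter_subgroup ::
  "('a::topological_space, 'e::euclidean_space) chart set \<Rightarrow> ('a \<Rightarrow> 'a) set \<Rightarrow>
   (real \<Rightarrow> 'a \<Rightarrow> 'a) \<Rightarrow> bool" where
  "one_parameter_subgroup A G \<phi> \<longleftrightarrow>
     (\<forall>t. \<phi> t \<in> G) \<and> (\<forall>s t. \<phi> (s + t) = \<phi> s \<circ> \<phi> t) \<and>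
     smooth_map (prod_atlas real_atlas A) A (\<lambda>(t, p). \<phi> t p)"

text \<open>
  Every geodesic is, up to reparametrization \<open>\<sigma>\<close>, an orbit of a one-parameter subgroup of \<open>G\<close>.
  This is required on a subinterval \<open>J\<close> around each parameter: when \<open>\<sigma>\<close> is not affine (which
  can happen along null geodesics), the orbit may be only a part of the maximal geodesic.
\<close>

definition geodesic_orbit ::
  "('a::topological_space, 'e::euclidean_space) chart set \<Rightarrow> ('a, 'e) metric_tensor \<Rightarrow>
   ('a \<Rightarrow> 'a) set \<Rightarrow> bool" where
  "geodesic_orbit A g G \<longleftrightarrow>
     (\<forall>I \<gamma>. open I \<and> is_interval I \<and> geodesic_on A g I \<gamma> \<longrightarrow>
        (\<forall>t\<^sub>0\<in>I. \<exists>J \<sigma> \<phi> p.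
           open J \<and> is_interval J \<and> t\<^sub>0 \<in> J \<and> J \<subseteq> I \<and>
           smooth_on J \<sigma> \<and> (\<forall>t\<in>J. deriv \<sigma> t \<noteq> 0) \<and>
           one_parameter_subgroup A G \<phi> \<and> (\<forall>t\<in>J. \<gamma> t = \<phi> (\<sigma> t) p)))"


section \<open>Lie groups and their Lie algebras\<close>

definition lie_group ::
  "('a::topological_space) monoid \<Rightarrow> ('a, 'e::euclidean_space) chart set \<Rightarrow> bool" where
  "lie_group N A \<longleftrightarrow> group N \<and> carrier N = UNIV \<and> smooth_atlas A \<and>
     smooth_map (prod_atlas A A) A (\<lambda>(a, b). a \<otimes>\<^bsub>N\<^esub> b) \<and> smooth_map A A (\<lambda>a. inv\<^bsub>N\<^esub> a)"

primrec lower_central_series :: "('a, 'm) monoid_scheme \<Rightarrow> nat \<Rightarrow> 'a set" where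
  "lower_central_series N 0 = carrier N"
| "lower_central_series N (Suc k) =
     generate N {a \<otimes>\<^bsub>N\<^esub> b \<otimes>\<^bsub>N\<^esub> inv\<^bsub>N\<^esub> a \<otimes>\<^bsub>N\<^esub> inv\<^bsub>N\<^esub> b |a b.
       a \<in> carrier N \<and> b \<in> lower_central_series N k}"

definition nilpotent_group :: "('a, 'm) monoid_scheme \<Rightarrow> bool" where
  "nilpotent_group N \<longleftrightarrow> (\<exists>k. lower_central_series N k = {\<one>\<^bsub>N\<^esub>})"

text \<open>
  A chart \<open>e\<close> around the identity identifies the Lie algebra (the tangent space at the identity)
  with the model space of the chart. The bracket is \<open>[u, v] = ad(u) v\<close>, where \<open>ad\<close> is the
  differential of \<open>Ad\<close> at the identity.
\<close>

definition Ad_map ::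
  "('a, 'm) monoid_scheme \<Rightarrow> ('a, 'e::euclidean_space) chart \<Rightarrow> 'a \<Rightarrow> 'e \<Rightarrow> 'e" where
  "Ad_map N e a = tangent_map e e (\<lambda>x. a \<otimes>\<^bsub>N\<^esub> x \<otimes>\<^bsub>N\<^esub> inv\<^bsub>N\<^esub> a) \<one>\<^bsub>N\<^esub>"

definition lie_bracket ::
  "('a, 'm) monoid_scheme \<Rightarrow> ('a, 'e::euclidean_space) chart \<Rightarrow> 'e \<Rightarrow> 'e \<Rightarrow> 'e" where
  "lie_bracket N e u v =
     frechet_derivative (\<lambda>y. Ad_map N e (chart_inv e y) v) (at (snd e \<one>\<^bsub>N\<^esub>)) u"

definition bracket_span ::
  "('e::real_vector \<Rightarrow> 'e \<Rightarrow> 'e) \<Rightarrow> 'e set \<Rightarrow> 'e set \<Rightarrow> 'e set" where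
  "bracket_span br S T = span {br u v |u v. u \<in> S \<and> v \<in> T}"

abbreviation derived_algebra :: "('e::real_vector \<Rightarrow> 'e \<Rightarrow> 'e) \<Rightarrow> 'e set" where
  "derived_algebra br \<equiv> bracket_span br UNIV UNIV"

definition two_step_nilpotent :: "('e::real_vector \<Rightarrow> 'e \<Rightarrow> 'e) \<Rightarrow> bool" where
  "two_step_nilpotent br \<longleftrightarrow>
     bracket_span br UNIV (derived_algebra br) = {0} \<and> derived_algebra br \<noteq> {0}"


section \<open>Left-invariant Lorentz metrics\<close>

text \<open>Inner products of signature \<open>(n - 1, 1)\<close>, where \<open>n\<close> is the dimension.\<close>

definition lorentz_inner_product :: "('e::euclidean_space \<Rightarrow> 'e \<Rightarrow> real) \<Rightarrow> bool" where
  "lorentz_inner_product ip \<longleftrightarrow> bilinear ip \<and> (\<forall>u v. ip u v = ip v u) \<and>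
     (\<exists>B. independent B \<and> span B = UNIV \<and> (\<forall>u\<in>B. \<forall>v\<in>B. u \<noteq> v \<longrightarrow> ip u v = 0) \<and>
        (\<exists>b\<in>B. ip b b = -1 \<and> (\<forall>u\<in>B - {b}. ip u u = 1)))"

definition nondegenerate_on :: "'e::real_vector set \<Rightarrow> ('e \<Rightarrow> 'e \<Rightarrow> real) \<Rightarrow> bool" where
  "nondegenerate_on S ip \<longleftrightarrow> (\<forall>u\<in>S. (\<forall>v\<in>S. ip u v = 0) \<longrightarrow> u = 0)"

text \<open>The left-invariant metric which is given by \<open>ip\<close> on the tangent space at the identity.\<close>

definition left_invariant_metric ::
  "('a, 'm) monoid_scheme \<Rightarrow> ('a, 'e::euclidean_space) chart \<Rightarrow> ('e \<Rightarrow> 'e \<Rightarrow> real) \<Rightarrow>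
   ('a, 'e) metric_tensor" where
  "left_invariant_metric N e ip c p u v =
     ip (tangent_map c e (\<lambda>x. inv\<^bsub>N\<^esub> p \<otimes>\<^bsub>N\<^esub> x) p u) (tangent_map c e (\<lambda>x. inv\<^bsub>N\<^esub> p \<otimes>\<^bsub>N\<^esub> x) p v)"

text \<open>
  The group \<open>N \<rtimes> H\<close>, as a group of transformations of \<open>N\<close>: here \<open>N\<close> acts by left translations
  and \<open>H\<close>, the isotropy subgroup at the identity, by automorphisms.
\<close>

definition semidirect_transformations ::
  "('a, 'm) monoid_scheme \<Rightarrow> ('a \<Rightarrow> 'a) set \<Rightarrow> ('a \<Rightarrow> 'a) set" where
  "semidirect_transformations N H = {\<lambda>x. a \<otimes>\<^bsub>N\<^esub> h x |a h. a \<in> carrier N \<and> h \<in> H}"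

end

theory Submission
  imports Defs
begin

text \<open>
  In a chart around the identity, a geodesic with any initial velocity \<open>T\<close> exists by the theorem
  of Picard and Lindelof. Writing it as an orbit of \<open>s \<mapsto> (x \<mapsto> a(s) h\<^sub>s(x))\<close>, the differentials of the automorphisms
  \<open>h\<^sub>s\<close> at the identity give a skew derivation, and the geodesic equation at the identity is the
  equation \<open>\<langle>[T + D, w], T\<rangle> = k \<langle>T, w\<rangle>\<close> of the Geodesic Lemma.

  Let \<open>\<nn>' = [\<nn>, \<nn>]\<close> and \<open>\<vv>\<close> its orthogonal complement. The Geodesic Lemma for
  \<open>T = X + Z\<close> with \<open>X \<in> \<vv>\<close>, \<open>Z \<in> \<nn>'\<close> shows that \<open>ad X\<close> is skew on \<open>\<nn>'\<close>; as \<open>\<vv>\<close> generates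
  \<open>\<nn>\<close>, so is every \<open>ad u\<close>. If \<open>[\<nn>, \<nn>'] \<noteq> 0\<close>, the last nonzero iterated bracket is a
  central null vector \<open>e\<close>, hence \<open>\<vv>\<close> is definite, \<open>\<nn>'\<close> is abelian and \<open>[u, y] \<in> \<real>e\<close> whenever
  \<open>y \<in> \<nn>'\<close> is orthogonal to \<open>e\<close>. The derivations of the Geodesic Lemma and the Jacobi identity
  then leave a plane with orthogonal basis \<open>a, b\<close> in \<open>\<vv>\<close>, preserved by \<open>D\<close>, with
  \<open>\<langle>e, [a, b]\<rangle> \<noteq> 0\<close>. Being skew, \<open>D\<close> kills \<open>[a, b]\<close>, whereas the Geodesic Lemma for
  \<open>T = a + [a, b]\<close> (up to scaling) gives \<open>D[a, b] = - [a, [a, b]] \<noteq> 0\<close>.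
\<close>


section \<open>Calculus of smooth maps\<close>

text \<open>The hypotheses concern a group, the argument its Lie algebra, and no exponential map is
  used: each passage between the two consists in writing a group identity in one chart around the
  identity and differentiating it there. \<open>H\<close> is a bare group of automorphisms, so no
  Lie algebra of \<open>H\<close> is formed; for each \<open>T\<close> an orbit provides one skew
  derivation \<open>D\<close>, with no claim that \<open>D\<close> depends linearly on
  \<open>T\<close>. The number \<open>k\<close> is the obstacle at null \<open>T\<close>. It is the
  logarithmic derivative of the velocity of the reparametrization, and testing the equation on
  \<open>w = T\<close> forces \<open>k = 0\<close> only if \<open>T\<close> is not null. This is why
  vectors \<open>X + s Z\<close> with an adjustable factor \<open>s\<close> occur. The signature
  enters through one fact: orthogonal vectors of nonpositive square are linearly dependent. It makes
  the orthogonal complement of \<open>e\<close> positive definite modulo \<open>e\<close>, and a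
  skew nilpotent operator on a definite space is zero.\<close>

lemma frechet_derivativeI: "(f has_derivative D) (at x) \<Longrightarrow> frechet_derivative f (at x) = D"
  by (rule frechet_derivative_at[symmetric])

lemma has_derivative_cong_nhds:
  assumes "(f has_derivative D) (at z)" "\<forall>\<^sub>F x in nhds z. f x = g x"
  shows "(g has_derivative D) (at z)"
  by (rule has_derivative_transform_eventually[OF assms(1)])
     (use assms(2) in \<open>simp_all add: eventually_nhds_conv_at\<close>)

lemma Ck_on_subset: "Ck_on k S f \<Longrightarrow> T \<subseteq> S \<Longrightarrow> Ck_on k T f"
  by (induction k arbitrary: f) (auto intro: continuous_on_subset)

lemma Ck_on_cong:
  assumes "open S" "Ck_on k S f" "\<And>x. x \<in> S \<Longrightarrow> f x = g x"
  shows "Ck_on k S g"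
  using assms(2,3)
proof (induction k arbitrary: f g)
  case 0
  then show ?case by (auto cong: continuous_on_cong)
next
  case (Suc k)
  have D: "(g has_derivative frechet_derivative f (at x)) (at x)" if "x \<in> S" for x
    using Suc.prems that \<open>open S\<close>
    by (intro has_derivative_transform_within_open[of f _ x UNIV S g])
       (auto simp: frechet_derivative_works[symmetric])
  have "frechet_derivative g (at x) = frechet_derivative f (at x)" if "x \<in> S" for x
    using frechet_derivative_at[OF D[OF that]] by simp
  moreover have "Ck_on k S (\<lambda>x. frechet_derivative g (at x) v)" for v
    by (rule Suc.IH[of "\<lambda>x. frechet_derivative f (at x) v"]) (use Suc.prems(1) calculation in simp_all)
  ultimately show ?case
    using D by (auto simp: differentiable_def)
qed

lemma Ck_on_imp_continuous_on: "Ck_on k S f \<Longrightarrow> continuous_on S f"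
  by (cases k)
     (auto intro!: differentiable_imp_continuous_on
           simp: differentiable_on_def differentiable_at_withinI)

text \<open>The product and chain rules produce terms that contain the functions themselves beside
  their derivatives, so in the step from \<open>k\<close> to \<open>Suc k\<close> the functions must
  also count as \<open>Ck_on k\<close>.\<close>

lemma Ck_on_SucD: "Ck_on (Suc k) S f \<Longrightarrow> Ck_on k S f"
proof (induction k arbitrary: f)
  case 0
  then show ?case using Ck_on_imp_continuous_on[of "Suc 0"] by auto
next
  case (Suc k)
  then show ?case by (auto simp del: Ck_on.simps(1) simp: Suc.IH)
qed

lemma Ck_on_const: "Ck_on k S (\<lambda>x. c)"
  by (induction k arbitrary: c) auto

lemma Ck_on_bounded_linear:
  assumes "bounded_linear f" shows "Ck_on k S f"
proof (cases k)
  case 0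
  then show ?thesis using assms by (simp add: linear_continuous_on)
next
  case (Suc n)
  have D: "(f has_derivative f) (at x)" for x
    using assms by (rule bounded_linear_imp_has_derivative)
  then have "frechet_derivative f (at x) = f" for x
    by (metis frechet_derivative_at)
  with D Suc show ?thesis by (auto simp: differentiable_def Ck_on_const)
qed

lemma Ck_on_add:
  assumes "open S" "Ck_on k S f" "Ck_on k S g"
  shows "Ck_on k S (\<lambda>x. f x + g x)"
  using assms(2,3)
proof (induction k arbitrary: f g)
  case 0
  then show ?case by (auto intro: continuous_on_add)
next
  case (Suc k)
  have D: "((\<lambda>x. f x + g x) has_derivative
      (\<lambda>v. frechet_derivative f (at x) v + frechet_derivative g (at x) v)) (at x)" if "x \<in> S" for x
    using Suc.prems that
    by (intro has_derivative_add) (auto simp: frechet_derivative_works[symmetric])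
  have "Ck_on k S (\<lambda>x. frechet_derivative (\<lambda>x. f x + g x) (at x) v)" for v
  proof (rule Ck_on_cong[OF \<open>open S\<close>])
    show "Ck_on k S (\<lambda>x. frechet_derivative f (at x) v + frechet_derivative g (at x) v)"
      using Suc.prems by (intro Suc.IH) simp_all
  qed (simp add: frechet_derivativeI[OF D])
  then show ?case using D by (auto simp: differentiable_def)
qed

lemma Ck_on_bilinear:
  assumes "bounded_bilinear B" "open S" "Ck_on k S f" "Ck_on k S g"
  shows "Ck_on k S (\<lambda>x. B (f x) (g x))"
  using assms(3,4)
proof (induction k arbitrary: f g)
  case 0
  then show ?case by (auto intro: bounded_bilinear.continuous_on[OF assms(1)])
next
  case (Suc k)
  have D: "((\<lambda>x. B (f x) (g x)) has_derivative
      (\<lambda>v. B (f x) (frechet_derivative g (at x) v) + B (frechet_derivative f (at x) v) (g x))) (at x)"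
    if "x \<in> S" for x
    using Suc.prems that
    by (intro bounded_bilinear.FDERIV[OF assms(1)]) (auto simp: frechet_derivative_works[symmetric])
  have "Ck_on k S (\<lambda>x. frechet_derivative (\<lambda>x. B (f x) (g x)) (at x) v)" for v
  proof (rule Ck_on_cong[OF \<open>open S\<close>])
    show "Ck_on k S (\<lambda>x. B (f x) (frechet_derivative g (at x) v) + B (frechet_derivative f (at x) v) (g x))"
      using Suc.prems Ck_on_SucD[OF Suc.prems(1)] Ck_on_SucD[OF Suc.prems(2)]
      by (intro Ck_on_add assms Suc.IH) simp_all
  qed (simp add: frechet_derivativeI[OF D])
  then show ?case using D by (auto simp: differentiable_def)
qed

lemma Ck_on_sum:
  assumes "open S" "\<And>i. i \<in> I \<Longrightarrow> Ck_on k S (f i)"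
  shows "Ck_on k S (\<lambda>x. \<Sum>i\<in>I. f i x)"
  using assms(2)
  by (induction I rule: infinite_finite_induct) (auto simp: Ck_on_const intro!: Ck_on_add assms(1))

lemma linear_euclidean_expand:
  fixes f :: "'a::euclidean_space \<Rightarrow> 'b::real_vector"
  assumes "linear f"
  shows "f v = (\<Sum>b\<in>Basis. (v \<bullet> b) *\<^sub>R f b)"
proof -
  have "f v = f (\<Sum>b\<in>Basis. (v \<bullet> b) *\<^sub>R b)" by (simp add: euclidean_representation)
  also have "\<dots> = (\<Sum>b\<in>Basis. (v \<bullet> b) *\<^sub>R f b)"
    using assms by (simp add: linear_sum linear_scale)
  finally show ?thesis .
qed

text \<open>In the derivative of the composite both base point and direction vary, so the induction
  hypothesis does not apply to it directly. Expanding the direction in \<open>Basis\<close> leaves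
  products of scalar functions with partial derivatives of \<open>f\<close> composed with
  \<open>g\<close>, and to these it does apply.\<close>

lemma Ck_on_compose:
  fixes f :: "'b::euclidean_space \<Rightarrow> 'c::real_normed_vector"
  assumes "open S" "open T" "Ck_on k S g" "Ck_on k T f" "g ` S \<subseteq> T"
  shows "Ck_on k S (\<lambda>x. f (g x))"
  using assms(3,4)
proof (induction k arbitrary: f)
  case 0
  then show ?case using assms(5) by (auto intro: continuous_on_compose2)
next
  case (Suc k)
  let ?f = "\<lambda>x. frechet_derivative f (at (g x))" and ?g = "\<lambda>x. frechet_derivative g (at x)"
  have Df: "(f has_derivative ?f x) (at (g x))" if "x \<in> S" for x
    using Suc.prems that assms(5) by (auto simp: frechet_derivative_works[symmetric])
  have Dg: "(g has_derivative ?g x) (at x)" if "x \<in> S" for x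
    using Suc.prems that by (auto simp: frechet_derivative_works[symmetric])
  have D: "((\<lambda>x. f (g x)) has_derivative (\<lambda>v. ?f x (?g x v))) (at x)" if "x \<in> S" for x
    using has_derivative_compose[OF Dg Df] that by auto
  have E: "?f x w = (\<Sum>b\<in>Basis. (w \<bullet> b) *\<^sub>R ?f x b)" if "x \<in> S" for x w
    by (rule linear_euclidean_expand) (use Df[OF that] has_derivative_linear in blast)
  have g: "Ck_on k S g" using Suc.prems(1) by (rule Ck_on_SucD)
  have "Ck_on k S (\<lambda>x. frechet_derivative (\<lambda>x. f (g x)) (at x) v)" for v
  proof (rule Ck_on_cong[OF \<open>open S\<close>])
    show "Ck_on k S (\<lambda>x. \<Sum>b\<in>Basis. (?g x v \<bullet> b) *\<^sub>R ?f x b)"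
      using Suc.prems g
      by (intro Ck_on_sum Ck_on_bilinear[OF bounded_bilinear_scaleR]
          Ck_on_bilinear[OF bounded_bilinear_inner] Ck_on_const Suc.IH assms) auto
    show "(\<Sum>b\<in>Basis. (?g x v \<bullet> b) *\<^sub>R ?f x b) = frechet_derivative (\<lambda>x. f (g x)) (at x) v"
      if "x \<in> S" for x
      using E[OF that, of "?g x v"] by (simp add: frechet_derivativeI[OF D[OF that]])
  qed
  then show ?case using D by (auto simp: differentiable_def)
qed

text \<open>The neighbourhood is hidden, so that smoothness of long expressions follows from
  introduction rules without tracking open domains.\<close>

definition smooth_at :: "('e::real_normed_vector \<Rightarrow> 'f::real_normed_vector) \<Rightarrow> 'e \<Rightarrow> bool" where
  "smooth_at f z \<longleftrightarrow> (\<exists>S. open S \<and> z \<in> S \<and> smooth_on S f)"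

lemma smooth_on_imp_smooth_at: "smooth_on S f \<Longrightarrow> open S \<Longrightarrow> z \<in> S \<Longrightarrow> smooth_at f z"
  by (auto simp: smooth_at_def)

lemma smooth_at_eventually: "smooth_at f z \<Longrightarrow> \<forall>\<^sub>F x in nhds z. smooth_at f x"
  unfolding smooth_at_def by (auto simp: eventually_nhds)

lemma smooth_at_has_derivative:
  assumes "smooth_at f z"
  shows "(f has_derivative frechet_derivative f (at z)) (at z)"
proof -
  obtain S where "open S" "z \<in> S" "smooth_on S f" using assms by (auto simp: smooth_at_def)
  then have "Ck_on (Suc 0) S f" unfolding smooth_on_def by blast
  with \<open>z \<in> S\<close> show ?thesis by (auto simp: frechet_derivative_works[symmetric])
qed

lemma smooth_at_linear: "smooth_at f z \<Longrightarrow> linear (frechet_derivative f (at z))"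
  using smooth_at_has_derivative has_derivative_linear by blast

lemma smooth_at_isCont: "smooth_at f z \<Longrightarrow> isCont f z"
  using smooth_at_has_derivative has_derivative_continuous by blast

lemma smooth_at_tendsto: "smooth_at f z \<Longrightarrow> filterlim f (nhds (f z)) (nhds z)"
  using smooth_at_isCont[of f z] by (simp add: isCont_def tendsto_at_iff_tendsto_nhds)

lemma smooth_at_cong:
  assumes "smooth_at f z" "\<forall>\<^sub>F x in nhds z. f x = g x"
  shows "smooth_at g z"
proof -
  obtain S where S: "open S" "z \<in> S" "smooth_on S f" using assms by (auto simp: smooth_at_def)
  obtain T where T: "open T" "z \<in> T" "\<And>x. x \<in> T \<Longrightarrow> f x = g x"
    using assms(2) by (auto simp: eventually_nhds)
  have "smooth_on (S \<inter> T) g"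
    unfolding smooth_on_def
  proof
    fix k
    show "Ck_on k (S \<inter> T) g"
      by (rule Ck_on_cong[where f = f])
         (use S T Ck_on_subset[of k S f "S \<inter> T"] in \<open>auto simp: smooth_on_def\<close>)
  qed
  then show ?thesis using S T by (intro smooth_on_imp_smooth_at[of "S \<inter> T"]) auto
qed

lemma frechet_derivative_cong_nhds:
  assumes "\<forall>\<^sub>F x in nhds z. f x = g x"
  shows "frechet_derivative f (at z) = frechet_derivative g (at z)"
proof -
  have "(f has_derivative D) (at z) \<longleftrightarrow> (g has_derivative D) (at z)" for D
    using has_derivative_cong_nhds[of f D z g] has_derivative_cong_nhds[of g D z f] assms
      eventually_mono[OF assms, of "\<lambda>x. g x = f x"] by (intro iffI) auto
  then show ?thesis by (simp add: frechet_derivative_def)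
qed

lemma smooth_at_const [simp]: "smooth_at (\<lambda>x. c) z"
  by (rule smooth_on_imp_smooth_at[of UNIV]) (auto simp: smooth_on_def Ck_on_const)

lemma smooth_at_bounded_linear: "bounded_linear f \<Longrightarrow> smooth_at f z"
  by (rule smooth_on_imp_smooth_at[of UNIV]) (auto simp: smooth_on_def Ck_on_bounded_linear)

lemma smooth_at_id [simp]: "smooth_at (\<lambda>x. x) z"
  by (intro smooth_at_bounded_linear bounded_linear_ident)

lemma smooth_at_compose:
  fixes f :: "'b::euclidean_space \<Rightarrow> 'c::real_normed_vector"
  assumes "smooth_at g z" "smooth_at f (g z)"
  shows "smooth_at (\<lambda>x. f (g x)) z"
proof -
  obtain S where S: "open S" "z \<in> S" "smooth_on S g" using assms by (auto simp: smooth_at_def)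
  obtain T where T: "open T" "g z \<in> T" "smooth_on T f" using assms by (auto simp: smooth_at_def)
  have "continuous_on S g" using S(3) Ck_on_imp_continuous_on by (auto simp: smooth_on_def)
  then have O: "open (S \<inter> g -` T)" using S(1) T(1) by (simp add: continuous_open_preimage)
  have "smooth_on (S \<inter> g -` T) (\<lambda>x. f (g x))"
    unfolding smooth_on_def
  proof
    fix k
    have "Ck_on k (S \<inter> g -` T) g" "Ck_on k T f"
      using S(3) T(3) Ck_on_subset[of k S g "S \<inter> g -` T"] by (auto simp: smooth_on_def)
    then show "Ck_on k (S \<inter> g -` T) (\<lambda>x. f (g x))"
      by (rule Ck_on_compose[OF O T(1)]) auto
  qed
  then show ?thesis using O S T by (intro smooth_on_imp_smooth_at[OF _ O]) auto
qed

lemma smooth_at_bilinear: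
  assumes "bounded_bilinear B" "smooth_at f z" "smooth_at g z"
  shows "smooth_at (\<lambda>x. B (f x) (g x)) z"
proof -
  obtain S where S: "open S" "z \<in> S" "smooth_on S f" using assms by (auto simp: smooth_at_def)
  obtain T where T: "open T" "z \<in> T" "smooth_on T g" using assms by (auto simp: smooth_at_def)
  have "smooth_on (S \<inter> T) (\<lambda>x. B (f x) (g x))"
    using S T Ck_on_subset[of _ S f "S \<inter> T"] Ck_on_subset[of _ T g "S \<inter> T"]
    by (auto simp: smooth_on_def intro!: Ck_on_bilinear[OF assms(1)])
  then show ?thesis using S T by (intro smooth_on_imp_smooth_at[of "S \<inter> T"]) auto
qed

lemma smooth_at_add:
  assumes "smooth_at f z" "smooth_at g z"
  shows "smooth_at (\<lambda>x. f x + g x) z"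
proof -
  obtain S where S: "open S" "z \<in> S" "smooth_on S f" using assms by (auto simp: smooth_at_def)
  obtain T where T: "open T" "z \<in> T" "smooth_on T g" using assms by (auto simp: smooth_at_def)
  have "smooth_on (S \<inter> T) (\<lambda>x. f x + g x)"
    using S T Ck_on_subset[of _ S f "S \<inter> T"] Ck_on_subset[of _ T g "S \<inter> T"]
    by (auto simp: smooth_on_def intro!: Ck_on_add)
  then show ?thesis using S T by (intro smooth_on_imp_smooth_at[of "S \<inter> T"]) auto
qed

lemmas smooth_at_scaleR = smooth_at_bilinear[OF bounded_bilinear_scaleR]
lemmas smooth_at_inner = smooth_at_bilinear[OF bounded_bilinear_inner]

lemma smooth_at_minus: "smooth_at f z \<Longrightarrow> smooth_at (\<lambda>x. - f x) z"
  using smooth_at_scaleR[OF smooth_at_const[of "-1"], of f z] by simp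

lemma smooth_at_diff: "smooth_at f z \<Longrightarrow> smooth_at g z \<Longrightarrow> smooth_at (\<lambda>x. f x - g x) z"
  using smooth_at_add[OF _ smooth_at_minus, of f z g] by simp

lemma smooth_at_sum:
  "(\<And>i. i \<in> I \<Longrightarrow> smooth_at (f i) z) \<Longrightarrow> smooth_at (\<lambda>x. \<Sum>i\<in>I. f i x) z"
  by (induction I rule: infinite_finite_induct) (auto intro!: smooth_at_add)

lemma smooth_at_Pair:
  fixes f :: "'a::real_normed_vector \<Rightarrow> 'b::euclidean_space" and g :: "'a \<Rightarrow> 'c::euclidean_space"
  assumes "smooth_at f z" "smooth_at g z"
  shows "smooth_at (\<lambda>x. (f x, g x)) z"
proof -
  have "smooth_at (\<lambda>x. (f x, 0 :: 'c)) z"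
    by (rule smooth_at_compose[OF assms(1)])
       (intro smooth_at_bounded_linear bounded_linear_Pair bounded_linear_ident bounded_linear_zero)
  moreover have "smooth_at (\<lambda>x. (0 :: 'b, g x)) z"
    by (rule smooth_at_compose[OF assms(2)])
       (intro smooth_at_bounded_linear bounded_linear_Pair bounded_linear_ident bounded_linear_zero)
  ultimately have "smooth_at (\<lambda>x. (f x, 0) + (0, g x)) z" by (rule smooth_at_add)
  then show ?thesis by simp
qed

lemma smooth_at_directional:
  assumes "smooth_at f z"
  shows "smooth_at (\<lambda>x. frechet_derivative f (at x) v) z"
proof -
  obtain S where S: "open S" "z \<in> S" "smooth_on S f" using assms by (auto simp: smooth_at_def)
  have "smooth_on S (\<lambda>x. frechet_derivative f (at x) v)"
    unfolding smooth_on_def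
  proof
    fix k
    have "Ck_on (Suc k) S f" using S(3) unfolding smooth_on_def by blast
    then show "Ck_on k S (\<lambda>x. frechet_derivative f (at x) v)" by auto
  qed
  then show ?thesis using S by (intro smooth_on_imp_smooth_at)
qed

lemma smooth_at_frechet_expand:
  fixes f :: "'b::euclidean_space \<Rightarrow> 'c::real_normed_vector"
  assumes "isCont p z" "smooth_at f (p z)"
  shows "\<forall>\<^sub>F x in nhds z. (\<Sum>b\<in>Basis. (w x \<bullet> b) *\<^sub>R frechet_derivative f (at (p x)) b)
           = frechet_derivative f (at (p x)) (w x)"
proof -
  have "\<forall>\<^sub>F x in nhds z. smooth_at f (p x)"
    using smooth_at_eventually[OF assms(2)] assms(1)
    by (intro eventually_compose_filterlim[of _ "nhds (p z)" p])
       (auto simp: isCont_def tendsto_at_iff_tendsto_nhds)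
  then show ?thesis
    by eventually_elim (rule linear_euclidean_expand[symmetric, OF smooth_at_linear])
qed

text \<open>\<open>Ck_on\<close> only controls derivatives in fixed directions. With a moving base
  point and a moving direction, the differential agrees near \<open>z\<close> with its expansion in
  \<open>Basis\<close>.\<close>

lemma smooth_at_frechet:
  fixes f :: "'b::euclidean_space \<Rightarrow> 'c::real_normed_vector"
  assumes "smooth_at p z" "smooth_at f (p z)" "smooth_at w z"
  shows "smooth_at (\<lambda>x. frechet_derivative f (at (p x)) (w x)) z"
proof (rule smooth_at_cong)
  show "smooth_at (\<lambda>x. \<Sum>b\<in>Basis. (w x \<bullet> b) *\<^sub>R frechet_derivative f (at (p x)) b) z"
    using assms smooth_at_compose[OF assms(1) smooth_at_directional[OF assms(2)]]
    by (intro smooth_at_sum smooth_at_scaleR smooth_at_inner smooth_at_const)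
qed (rule smooth_at_frechet_expand[OF smooth_at_isCont[OF assms(1)] assms(2)])

section \<open>Second derivatives and their symmetry\<close>

definition second_derivative ::
  "('e::real_normed_vector \<Rightarrow> 'f::real_normed_vector) \<Rightarrow> 'e \<Rightarrow> 'e \<Rightarrow> 'e \<Rightarrow> 'f" where
  "second_derivative f z u v = frechet_derivative (\<lambda>x. frechet_derivative f (at x) v) (at z) u"

lemma second_derivative_linear_left:
  "smooth_at f z \<Longrightarrow> linear (\<lambda>u. second_derivative f z u v)"
  unfolding second_derivative_def by (intro smooth_at_linear smooth_at_directional)

lemma has_derivative_directional:
  "smooth_at f z \<Longrightarrow>
   ((\<lambda>x. frechet_derivative f (at x) v) has_derivative (\<lambda>u. second_derivative f z u v)) (at z)"
  unfolding second_derivative_def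
  using smooth_at_has_derivative[OF smooth_at_directional] by blast

text \<open>The first derivative is linear at every point near \<open>z\<close>; differentiating the
  linearity identities in the base point passes them on.\<close>

lemma second_derivative_linear_right:
  assumes "smooth_at f z"
  shows "linear (second_derivative f z u)"
proof
  fix v w :: 'a and r :: real
  have ev: "\<forall>\<^sub>F x in nhds z. linear (frechet_derivative f (at x))"
    using smooth_at_eventually[OF assms] by eventually_elim (rule smooth_at_linear)
  have "second_derivative f z u (v + w)
      = frechet_derivative (\<lambda>x. frechet_derivative f (at x) v + frechet_derivative f (at x) w) (at z) u"
    unfolding second_derivative_def
    by (rule fun_cong[OF frechet_derivative_cong_nhds], use ev in eventually_elim) (rule linear_add)
  also have "\<dots> = second_derivative f z u v + second_derivative f z u w"
    by (simp add: frechet_derivativeI[OF has_derivative_add[OF has_derivative_directional[OF assms]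
          has_derivative_directional[OF assms]]])
  finally show "second_derivative f z u (v + w) = second_derivative f z u v + second_derivative f z u w" .
  have "second_derivative f z u (r *\<^sub>R v)
      = frechet_derivative (\<lambda>x. r *\<^sub>R frechet_derivative f (at x) v) (at z) u"
    unfolding second_derivative_def
    by (rule fun_cong[OF frechet_derivative_cong_nhds], use ev in eventually_elim) (rule linear_scale)
  also have "\<dots> = r *\<^sub>R second_derivative f z u v"
    by (simp add: frechet_derivativeI[OF has_derivative_scaleR_right[OF
          has_derivative_directional[OF assms]]])
  finally show "second_derivative f z u (r *\<^sub>R v) = r *\<^sub>R second_derivative f z u v" .
qed

text \<open>The product rule for a differential whose base point and argument both move. The
  derivatives of \<open>R\<close>, \<open>Lt\<close> and \<open>Ad_map\<close> are obtained from it,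
  with \<open>f\<close> the multiplication in coordinates.\<close>

lemma has_derivative_frechet_along:
  fixes f :: "'b::euclidean_space \<Rightarrow> 'c::real_normed_vector"
  assumes p: "(p has_derivative p') (at z)" and f: "smooth_at f (p z)"
    and w: "(w has_derivative w') (at z)"
  shows "((\<lambda>x. frechet_derivative f (at (p x)) (w x)) has_derivative
           (\<lambda>u. second_derivative f (p z) (p' u) (w z) + frechet_derivative f (at (p z)) (w' u))) (at z)"
proof -
  let ?e = "\<lambda>x. \<Sum>b\<in>Basis. (w x \<bullet> b) *\<^sub>R frechet_derivative f (at (p x)) b"
  have d: "((\<lambda>x. frechet_derivative f (at (p x)) b) has_derivative
      (\<lambda>u. second_derivative f (p z) (p' u) b)) (at z)" for b
    using has_derivative_compose[OF p has_derivative_directional[OF f]] .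
  have "(?e has_derivative (\<lambda>u. \<Sum>b\<in>Basis. (w z \<bullet> b) *\<^sub>R second_derivative f (p z) (p' u) b
      + (w' u \<bullet> b) *\<^sub>R frechet_derivative f (at (p z)) b)) (at z)"
    by (intro has_derivative_sum has_derivative_scaleR has_derivative_inner_left w d)
  also have "(\<lambda>u. \<Sum>b\<in>Basis. (w z \<bullet> b) *\<^sub>R second_derivative f (p z) (p' u) b
      + (w' u \<bullet> b) *\<^sub>R frechet_derivative f (at (p z)) b)
      = (\<lambda>u. second_derivative f (p z) (p' u) (w z) + frechet_derivative f (at (p z)) (w' u))"
    by (simp add: sum.distrib linear_euclidean_expand[OF second_derivative_linear_right[OF f], of _ "w z"]
        linear_euclidean_expand[OF smooth_at_linear[OF f], of "w' _"])
  finally have 1: "(?e has_derivative (\<lambda>u. second_derivative f (p z) (p' u) (w z)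
      + frechet_derivative f (at (p z)) (w' u))) (at z)" .
  have "\<forall>\<^sub>F x in nhds z. ?e x = frechet_derivative f (at (p x)) (w x)"
    by (rule smooth_at_frechet_expand[OF has_derivative_continuous[OF p] f])
  with 1 show ?thesis by (rule has_derivative_cong_nhds)
qed

lemma has_derivative_line:
  assumes "(f has_derivative f') (at (a + t *\<^sub>R u))"
  shows "((\<lambda>s. f (a + s *\<^sub>R u)) has_vector_derivative f' u) (at t)"
proof -
  have "((\<lambda>s. a + s *\<^sub>R u) has_vector_derivative u) (at t)"
    by (auto intro!: derivative_eq_intros)
  from vector_derivative_diff_chain_within[OF this, of f f'] assms show ?thesis
    by (simp add: o_def has_derivative_at_withinI)
qed

text \<open>Both mixed derivatives are limits of the same second difference quotient.\<close>

lemma second_difference_mean_value: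
  fixes f :: "'a::real_normed_vector \<Rightarrow> real"
  assumes h: "0 < h"
    and sm: "\<And>s t. 0 \<le> s \<Longrightarrow> s \<le> h \<Longrightarrow> 0 \<le> t \<Longrightarrow> t \<le> h \<Longrightarrow> smooth_at f (z + s *\<^sub>R u + t *\<^sub>R v)"
  obtains s t where "0 < s" "s < h" "0 < t" "t < h"
    "f (z + h *\<^sub>R u + h *\<^sub>R v) - f (z + h *\<^sub>R u) - f (z + h *\<^sub>R v) + f z
       = h * h * second_derivative f (z + s *\<^sub>R u + t *\<^sub>R v) v u"
proof -
  let ?g = "\<lambda>s. f ((z + h *\<^sub>R v) + s *\<^sub>R u) - f (z + s *\<^sub>R u)"
  let ?g' = "\<lambda>s. frechet_derivative f (at ((z + h *\<^sub>R v) + s *\<^sub>R u)) u - frechet_derivative f (at (z + s *\<^sub>R u)) u"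
  have "(?g has_real_derivative ?g' s) (at s)" if "0 \<le> s" "s \<le> h" for s
    using sm[OF that, of h] sm[OF that, of 0] h
      has_derivative_line[OF smooth_at_has_derivative, of f "z + h *\<^sub>R v" s u]
      has_derivative_line[OF smooth_at_has_derivative, of f z s u]
    by (intro DERIV_diff) (simp_all add: has_real_derivative_iff_has_vector_derivative add_ac)
  from MVT2[OF h this] obtain s where s: "0 < s" "s < h" "?g h - ?g 0 = h * ?g' s" by auto
  let ?k = "\<lambda>t. frechet_derivative f (at ((z + s *\<^sub>R u) + t *\<^sub>R v)) u"
  have "(?k has_real_derivative second_derivative f ((z + s *\<^sub>R u) + t *\<^sub>R v) v u) (at t)"
    if "0 \<le> t" "t \<le> h" for t
    unfolding has_real_derivative_iff_has_vector_derivative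
    by (rule has_derivative_line[OF has_derivative_directional]) (use sm[of s t] s that in auto)
  from MVT2[OF h this] obtain t where t: "0 < t" "t < h"
    "?k h - ?k 0 = h * second_derivative f ((z + s *\<^sub>R u) + t *\<^sub>R v) v u" by auto
  show ?thesis
    by (rule that[OF s(1,2) t(1,2)]) (use s(3) t(3) in \<open>simp add: algebra_simps\<close>)
qed

lemma second_derivative_commute_real:
  fixes f :: "'a::real_normed_vector \<Rightarrow> real"
  assumes "smooth_at f z"
  shows "second_derivative f z u v = second_derivative f z v u"
proof (rule ccontr)
  \<comment> \<open>Half the gap: no number is within \<open>e\<close> of both mixed
    derivatives.\<close>
  define e where "e = \<bar>second_derivative f z u v - second_derivative f z v u\<bar> / 2"
  assume "second_derivative f z u v \<noteq> second_derivative f z v u"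
  then have e: "e > 0" by (simp add: e_def)
  have ev: "\<forall>\<^sub>F x in nhds z. \<bar>second_derivative f x a b - second_derivative f z a b\<bar> < e" for a b
    using tendstoD[OF smooth_at_tendsto[OF smooth_at_directional[OF smooth_at_directional[OF assms]]] e, of b a]
    by (simp add: second_derivative_def dist_real_def)
  have "\<forall>\<^sub>F x in nhds z. smooth_at f x \<and> \<bar>second_derivative f x u v - second_derivative f z u v\<bar> < e \<and>
      \<bar>second_derivative f x v u - second_derivative f z v u\<bar> < e"
    using smooth_at_eventually[OF assms] ev[of u v] ev[of v u] by eventually_elim simp
  then obtain d where d: "d > 0" "\<And>x. dist x z < d \<Longrightarrow> smooth_at f x \<and>
      \<bar>second_derivative f x u v - second_derivative f z u v\<bar> < e \<and>
      \<bar>second_derivative f x v u - second_derivative f z v u\<bar> < e"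
    unfolding eventually_nhds_metric by blast
  \<comment> \<open>With \<open>h = d / K / 2\<close> the parallelogram with sides
    \<open>h *\<^sub>R u\<close> and \<open>h *\<^sub>R v\<close> stays within distance
    \<open>d\<close> of \<open>z\<close>; the \<open>1\<close> keeps \<open>K\<close> positive for
    \<open>u = v = 0\<close>.\<close>
  define K where "K = norm u + norm v + 1"
  have K: "K > 0" by (simp add: K_def add_nonneg_pos)
  define h where "h = d / K / 2"
  have h: "h > 0" using d K by (simp add: h_def)
  have near: "dist (z + s *\<^sub>R a + t *\<^sub>R b) z < d"
    if "0 \<le> s" "s \<le> h" "0 \<le> t" "t \<le> h" "{a, b} = {u, v}" for s t a b
  proof -
    have "dist (z + s *\<^sub>R a + t *\<^sub>R b) z = norm (s *\<^sub>R a + t *\<^sub>R b)" by (simp add: dist_norm)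
    also have "\<dots> \<le> s * norm a + t * norm b" using norm_triangle_ineq[of "s *\<^sub>R a" "t *\<^sub>R b"] that by simp
    also have "\<dots> \<le> h * norm a + h * norm b" using that by (intro add_mono mult_right_mono) auto
    also have "\<dots> = h * (norm u + norm v)" using that(5) by (auto simp: doubleton_eq_iff algebra_simps)
    also have "\<dots> \<le> h * K" using h by (simp add: K_def)
    also have "\<dots> = d / 2" using K by (simp add: h_def)
    finally show ?thesis using d(1) by simp
  qed
  obtain s t where st: "0 < s" "s < h" "0 < t" "t < h"
    "f (z + h *\<^sub>R u + h *\<^sub>R v) - f (z + h *\<^sub>R u) - f (z + h *\<^sub>R v) + f z
       = h * h * second_derivative f (z + s *\<^sub>R u + t *\<^sub>R v) v u"
    using second_difference_mean_value[OF h, of f z u v] near d(2) by blast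
  obtain s' t' where st': "0 < s'" "s' < h" "0 < t'" "t' < h"
    "f (z + h *\<^sub>R v + h *\<^sub>R u) - f (z + h *\<^sub>R v) - f (z + h *\<^sub>R u) + f z
       = h * h * second_derivative f (z + s' *\<^sub>R v + t' *\<^sub>R u) u v"
    using second_difference_mean_value[OF h, of f z v u] near d(2) by blast
  have vu: "z + h *\<^sub>R v + h *\<^sub>R u = z + h *\<^sub>R u + h *\<^sub>R v" by simp
  have "h * h * second_derivative f (z + s *\<^sub>R u + t *\<^sub>R v) v u
      = h * h * second_derivative f (z + s' *\<^sub>R v + t' *\<^sub>R u) u v"
    using st(5) st'(5)[unfolded vu] by linarith
  then have eq: "second_derivative f (z + s *\<^sub>R u + t *\<^sub>R v) v u
      = second_derivative f (z + s' *\<^sub>R v + t' *\<^sub>R u) u v"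
    using h by simp
  have "\<bar>second_derivative f (z + s *\<^sub>R u + t *\<^sub>R v) v u - second_derivative f z v u\<bar> < e"
    "\<bar>second_derivative f (z + s' *\<^sub>R v + t' *\<^sub>R u) u v - second_derivative f z u v\<bar> < e"
    using d(2) near[of s t u v] near[of s' t' v u] st st' by (auto simp: insert_commute)
  moreover have False if "\<bar>c - b\<bar> < \<bar>a - b\<bar> / 2" "\<bar>c - a\<bar> < \<bar>a - b\<bar> / 2" for a b c :: real
    using that by argo
  ultimately show False using eq unfolding e_def by metis
qed

lemma second_derivative_commute:
  fixes f :: "'a::real_normed_vector \<Rightarrow> 'b::euclidean_space"
  assumes "smooth_at f z"
  shows "second_derivative f z u v = second_derivative f z v u"
proof (rule euclidean_eqI)
  fix b :: 'b
  have D: "\<forall>\<^sub>F x in nhds z. frechet_derivative (\<lambda>x. f x \<bullet> b) (at x) = (\<lambda>w. frechet_derivative f (at x) w \<bullet> b)"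
    using smooth_at_eventually[OF assms]
    by eventually_elim (rule frechet_derivativeI[OF has_derivative_inner_left[OF smooth_at_has_derivative]])
  have "second_derivative (\<lambda>x. f x \<bullet> b) z a c = second_derivative f z a c \<bullet> b" for a c
  proof -
    have "\<forall>\<^sub>F x in nhds z. frechet_derivative (\<lambda>x. f x \<bullet> b) (at x) c = frechet_derivative f (at x) c \<bullet> b"
      using D by eventually_elim simp
    then have "second_derivative (\<lambda>x. f x \<bullet> b) z a c
        = frechet_derivative (\<lambda>x. frechet_derivative f (at x) c \<bullet> b) (at z) a"
      unfolding second_derivative_def by (rule fun_cong[OF frechet_derivative_cong_nhds])
    also have "\<dots> = second_derivative f z a c \<bullet> b"
      by (simp add: frechet_derivativeI[OF has_derivative_inner_left[OF has_derivative_directional[OF assms]]])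
    finally show ?thesis .
  qed
  moreover have "smooth_at (\<lambda>x. f x \<bullet> b) z" by (intro smooth_at_inner assms smooth_at_const)
  ultimately show "second_derivative f z u v \<bullet> b = second_derivative f z v u \<bullet> b"
    using second_derivative_commute_real[of "\<lambda>x. f x \<bullet> b" z u v] by simp
qed

section \<open>Local solutions of ordinary differential equations\<close>

lemma smooth_at_locally_lipschitz:
  fixes f :: "'a::euclidean_space \<Rightarrow> 'b::real_normed_vector"
  assumes "smooth_at f z"
  obtains r L where "r > 0" "L \<ge> 0"
    "\<And>x y. x \<in> cball z r \<Longrightarrow> y \<in> cball z r \<Longrightarrow> norm (f x - f y) \<le> L * norm (x - y)"
proof -
  let ?D = "\<lambda>x. frechet_derivative f (at x)"
  \<comment> \<open>The norms on a basis bound the operator norm; the slack \<open>1\<close> makes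
    the strict bounds at \<open>z\<close> persist nearby.\<close>
  define L where "L = (\<Sum>b\<in>Basis. norm (?D z b) + 1)"
  have "\<forall>\<^sub>F x in nhds z. norm (?D x b) < norm (?D z b) + 1" for b
    by (rule order_tendstoD[OF tendsto_norm[OF smooth_at_tendsto[OF smooth_at_directional[OF assms]]]]) simp
  then have "\<forall>\<^sub>F x in nhds z. \<forall>b\<in>Basis. norm (?D x b) < norm (?D z b) + 1"
    by (intro eventually_ball_finite) auto
  with smooth_at_eventually[OF assms]
  have "\<forall>\<^sub>F x in nhds z. smooth_at f x \<and> (\<forall>b\<in>Basis. norm (?D x b) < norm (?D z b) + 1)"
    by eventually_elim simp
  then obtain e where e: "e > 0"
    "\<And>x. x \<in> cball z e \<Longrightarrow> smooth_at f x \<and> (\<forall>b\<in>Basis. norm (?D x b) < norm (?D z b) + 1)"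
    by (auto simp: eventually_nhds_metric_le dist_commute)
  have bound: "onorm (?D x) \<le> L" if "x \<in> cball z e" for x
  proof -
    have "bounded_linear (?D x)"
      using e(2)[OF that] smooth_at_linear linear_conv_bounded_linear by blast
    then have "onorm (?D x) \<le> (\<Sum>b\<in>Basis. norm (?D x b))" by (rule onorm_componentwise)
    also have "\<dots> \<le> L" unfolding L_def using e(2)[OF that] by (intro sum_mono) (auto intro: less_imp_le)
    finally show ?thesis .
  qed
  show ?thesis
  proof (rule that[OF e(1)])
    show "L \<ge> 0" unfolding L_def by (intro sum_nonneg) auto
    show "norm (f x - f y) \<le> L * norm (x - y)" if "x \<in> cball z e" "y \<in> cball z e" for x y
      by (rule differentiable_bound[OF convex_cball _ bound that])
         (use e(2) smooth_at_has_derivative has_derivative_at_withinI in blast)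
  qed
qed

text \<open>Picard iteration as a contraction of the complete space of bounded continuous functions
  on the whole line. Time is clamped to \<open>{-h..h}\<close> by \<open>c\<close> to keep the
  iterates bounded; the fixed point solves the equation on the open interval.\<close>

lemma ode_exists_globally_lipschitz:
  fixes G :: "'a::euclidean_space \<Rightarrow> 'a"
  assumes L: "L \<ge> 0" "\<And>x y. norm (G x - G y) \<le> L * norm (x - y)"
  obtains h y where "h > 0" "y 0 = y0"
    "\<And>t. t \<in> {-h<..<h} \<Longrightarrow> (y has_vector_derivative G (y t)) (at t)"
proof -
  \<comment> \<open>The contraction estimate has the factor \<open>3 * h * L\<close>: up to
    \<open>2 * h\<close> from the integral ending at \<open>c t\<close> and \<open>h\<close> from
    the one ending at \<open>0\<close>. This choice of \<open>h\<close> makes it at most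
    \<open>3 / 4\<close>, also for \<open>L = 0\<close>.\<close>
  define h where "h = 1 / (4 * (L + 1))"
  have h: "h > 0" "3 * h * L \<le> 3 / 4" using L(1) by (simp_all add: h_def divide_simps)
  have Gc: "continuous_on UNIV G"
    unfolding continuous_on_iff
  proof (intro ballI allI impI)
    fix x :: 'a and e :: real assume "e > 0"
    have "dist (G x') (G x) < e" if "dist x' x < e / (L + 1)" for x'
    proof -
      have "dist (G x') (G x) \<le> (L + 1) * dist x' x"
        using L(2)[of x' x] by (simp add: dist_norm distrib_right add_increasing2)
      also have "\<dots> < e" using that L(1) by (simp add: pos_less_divide_eq mult.commute)
      finally show ?thesis .
    qed
    then show "\<exists>d>0. \<forall>x'\<in>UNIV. dist x' x < d \<longrightarrow> dist (G x') (G x) < e"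
      using \<open>e > 0\<close> L(1) by (intro exI[of _ "e / (L + 1)"]) auto
  qed
  define c where "c t = max (-h) (min h t)" for t :: real
  have c: "c t \<in> {-h..h}" "continuous_on UNIV c" for t
    using h by (auto simp: c_def intro!: continuous_intros)
  \<comment> \<open>The integral starts at \<open>-h\<close> because an integral over
    \<open>{0..t}\<close> would be zero for negative \<open>t\<close>; the initial value is restored
    by subtracting \<open>I y 0\<close> in \<open>P\<close>.\<close>
  define I where "I y t = integral {-h..t} (\<lambda>s. G (apply_bcontfun y s))" for y t
  have cont: "continuous_on T (\<lambda>s. G (apply_bcontfun y s))" for y T
    using continuous_on_compose2[OF Gc, of T "apply_bcontfun y"] by auto
  have int: "(\<lambda>s. G (apply_bcontfun y s)) integrable_on {a..b}" for y and a b :: real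
    by (rule integrable_continuous_real[OF cont])
  have contI: "continuous_on {-h..h} (I y)" for y
    unfolding I_def by (intro indefinite_integral_continuous_1 int)
  have bc: "(\<lambda>t. y0 + I y (c t) - I y 0) \<in> bcontfun" for y
  proof -
    have "compact (I y ` {-h..h})" by (intro compact_continuous_image contI) auto
    then obtain B where B: "\<And>t. t \<in> {-h..h} \<Longrightarrow> norm (I y t) \<le> B"
      using compact_imp_bounded bounded_iff by (metis imageI)
    show ?thesis
    proof (rule bcontfun_normI)
      show "continuous_on UNIV (\<lambda>t. y0 + I y (c t) - I y 0)"
        using c by (intro continuous_intros continuous_on_compose2[OF contI[of y] c(2)]) auto
      show "norm (y0 + I y (c t) - I y 0) \<le> norm y0 + B + norm (I y 0)" for t
        using B[OF c(1)[of t]] norm_triangle_ineq4[of "y0 + I y (c t)" "I y 0"]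
          norm_triangle_ineq[of y0 "I y (c t)"] by linarith
    qed
  qed
  define P where "P y = Bcontfun (\<lambda>t. y0 + I y (c t) - I y 0)" for y
  have P: "apply_bcontfun (P y) t = y0 + I y (c t) - I y 0" for y t
    unfolding P_def using bc by (simp add: Bcontfun_inverse)
  have Id: "norm (I y t - I z t) \<le> L * dist y z * (t + h)" if "t \<in> {-h..h}" for y z t
  proof -
    have "I y t - I z t = integral {-h..t} (\<lambda>s. G (apply_bcontfun y s) - G (apply_bcontfun z s))"
      unfolding I_def by (rule Henstock_Kurzweil_Integration.integral_diff[OF int int, symmetric])
    also have "norm \<dots> \<le> L * dist y z * (t - (-h))"
    proof (rule integral_bound)
      show "continuous_on {- h..t} (\<lambda>s. G (apply_bcontfun y s) - G (apply_bcontfun z s))"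
        by (intro continuous_on_diff cont)
      show "norm (G (apply_bcontfun y s) - G (apply_bcontfun z s)) \<le> L * dist y z" for s
      proof -
        have "norm (G (apply_bcontfun y s) - G (apply_bcontfun z s))
            \<le> L * dist (apply_bcontfun y s) (apply_bcontfun z s)"
          using L(2) by (simp add: dist_norm)
        also have "\<dots> \<le> L * dist y z" using L(1) dist_bounded by (intro mult_left_mono)
        finally show ?thesis .
      qed
    qed (use that in auto)
    finally show ?thesis by simp
  qed
  have "dist (P y) (P z) \<le> 3 / 4 * dist y z" for y z
  proof (rule dist_bound)
    fix t
    have "dist (apply_bcontfun (P y) t) (apply_bcontfun (P z) t)
        = norm ((I y (c t) - I z (c t)) - (I y 0 - I z 0))"
      by (simp add: P dist_norm algebra_simps)
    also have "\<dots> \<le> L * dist y z * (c t + h) + L * dist y z * (0 + h)"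
      using Id[OF c(1)[of t], of y z] Id[of 0 y z] h(1) norm_triangle_ineq4[of "I y (c t) - I z (c t)" "I y 0 - I z 0"]
      by simp
    also have "\<dots> \<le> L * dist y z * (h + h) + L * dist y z * (0 + h)"
      using c(1)[of t] L(1) by (intro add_right_mono mult_left_mono) auto
    also have "\<dots> = 3 * h * L * dist y z" by (simp add: algebra_simps)
    also have "\<dots> \<le> 3 / 4 * dist y z" using h(2) by (rule mult_right_mono) simp
    finally show "dist (apply_bcontfun (P y) t) (apply_bcontfun (P z) t) \<le> 3 / 4 * dist y z" .
  qed
  then obtain y where y: "P y = y" using banach_fix_type[of "3/4" P] by auto
  show ?thesis
  proof (rule that[OF h(1), of "apply_bcontfun y"])
    show "apply_bcontfun y 0 = y0"
      using P[of y 0] h(1) by (simp add: y c_def)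
    fix t assume t: "t \<in> {-h<..<h}"
    have "(I y has_vector_derivative G (apply_bcontfun y t)) (at t within {-h..h})"
      unfolding I_def using t by (intro integral_has_vector_derivative cont) auto
    then have "(I y has_vector_derivative G (apply_bcontfun y t)) (at t)"
      using t by (simp add: at_within_Icc_at)
    then have "((\<lambda>t. y0 + I y t - I y 0) has_vector_derivative G (apply_bcontfun y t)) (at t)"
      by (auto intro!: derivative_eq_intros)
    then show "(apply_bcontfun y has_vector_derivative G (apply_bcontfun y t)) (at t)"
    proof (rule has_vector_derivative_transform_within_open[of _ _ _ "{-h<..<h}"])
      fix s assume s: "s \<in> {-h<..<h}"
      then have "c s = s" by (auto simp: c_def)
      then show "y0 + I y s - I y 0 = apply_bcontfun y s" using P[of y s] by (simp add: y)
    qed (use t in auto)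
  qed
qed

text \<open>Composing \<open>F\<close> with the nearest-point projection onto a small ball, which is
  1-Lipschitz, makes it globally Lipschitz. For short times the solution stays in the ball, where
  the projection is the identity, and keeps any property \<open>Q\<close> that holds near
  \<open>y0\<close>.\<close>

lemma ode_exists:
  fixes F :: "'a::euclidean_space \<Rightarrow> 'a"
  assumes "smooth_at F y0" "\<forall>\<^sub>F x in nhds y0. Q x"
  obtains h y where "h > 0" "y 0 = y0"
    "\<And>t. t \<in> {-h<..<h} \<Longrightarrow> (y has_vector_derivative F (y t)) (at t)"
    "\<And>t. t \<in> {-h<..<h} \<Longrightarrow> Q (y t)"
proof -
  obtain r L where r: "r > 0" "L \<ge> 0" and
    lip: "\<And>x y. x \<in> cball y0 r \<Longrightarrow> y \<in> cball y0 r \<Longrightarrow> norm (F x - F y) \<le> L * norm (x - y)"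
    using smooth_at_locally_lipschitz[OF assms(1)] by blast
  let ?p = "closest_point (cball y0 r)"
  have p: "?p x \<in> cball y0 r" "norm (?p x - ?p y) \<le> norm (x - y)" for x y
    using r(1) closest_point_in_set[of "cball y0 r" x]
      closest_point_lipschitz[of "cball y0 r" x y] by (auto simp: dist_norm)
  have "norm (F (?p x) - F (?p y)) \<le> L * norm (x - y)" for x y
    using lip[OF p(1) p(1)] mult_left_mono[OF p(2) r(2)] by (rule order_trans)
  then obtain h y where h: "h > 0" "y 0 = y0"
    "\<And>t. t \<in> {-h<..<h} \<Longrightarrow> (y has_vector_derivative F (?p (y t))) (at t)"
    using ode_exists_globally_lipschitz[of L "\<lambda>x. F (?p x)" y0] r(2) by blast
  have "isCont y 0" using h(1) by (intro has_vector_derivative_continuous[OF h(3)]) auto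
  then have "filterlim y (nhds y0) (nhds 0)" using h(2) by (metis isCont_def tendsto_at_iff_tendsto_nhds)
  moreover have "\<forall>\<^sub>F x in nhds y0. Q x \<and> x \<in> ball y0 r"
    using assms(2) r(1) eventually_nhds_in_open[of "ball y0 r" y0] by (simp add: eventually_conj)
  ultimately have "\<forall>\<^sub>F t in nhds 0. Q (y t) \<and> y t \<in> ball y0 r"
    by (rule eventually_compose_filterlim[rotated])
  then obtain k where k: "k > 0" "\<And>t. \<bar>t\<bar> < k \<Longrightarrow> Q (y t) \<and> y t \<in> ball y0 r"
    by (auto simp: eventually_nhds_metric dist_real_def)
  show ?thesis
  proof (rule that[of "min h k" y])
    fix t assume t: "t \<in> {- min h k<..<min h k}"
    then have "y t \<in> ball y0 r" using k(2)[of t] by auto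
    then have "?p (y t) = y t" by (intro closest_point_self) auto
    then show "(y has_vector_derivative F (y t)) (at t)" using h(3)[of t] t by auto
    show "Q (y t)" using k(2)[of t] t by auto
  qed (use h k in auto)
qed

section \<open>Lorentz inner products\<close>

text \<open>The map \<open>f\<close> collects the products of \<open>x\<close> with a basis of
  \<open>S\<close> as coefficients of that basis. Nondegeneracy makes it injective on
  \<open>S\<close>, hence onto \<open>S\<close> by dimension, so some \<open>z\<close> in
  \<open>S\<close> has the same products with \<open>S\<close> as \<open>x\<close>.\<close>

lemma nondegenerate_orthogonal_decomp:
  fixes ip :: "'e::euclidean_space \<Rightarrow> 'e \<Rightarrow> real"
  assumes ip: "bilinear ip" and S: "subspace S" and nd: "nondegenerate_on S ip"
    and sym: "\<And>u v. ip u v = ip v u"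
  obtains z where "z \<in> S" "\<And>w. w \<in> S \<Longrightarrow> ip w (x - z) = 0"
proof -
  obtain B where B: "B \<subseteq> S" "independent B" "S \<subseteq> span B"
    using basis_exists[of S] by metis
  then have fin: "finite B" and sp: "span B = S"
    using independent_imp_finite S span_minimal by blast+
  define f where "f x = (\<Sum>b\<in>B. ip b x *\<^sub>R b)" for x
  have lin: "linear f"
    unfolding f_def
    by (intro linearI) (simp_all add: bilinear_radd[OF ip] bilinear_rmul[OF ip] scaleR_add_left
        sum.distrib scaleR_sum_right)
  have ker: "ip w x = 0" if "f x = 0" "w \<in> S" for x w
  proof -
    have "ip b x = 0" if "b \<in> B" for b
      using independentD[OF B(2) fin order_refl, of "\<lambda>b. ip b x"] \<open>f x = 0\<close> that by (simp add: f_def)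
    then have "subspace {w. ip w x = 0}" "B \<subseteq> {w. ip w x = 0}"
      by (auto simp: subspace_def bilinear_ladd[OF ip] bilinear_lmul[OF ip] bilinear_lzero[OF ip])
    then show ?thesis using that(2) span_minimal sp by blast
  qed
  have "x = 0" if "x \<in> S" "f x = 0" for x
  proof -
    have "\<forall>w\<in>S. ip x w = 0" using ker[OF that(2)] by (simp add: sym[of x])
    then show ?thesis using nd that(1) by (simp add: nondegenerate_on_def)
  qed
  then have "inj_on f S" by (simp add: linear_inj_on_iff_eq_0[OF lin S])
  moreover have "span S = S" using S by (simp only: span_eq_iff)
  ultimately have "inj_on f (span S)" by (simp only:)
  then have "dim (f ` S) = dim S" by (rule dim_image_eq[OF lin])
  moreover have "f ` S \<subseteq> S"
    unfolding f_def using B(1) by (intro image_subsetI subspace_sum[OF S] subspace_scale[OF S]) auto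
  moreover have "subspace (f ` S)" using lin S by (rule linear_subspace_image)
  ultimately have "f ` S = S" using S by (intro subspace_dim_equal) auto
  moreover have "f x \<in> S" unfolding f_def using B(1) by (intro subspace_sum[OF S] subspace_scale[OF S]) auto
  ultimately obtain z where "z \<in> S" "f x = f z" by blast
  then have "f (x - z) = 0" by (simp add: linear_diff[OF lin])
  with ker \<open>z \<in> S\<close> that show ?thesis by blast
qed

text \<open>The orthogonal complement of the timelike basis vector \<open>b\<close> is positive
  definite. Some nontrivial combination of \<open>x\<close> and \<open>y\<close> is orthogonal to
  \<open>b\<close>, and its square is nonpositive because the mixed term vanishes; so it is
  zero.\<close>

lemma lorentz_nonpos_dependent:
  assumes "lorentz_inner_product ip" "ip x x \<le> 0" "ip y y \<le> 0" "ip x y = 0"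
  obtains a b where "a *\<^sub>R x + b *\<^sub>R y = 0" "a \<noteq> 0 \<or> b \<noteq> (0::real)"
proof -
  from assms(1) obtain B b where ip: "bilinear ip" and sym: "\<And>u v. ip u v = ip v u"
    and B: "independent B" "span B = UNIV" "\<And>u v. u \<in> B \<Longrightarrow> v \<in> B \<Longrightarrow> u \<noteq> v \<Longrightarrow> ip u v = 0"
    and b: "b \<in> B" "ip b b = -1" "\<And>u. u \<in> B \<Longrightarrow> u \<noteq> b \<Longrightarrow> ip u u = 1"
    unfolding lorentz_inner_product_def by blast
  have fin: "finite B" using B(1) by (rule independent_imp_finite)
  have spacelike: "x = 0" if "ip x b = 0" "ip x x \<le> 0" for x
  proof -
    have "x \<in> range (\<lambda>c. \<Sum>u\<in>B. c u *\<^sub>R u)"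
      using B(2) by (simp flip: span_finite[OF fin])
    then obtain c where c: "x = (\<Sum>u\<in>B. c u *\<^sub>R u)" by blast
    have xu: "ip x u = c u * ip u u" if "u \<in> B" for u
    proof -
      have "ip x u = (\<Sum>v\<in>B. c v * ip v u)"
        unfolding c using linear_sum[of "\<lambda>x. ip x u" "\<lambda>v. c v *\<^sub>R v" B] ip
        by (simp add: bilinear_def bilinear_lmul[OF ip])
      also have "\<dots> = (\<Sum>v\<in>B. if v = u then c u * ip u u else 0)"
        using B(3) that by (intro sum.cong) auto
      finally show ?thesis using fin that by simp
    qed
    have "c b = 0" using xu[OF b(1)] that(1) b(2) by simp
    have "ip x x = (\<Sum>u\<in>B. c u * ip x u)"
      using linear_sum[of "ip x" "\<lambda>u. c u *\<^sub>R u" B] ip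
      by (simp add: bilinear_def bilinear_rmul[OF ip] flip: c)
    also have "\<dots> = (\<Sum>u\<in>B. (c u)\<^sup>2)"
      using xu b \<open>c b = 0\<close> by (intro sum.cong) (auto simp: power2_eq_square)
    finally have "(\<Sum>u\<in>B. (c u)\<^sup>2) = 0" using that(2) by (simp add: antisym sum_nonneg)
    then show "x = 0" using fin unfolding c by (simp add: sum_nonneg_eq_0_iff)
  qed
  show ?thesis
  proof (cases "ip x b = 0 \<and> ip y b = 0")
    case True
    then show ?thesis using spacelike[of x] assms(2) that[of 1 0] by simp
  next
    case False
    let ?w = "ip y b *\<^sub>R x + (- ip x b) *\<^sub>R y"
    have "ip ?w b = 0"
      by (simp only: bilinear_ladd[OF ip] bilinear_lmul[OF ip]) (simp add: algebra_simps)
    moreover have "ip ?w ?w = (ip y b)\<^sup>2 * ip x x + (ip x b)\<^sup>2 * ip y y"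
      using assms(4) sym[of y x]
      by (simp only: bilinear_ladd[OF ip] bilinear_lmul[OF ip] bilinear_radd[OF ip] bilinear_rmul[OF ip])
         (simp add: algebra_simps power2_eq_square)
    then have "ip ?w ?w \<le> 0"
      using assms(2,3) by (simp add: mult_nonneg_nonpos add_nonpos_nonpos)
    ultimately have "?w = 0" by (rule spacelike)
    then show ?thesis using that[of "ip y b" "- ip x b"] False by auto
  qed
qed

text \<open>A radical vector is linearly dependent with the timelike vector \<open>b\<close>, and
  pairing the relation with \<open>b\<close> shows that \<open>b\<close> does not occur in
  it.\<close>

lemma lorentz_nondegenerate:
  assumes l: "lorentz_inner_product ip" and u: "\<And>v. ip u v = 0"
  shows "u = 0"
proof -
  obtain b where b: "ip b b = -1" and ip: "bilinear ip"
    using l unfolding lorentz_inner_product_def by blast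
  obtain r s where rs: "r *\<^sub>R u + s *\<^sub>R b = 0" "r \<noteq> 0 \<or> s \<noteq> 0"
    using lorentz_nonpos_dependent[OF l, of u b] u b by auto
  have "ip (r *\<^sub>R u + s *\<^sub>R b) b = - s"
    by (simp add: bilinear_ladd[OF ip] bilinear_lmul[OF ip] u b)
  then have "s = 0" by (simp add: rs(1) bilinear_lzero[OF ip])
  then show ?thesis using rs by simp
qed


section \<open>Lorentz geodesic orbit nilpotent Lie algebras\<close>

lemma linear_foldr:
  assumes "bilinear br" shows "linear (foldr br us)"
proof (induction us)
  case Nil
  then show ?case by (simp add: linear_iff)
next
  case (Cons u us)
  have "linear (br u)" using assms by (simp add: bilinear_def)
  then show ?case using Cons linear_compose[of "foldr br us" "br u"] by (simp add: o_def)
qed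

text \<open>What is kept of the group. The derivation \<open>D\<close> stands for the action of the
  isotropy element belonging to \<open>T\<close>. Nilpotency is stated for nested brackets
  \<open>[u1, [u2, ..., [uk, v]]]\<close>, the form in which it is derived from the group.\<close>

locale lorentz_go_algebra =
  fixes br :: "'e::euclidean_space \<Rightarrow> 'e \<Rightarrow> 'e" and ip :: "'e \<Rightarrow> 'e \<Rightarrow> real" and k :: nat
  assumes br: "bilinear br" and br_self: "br u u = 0"
    and jacobi: "br w (br u v) = br (br w u) v + br u (br w v)"
    and nilpotent: "length us = k \<Longrightarrow> foldr br us v = 0"
    and lorentz: "lorentz_inner_product ip"
    and nondegenerate: "nondegenerate_on (derived_algebra br) ip"
    and geodesic_lemma: "\<exists>D c. linear D \<and> (\<forall>u v. D (br u v) = br (D u) v + br u (D v)) \<and>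
       (\<forall>u v. ip (D u) v = - ip u (D v)) \<and> (\<forall>w. ip (br T w + D w) T = c * ip T w)"
begin

abbreviation "DD \<equiv> derived_algebra br"

definition "VV = {x. \<forall>z\<in>DD. ip x z = 0}"

lemma ip: "bilinear ip" and ip_sym: "ip u v = ip v u"
  using lorentz by (auto simp: lorentz_inner_product_def)

lemmas br_simps = bilinear_ladd[OF br] bilinear_lmul[OF br] bilinear_radd[OF br] bilinear_rmul[OF br]
  bilinear_lneg[OF br] bilinear_rneg[OF br] bilinear_lzero[OF br] bilinear_rzero[OF br]
  bilinear_lsub[OF br] bilinear_rsub[OF br]

lemmas ip_simps = bilinear_ladd[OF ip] bilinear_lmul[OF ip] bilinear_radd[OF ip] bilinear_rmul[OF ip]
  bilinear_lneg[OF ip] bilinear_rneg[OF ip] bilinear_lzero[OF ip] bilinear_rzero[OF ip]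
  bilinear_lsub[OF ip] bilinear_rsub[OF ip]

lemma br_anti: "br u v = - br v u"
proof -
  have "br u u + br v u + (br u v + br v v) = 0"
    using br_self[of "u + v"] by (simp only: bilinear_ladd[OF br] bilinear_radd[OF br])
  then show ?thesis by (simp add: br_self eq_neg_iff_add_eq_0 add.commute)
qed

lemma subspace_DD: "subspace DD" by (simp add: bracket_span_def)

lemma br_in_DD: "br u v \<in> DD"
  unfolding bracket_span_def by (rule span_base) auto

lemma DD_induct:
  assumes "z \<in> DD" "subspace {z. P z}" "\<And>u v. P (br u v)"
  shows "P z"
  using span_minimal[of "{br u v |u v. u \<in> UNIV \<and> v \<in> UNIV}" "{z. P z}"] assms
  by (auto simp: bracket_span_def)

lemma subspace_VV: "subspace VV"
  by (auto simp: subspace_def VV_def ip_simps)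

lemma VV_DD: "x \<in> VV \<Longrightarrow> z \<in> DD \<Longrightarrow> ip x z = 0" "x \<in> VV \<Longrightarrow> z \<in> DD \<Longrightarrow> ip z x = 0"
  by (auto simp: VV_def ip_sym)

lemma DD_eq_0: "z \<in> DD \<Longrightarrow> (\<And>w. w \<in> DD \<Longrightarrow> ip z w = 0) \<Longrightarrow> z = 0"
  using nondegenerate by (auto simp: nondegenerate_on_def)

lemma VV_DD_eq_0: "x \<in> VV \<Longrightarrow> x \<in> DD \<Longrightarrow> x = 0"
  using DD_eq_0 VV_DD by blast

lemma decomp: obtains x z where "x \<in> VV" "z \<in> DD" "u = x + z"
proof -
  obtain z where "z \<in> DD" "\<And>w. w \<in> DD \<Longrightarrow> ip w (u - z) = 0"
    using nondegenerate_orthogonal_decomp[OF ip subspace_DD nondegenerate ip_sym] by blast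
  then show ?thesis using that[of "u - z" z] by (auto simp: VV_def ip_sym)
qed

primrec lcs :: "nat \<Rightarrow> 'e set" where
  "lcs 0 = UNIV"
| "lcs (Suc j) = bracket_span br UNIV (lcs j)"

lemma subspace_lcs: "subspace (lcs j)"
  by (cases j) (simp_all add: bracket_span_def)

lemma br_in_lcs: "c \<in> lcs j \<Longrightarrow> br u c \<in> lcs (Suc j)" "c \<in> lcs j \<Longrightarrow> br c u \<in> lcs (Suc j)"
proof -
  show *: "br u c \<in> lcs (Suc j)" if "c \<in> lcs j" for u c
    using that by (auto simp: bracket_span_def intro!: span_base)
  show "br c u \<in> lcs (Suc j)" if "c \<in> lcs j"
    using subspace_neg[OF subspace_lcs *[OF that, of u]] br_anti[of c u] by simp
qed

text \<open>For \<open>j = k\<close> and \<open>us = []\<close> this yields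
  \<open>lcs k = {0}\<close>. The prefix \<open>us\<close> is carried along because the induction
  trades one bracket of \<open>lcs\<close> for one entry at the end of \<open>us\<close>.\<close>

lemma foldr_lcs: "c \<in> lcs j \<Longrightarrow> length us + j = k \<Longrightarrow> foldr br us c = 0"
proof (induction j arbitrary: us c)
  case 0
  then show ?case using nilpotent by simp
next
  case (Suc j)
  have "subspace {c. foldr br us c = 0}"
    using linear_foldr[OF br, of us] by (rule linear_subspace_kernel)
  moreover have "{br u v |u v. u \<in> UNIV \<and> v \<in> lcs j} \<subseteq> {c. foldr br us c = 0}"
    using Suc.IH[of _ "us @ [_]"] Suc.prems(2) by auto
  ultimately have "lcs (Suc j) \<subseteq> {c. foldr br us c = 0}"
    unfolding lcs.simps bracket_span_def by (intro span_minimal)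
  with Suc.prems(1) show ?case by blast
qed

text \<open>A subalgebra \<open>S\<close> containing a complement of \<open>DD\<close> satisfies \<open>S + lcs j = UNIV\<close> for every \<open>j\<close>.\<close>

lemma VV_generates:
  assumes S: "subspace S" "\<And>u v. u \<in> S \<Longrightarrow> v \<in> S \<Longrightarrow> br u v \<in> S" "VV \<subseteq> S"
  shows "u \<in> S"
proof -
  have "\<exists>s\<in>S. u - s \<in> lcs j" for j u
  proof (induction j arbitrary: u)
    case 0
    then show ?case using subspace_0[OF S(1)] by auto
  next
    case (Suc j)
    define P where "P z \<longleftrightarrow> (\<exists>s\<in>S. z - s \<in> lcs (Suc j))" for z
    have add: "P (x + y)" if xy: "P x" "P y" for x y
    proof -
      from xy obtain s t where st: "s \<in> S" "x - s \<in> lcs (Suc j)" "t \<in> S" "y - t \<in> lcs (Suc j)"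
        unfolding P_def by blast
      from subspace_add[OF subspace_lcs st(2,4)] subspace_add[OF S(1) st(1,3)] show ?thesis
        unfolding P_def by (intro bexI[of _ "s + t"]) (simp_all del: lcs.simps add: algebra_simps)
    qed
    have scale: "P (c *\<^sub>R x)" if x: "P x" for c x
    proof -
      from x obtain s where s: "s \<in> S" "x - s \<in> lcs (Suc j)" unfolding P_def by blast
      from subspace_scale[OF subspace_lcs s(2), of c] subspace_scale[OF S(1) s(1), of c] show ?thesis
        unfolding P_def by (intro bexI[of _ "c *\<^sub>R s"]) (simp_all del: lcs.simps add: algebra_simps)
    qed
    have inS: "P x" if "x \<in> S" for x
      unfolding P_def using that subspace_0[OF subspace_lcs] by (intro bexI[of _ x]) (simp_all del: lcs.simps)
    have inL: "P x" if "x \<in> lcs (Suc j)" for x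
      unfolding P_def using that subspace_0[OF S(1)] by (intro bexI[of _ 0]) (simp_all del: lcs.simps)
    have "P (br a b)" for a b
    proof -
      obtain s t where st: "s \<in> S" "a - s \<in> lcs j" "t \<in> S" "b - t \<in> lcs j"
        using Suc.IH by meson
      \<comment> \<open>The first term stays in the subalgebra \<open>S\<close>; the other two
        contain a factor from \<open>lcs j\<close> and so lie in \<open>lcs (Suc j)\<close>.\<close>
      have "br a b = br s t + (br s (b - t) + br (a - s) b)" by (simp add: br_simps)
      then show ?thesis
        using inS[OF S(2)[OF st(1,3)]] inL[OF br_in_lcs(1)[OF st(4)]] inL[OF br_in_lcs(2)[OF st(2)]] add by metis
    qed
    moreover have "subspace {z. P z}"
      using add scale inS[OF subspace_0[OF S(1)]] by (simp add: subspace_def)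
    ultimately have "P z" if "z \<in> DD" for z using DD_induct[OF that] by blast
    moreover obtain x z where "x \<in> VV" "z \<in> DD" "u = x + z" by (rule decomp)
    ultimately have "P u" using add inS S(3) by blast
    then show ?case by (simp add: P_def)
  qed
  then obtain s where "s \<in> S" "u - s \<in> lcs k" by blast
  then show ?thesis using foldr_lcs[of "u - s" k "[]"] by simp
qed

lemma derivation_DD:
  assumes "linear D" "\<And>u v. D (br u v) = br (D u) v + br u (D v)" "z \<in> DD"
  shows "D z \<in> DD"
proof (rule DD_induct[OF assms(3)])
  show "subspace {z. D z \<in> DD}"
    using subspace_DD by (auto simp: subspace_def linear_add[OF assms(1)] linear_scale[OF assms(1)] linear_0[OF assms(1)])
  show "D (br u v) \<in> DD" for u v
    using assms(2) br_in_DD subspace_add[OF subspace_DD] by simp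
qed

text \<open>For \<open>w = T\<close> both \<open>br T T\<close> and \<open>ip (D T) T\<close>
  vanish, which leaves \<open>c * ip T T = 0\<close>.\<close>

lemma geodesic_nonnull:
  assumes "ip T T \<noteq> 0"
  obtains D where "linear D" "\<And>u v. D (br u v) = br (D u) v + br u (D v)"
    "\<And>u v. ip (D u) v = - ip u (D v)" "\<And>w. ip (br T w + D w) T = 0"
proof -
  obtain D c where D: "linear D" "\<And>u v. D (br u v) = br (D u) v + br u (D v)"
    "\<And>u v. ip (D u) v = - ip u (D v)" "\<And>w. ip (br T w + D w) T = c * ip T w"
    using geodesic_lemma by blast
  have "ip (D T) T = 0" using D(3)[of T T] ip_sym[of T "D T"] by simp
  then have "c = 0" using D(4)[of T] assms by (simp add: br_self)
  with D that show ?thesis by simp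
qed

text \<open>Testing the Geodesic Lemma for \<open>T = x + s *\<^sub>R z\<close> on
  \<open>w = z\<close>, all products of \<open>VV\<close> with \<open>DD\<close> drop out and
  \<open>s * ip (br x z) z\<close> remains. If no nonzero \<open>s\<close> makes \<open>T\<close>
  non-null, then \<open>x\<close> and \<open>z\<close> are orthogonal of nonpositive square, hence
  dependent, and one of them is zero.\<close>

lemma skew_VV_diag:
  assumes x: "x \<in> VV" and z: "z \<in> DD"
  shows "ip (br x z) z = 0"
proof (cases "\<exists>s. s \<noteq> 0 \<and> ip (x + s *\<^sub>R z) (x + s *\<^sub>R z) \<noteq> 0")
  case True
  then obtain s where s: "s \<noteq> 0" "ip (x + s *\<^sub>R z) (x + s *\<^sub>R z) \<noteq> 0" by blast
  obtain D where D: "linear D" "\<And>u v. D (br u v) = br (D u) v + br u (D v)"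
    "\<And>u v. ip (D u) v = - ip u (D v)" "\<And>w. ip (br (x + s *\<^sub>R z) w + D w) (x + s *\<^sub>R z) = 0"
    using geodesic_nonnull[OF s(2)] by metis
  have "ip (D z) z = 0" using D(3)[of z z] ip_sym[of z "D z"] by simp
  moreover have "ip (D z) x = 0" "ip (br x z) x = 0"
    using derivation_DD[OF D(1,2) z] br_in_DD x VV_DD by blast+
  ultimately have "s * ip (br x z) z = 0"
    using D(4)[of z] by (simp add: ip_simps br_simps br_self)
  then show ?thesis using s(1) by simp
next
  case False
  have e: "ip (x + s *\<^sub>R z) (x + s *\<^sub>R z) = ip x x + s * s * ip z z" for s
    using VV_DD[OF x z] by (simp add: ip_simps)
  have "ip x x + s * s * ip z z = 0" if "s \<noteq> 0" for s
    using False that e[of s] by metis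
  from this[of 1] this[of 2] have "ip x x + ip z z = 0" "ip x x + 4 * ip z z = 0" by simp_all
  then have "ip x x \<le> 0" "ip z z \<le> 0" by linarith+
  then obtain a b where ab: "a *\<^sub>R x + b *\<^sub>R z = 0" "a \<noteq> 0 \<or> b \<noteq> 0"
    using lorentz_nonpos_dependent[OF lorentz _ _ VV_DD(1)[OF x z]] by blast
  have "a *\<^sub>R x = (- b) *\<^sub>R z" using ab(1) by (simp add: eq_neg_iff_add_eq_0)
  then have "a *\<^sub>R x \<in> DD" using subspace_scale[OF subspace_DD z] by metis
  then have "a *\<^sub>R x = 0" using VV_DD_eq_0 subspace_scale[OF subspace_VV x] by blast
  then have "x = 0 \<or> z = 0" using ab by auto
  then show ?thesis by (auto simp: br_simps ip_simps)
qed

lemma skew: 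
  assumes "z \<in> DD" "w \<in> DD"
  shows "ip (br u z) w = - ip z (br u w)"
proof -
  define S where "S = {u. \<forall>z\<in>DD. \<forall>w\<in>DD. ip (br u z) w = - ip z (br u w)}"
  have "subspace S" by (auto simp: S_def subspace_def br_simps ip_simps algebra_simps)
  moreover have "br a b \<in> S" if "a \<in> S" "b \<in> S" for a b
    unfolding S_def
  proof (intro CollectI ballI)
    fix z w assume zw: "z \<in> DD" "w \<in> DD"
    have e: "br (br a b) y = br a (br b y) - br b (br a y)" for y using jacobi[of a b y] by simp
    have "ip (br (br a b) z) w = - ip (br b z) (br a w) + ip (br a z) (br b w)"
      unfolding e using that zw br_in_DD by (simp add: S_def ip_simps)
    also have "\<dots> = ip z (br b (br a w)) - ip z (br a (br b w))"
      using that zw br_in_DD by (simp add: S_def ip_simps)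
    finally show "ip (br (br a b) z) w = - ip z (br (br a b) w)" unfolding e by (simp add: ip_simps)
  qed
  moreover have "VV \<subseteq> S"
  proof
    fix x assume x: "x \<in> VV"
    have "ip (br x z) w + ip z (br x w) = 0" if "z \<in> DD" "w \<in> DD" for z w
      using skew_VV_diag[OF x subspace_add[OF subspace_DD that]] skew_VV_diag[OF x that(1)]
        skew_VV_diag[OF x that(2)] ip_sym[of z "br x w"]
      by (simp add: ip_simps br_simps)
    then show "x \<in> S" unfolding S_def by (simp add: eq_neg_iff_add_eq_0)
  qed
  ultimately have "u \<in> S" by (rule VV_generates)
  with assms show ?thesis by (simp add: S_def)
qed

lemma foldr_long: "k \<le> length us \<Longrightarrow> foldr br us v = 0"
  using nilpotent[of "take k us" "foldr br (drop k us) v"] by (simp flip: foldr_append)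

lemma foldr_DD: "z \<in> DD \<Longrightarrow> foldr br us z \<in> DD"
  by (induction us) (auto simp: br_in_DD)

end

text \<open>
  If \<open>[\<nn>, [\<nn>, \<nn>]] \<noteq> 0\<close>, then the last nonzero iterated bracket \<open>e\<close> is a central null
  vector.
\<close>

locale lorentz_go_counterexample = lorentz_go_algebra +
  fixes e u\<^sub>0 z\<^sub>0 :: 'a
  assumes e_nonzero: "e \<noteq> 0" and central: "br u e = 0" and e_br: "e = br u\<^sub>0 z\<^sub>0" and z0: "z\<^sub>0 \<in> DD"
begin

lemma e_DD: "e \<in> DD" using e_br br_in_DD by simp

text \<open>Skewness gives \<open>ip e e = - ip z\<^sub>0 (br u\<^sub>0 e)\<close>, and
  \<open>e\<close> is central.\<close>

lemma e_null: "ip e e = 0"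
  using skew[OF z0 e_DD, of u\<^sub>0] by (simp add: central ip_simps flip: e_br)

lemma br_perp_e: "z \<in> DD \<Longrightarrow> ip (br u z) e = 0" "z \<in> DD \<Longrightarrow> ip e (br u z) = 0"
  using skew[OF _ e_DD] by (simp_all add: central ip_simps ip_sym[of e])

text \<open>Vanishing modulo \<open>e\<close>: this predicate replaces the quotient by the line of
  \<open>e\<close>, in which the following computations take place.\<close>

definition on_line :: "'a \<Rightarrow> bool" where "on_line x \<longleftrightarrow> (\<exists>c. x = c *\<^sub>R e)"

lemma subspace_on_line: "subspace {x. on_line x}"
proof -
  have "{x. on_line x} = span {e}" by (auto simp: on_line_def span_singleton)
  then show ?thesis by simp
qed

lemma on_line_intros:
  "on_line 0" "on_line x \<Longrightarrow> on_line y \<Longrightarrow> on_line (x + y)" "on_line x \<Longrightarrow> on_line (c *\<^sub>R x)"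
  "on_line x \<Longrightarrow> on_line y \<Longrightarrow> on_line (x - y)" "on_line x \<Longrightarrow> on_line (- x)"
  using subspace_0[OF subspace_on_line] subspace_add[OF subspace_on_line, of x y]
    subspace_scale[OF subspace_on_line, of x c] subspace_diff[OF subspace_on_line, of x y]
    subspace_neg[OF subspace_on_line, of x]
  by simp_all

lemma on_line_scaleD: "on_line (c *\<^sub>R x) \<Longrightarrow> c \<noteq> 0 \<Longrightarrow> on_line x"
  using on_line_intros(3)[of "c *\<^sub>R x" "1 / c"] by simp

text \<open>Positive definiteness of the orthogonal complement of \<open>e\<close> modulo
  \<open>e\<close>: \<open>x\<close> and the null vector \<open>e\<close> are linearly
  dependent.\<close>

lemma nonpos_on_line:
  assumes "ip x e = 0" "ip x x \<le> 0" shows "on_line x"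
proof -
  obtain a b where ab: "a *\<^sub>R x + b *\<^sub>R e = 0" "a \<noteq> 0 \<or> b \<noteq> 0"
    using lorentz_nonpos_dependent[OF lorentz assms(2) _ assms(1)] e_null by auto
  have "a \<noteq> 0" using ab e_nonzero by auto
  moreover have "a *\<^sub>R x = (- b) *\<^sub>R e" using ab(1) by (simp add: eq_neg_iff_add_eq_0)
  ultimately show ?thesis using on_line_scaleD unfolding on_line_def by metis
qed

text \<open>\<open>VV\<close> is orthogonal to \<open>e\<close> and meets the line of
  \<open>e\<close>, which lies in \<open>DD\<close>, only in zero.\<close>

lemma VV_pos: assumes "x \<in> VV" "x \<noteq> 0" shows "ip x x > 0"
proof (rule ccontr)
  assume "\<not> ip x x > 0"
  then have "on_line x" using nonpos_on_line VV_DD[OF assms(1) e_DD] by simp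
  then have "x \<in> DD" using subspace_scale[OF subspace_DD e_DD] by (auto simp: on_line_def)
  then show False using VV_DD_eq_0 assms by blast
qed

text \<open>\<open>ad u\<close> is nilpotent and skew on the definite space \<open>e\<^sup>\<bottom> / e\<close>, hence zero there.\<close>

lemma br_on_line:
  assumes y: "y \<in> DD" "ip y e = 0" shows "on_line (br u y)"
proof -
  define p where "p j = foldr br (replicate j u) y" for j
  have pS: "p (Suc j) = br u (p j)" for j by (simp add: p_def)
  have pD: "p j \<in> DD" for j unfolding p_def using y(1) by (rule foldr_DD)
  have pe: "ip (p j) e = 0" for j
    using y(2) pD by (cases j) (auto simp: pS br_perp_e, simp add: p_def)
  have "on_line (p (Suc d)) \<Longrightarrow> on_line (p (Suc 0))" for d
  proof (induction d)
    case (Suc d)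
    obtain c where c: "p (Suc (Suc d)) = c *\<^sub>R e" using Suc.prems by (auto simp: on_line_def)
    \<comment> \<open>Descent: if the iterate two steps further is a multiple of \<open>e\<close>,
      to which \<open>p d\<close> is orthogonal, then \<open>p (Suc d)\<close> is null and lies on
      the line as well.\<close>
    have "ip (p (Suc d)) (p (Suc d)) = - ip (p d) (p (Suc (Suc d)))"
      using skew[OF pD pD, of u d "Suc d"] by (simp add: pS)
    also have "\<dots> = 0" by (simp add: c ip_simps pe)
    finally show ?case using Suc.IH nonpos_on_line pe by simp
  qed simp
  moreover have "p (Suc k) = 0" unfolding p_def by (rule foldr_long) simp
  ultimately have "on_line (p (Suc 0))" using on_line_intros(1) by metis
  then show ?thesis by (simp add: p_def)
qed

text \<open>By the Jacobi identity \<open>br (br a b) z\<close> is \<open>c - d\<close> times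
  \<open>e\<close>. Pairing both double brackets with \<open>z\<close> gives the same number
  \<open>- ip (br a z) (br b z)\<close>, so \<open>c = d\<close> unless \<open>z\<close> is
  orthogonal to \<open>e\<close>; in that case \<open>br a z\<close> and \<open>br b z\<close> are
  themselves multiples of the central \<open>e\<close>.\<close>

lemma DD_abelian: assumes w: "w \<in> DD" and z: "z \<in> DD" shows "br w z = 0"
proof (rule DD_induct[OF w])
  show "subspace {w. br w z = 0}" by (auto simp: subspace_def br_simps)
  fix a b
  obtain c where c: "br a (br b z) = c *\<^sub>R e"
    using br_on_line[OF br_in_DD br_perp_e(1)[OF z]] by (auto simp: on_line_def)
  obtain d where d: "br b (br a z) = d *\<^sub>R e"
    using br_on_line[OF br_in_DD br_perp_e(1)[OF z]] by (auto simp: on_line_def)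
  have j: "br (br a b) z = (c - d) *\<^sub>R e" using jacobi[of a b z] by (simp add: c d algebra_simps)
  have "c * ip e z = d * ip e z"
    using skew[OF br_in_DD z, of a b z] skew[OF br_in_DD z, of b a z] ip_sym[of "br a z" "br b z"]
    by (simp add: c d ip_simps)
  show "br (br a b) z = 0"
  proof (cases "ip e z = 0")
    case True
    then have "on_line (br a z)" "on_line (br b z)" using br_on_line[OF z] by (simp_all add: ip_sym)
    then show ?thesis using c d jacobi[of a b z] by (auto simp: on_line_def br_simps central)
  next
    case False
    then show ?thesis using j \<open>c * ip e z = d * ip e z\<close> by simp
  qed
qed

text \<open>
  Modulo the line of \<open>e\<close>, \<open>br x z\<close> depends on \<open>z \<in> DD\<close> only through \<open>ip e z\<close>, so the Jacobi
  identity becomes the cyclic identity \<open>om_cyclic\<close>. It forces the space \<open>V1\<close> below, on which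
  \<open>x \<mapsto> br x z\<^sub>1\<close> is injective modulo \<open>e\<close>, to be a plane.
\<close>

definition "om x y = ip e (br x y)"

lemma om_simps: "om (x + y) z = om x z + om y z" "om x (y + z) = om x y + om x z"
  "om (x - y) z = om x z - om y z" "om x (y - z) = om x y - om x z"
  "om (c *\<^sub>R x) y = c * om x y" "om x (c *\<^sub>R y) = c * om x y" "om x x = 0" "om 0 x = 0"
  by (simp_all add: om_def ip_simps br_simps br_self)

lemma om_anti: "om x y = - om y x"
  by (simp add: om_def br_anti[of x y] ip_simps)

lemma om_DD: "z \<in> DD \<Longrightarrow> om x z = 0" "z \<in> DD \<Longrightarrow> om z x = 0"
  by (simp_all add: om_def br_perp_e br_anti[of z] ip_simps)

text \<open>Otherwise \<open>e\<close> would be orthogonal to all brackets, against nondegeneracy on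
  \<open>DD\<close>. Components in \<open>DD\<close> do not contribute to \<open>om\<close>.\<close>

lemma om_nonzero: obtains x y where "x \<in> VV" "y \<in> VV" "om x y \<noteq> 0"
proof -
  have "\<exists>u v. om u v \<noteq> 0"
  proof (rule ccontr)
    assume *: "\<not> ?thesis"
    have "ip e z = 0" if "z \<in> DD" for z
      by (rule DD_induct[OF that]) (use * in \<open>auto simp: om_def subspace_def ip_simps\<close>)
    then show False using DD_eq_0 e_DD e_nonzero by blast
  qed
  then obtain u v where uv: "om u v \<noteq> 0" by blast
  obtain x z where x: "x \<in> VV" "z \<in> DD" "u = x + z" by (rule decomp)
  obtain y w where y: "y \<in> VV" "w \<in> DD" "v = y + w" by (rule decomp)
  have "om u v = om x y" by (simp add: x(3) y(3) om_simps om_DD x(2) y(2))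
  with uv x y that show ?thesis by simp
qed

text \<open>A vector of \<open>DD\<close> dual to \<open>e\<close>, provided by nondegeneracy. It
  spans the one direction of \<open>DD\<close> on which the operators \<open>br x\<close> can be
  nonzero modulo \<open>e\<close>.\<close>

definition "z\<^sub>1 = (SOME z. z \<in> DD \<and> ip e z = 1)"

lemma z1: "z\<^sub>1 \<in> DD" "ip e z\<^sub>1 = 1"
proof -
  obtain z where z: "z \<in> DD" "ip e z \<noteq> 0" using DD_eq_0 e_DD e_nonzero by blast
  then have "(1 / ip e z) *\<^sub>R z \<in> DD \<and> ip e ((1 / ip e z) *\<^sub>R z) = 1"
    using subspace_scale[OF subspace_DD] by (simp add: ip_simps)
  then have "z\<^sub>1 \<in> DD \<and> ip e z\<^sub>1 = 1" unfolding z\<^sub>1_def by (rule someI)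
  then show "z\<^sub>1 \<in> DD" "ip e z\<^sub>1 = 1" by auto
qed

text \<open>The difference \<open>z - ip e z *\<^sub>R z\<^sub>1\<close> is orthogonal to
  \<open>e\<close>, so \<open>br_on_line\<close> applies to it.\<close>

lemma br_mod_line: assumes "z \<in> DD" shows "on_line (br x z - ip e z *\<^sub>R br x z\<^sub>1)"
proof -
  have "z - ip e z *\<^sub>R z\<^sub>1 \<in> DD"
    using assms z1 by (intro subspace_diff[OF subspace_DD] subspace_scale[OF subspace_DD])
  moreover have "ip (z - ip e z *\<^sub>R z\<^sub>1) e = 0"
    using z1(2) by (simp add: ip_simps ip_sym[of _ e])
  ultimately show ?thesis using br_on_line[of _ x] by (fastforce simp: br_simps)
qed

lemma om_cyclic: "on_line (om y w *\<^sub>R br x z\<^sub>1 + om w x *\<^sub>R br y z\<^sub>1 + om x y *\<^sub>R br w z\<^sub>1)"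
proof -
  have "br x (br y w) + br y (br w x) + br w (br x y) = 0"
    using jacobi[of x y w] br_anti[of w "br x y"] br_anti[of w x] by (simp add: br_simps)
  then have eq: "om y w *\<^sub>R br x z\<^sub>1 + om w x *\<^sub>R br y z\<^sub>1 + om x y *\<^sub>R br w z\<^sub>1
    = - ((br x (br y w) - om y w *\<^sub>R br x z\<^sub>1) + (br y (br w x) - om w x *\<^sub>R br y z\<^sub>1)
       + (br w (br x y) - om x y *\<^sub>R br w z\<^sub>1))"
    by (simp add: algebra_simps)
  have "on_line (br a (br b c) - om b c *\<^sub>R br a z\<^sub>1)" for a b c
    unfolding om_def by (rule br_mod_line[OF br_in_DD])
  then show ?thesis unfolding eq by (intro on_line_intros(5) on_line_intros(2))
qed

text \<open>By \<open>br_mod_line\<close>, these are the \<open>x\<close> in \<open>VV\<close> for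
  which \<open>br x\<close> maps all of \<open>DD\<close> into the line of \<open>e\<close>.\<close>

definition "KK = {x \<in> VV. on_line (br x z\<^sub>1)}"

definition "V1 = {x \<in> VV. \<forall>w\<in>KK. ip x w = 0}"

lemma subspace_KK: "subspace KK"
  using subspace_VV by (auto simp: KK_def subspace_def br_simps on_line_intros)

lemma subspace_V1: "subspace V1"
  using subspace_VV by (auto simp: V1_def subspace_def ip_simps)

lemma KK_V1_eq_0: "x \<in> KK \<Longrightarrow> x \<in> V1 \<Longrightarrow> x = 0"
  using VV_pos[of x] by (force simp: KK_def V1_def)

lemma V1_decomp: assumes "x \<in> VV" obtains y w where "y \<in> V1" "w \<in> KK" "x = y + w"
proof -
  have "nondegenerate_on KK ip"
    using VV_pos by (force simp: nondegenerate_on_def KK_def)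
  then obtain w where w: "w \<in> KK" "\<And>v. v \<in> KK \<Longrightarrow> ip v (x - w) = 0"
    using nondegenerate_orthogonal_decomp[OF ip subspace_KK _ ip_sym] by blast
  then have "x - w \<in> V1"
    using assms subspace_diff[OF subspace_VV] by (auto simp: V1_def KK_def ip_sym)
  with w that show ?thesis by fastforce
qed

text \<open>If \<open>V1\<close> were zero, then \<open>br x z\<^sub>1\<close> would be a multiple
  of \<open>e\<close> for all \<open>x\<close> in \<open>VV\<close>. Pairing with
  \<open>z\<^sub>1\<close> makes it zero, and pairing \<open>br x z\<close> with
  \<open>z\<^sub>1\<close> then makes that zero too; since \<open>DD\<close> is abelian,
  \<open>e = br u\<^sub>0 z\<^sub>0\<close> would vanish.\<close>

lemma V1_nonzero: obtains x where "x \<in> V1" "x \<noteq> 0"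
proof (rule ccontr)
  assume *: "\<not> thesis"
  note V1_thesis = that
  have K: "x \<in> KK" if x: "x \<in> VV" for x
  proof -
    obtain y w where "y \<in> V1" "w \<in> KK" "x = y + w" using V1_decomp[OF x] by blast
    moreover have "y = 0" using * V1_thesis[OF \<open>y \<in> V1\<close>] by blast
    ultimately show ?thesis by simp
  qed
  have 0: "br x z = 0" if x: "x \<in> VV" and z: "z \<in> DD" for x z
  proof -
    obtain c where c: "br x z\<^sub>1 = c *\<^sub>R e" using K[OF x] by (auto simp: KK_def on_line_def)
    have "ip (br x z\<^sub>1) z\<^sub>1 = 0" using skew_VV_diag[OF x z1(1)] .
    then have "br x z\<^sub>1 = 0" using c z1(2) by (simp add: ip_simps)
    then obtain d where d: "br x z = d *\<^sub>R e" using br_mod_line[OF z, of x] by (auto simp: on_line_def)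
    have "ip (br x z) z\<^sub>1 = 0" using skew[OF z z1(1), of x] \<open>br x z\<^sub>1 = 0\<close> by (simp add: ip_simps)
    then show ?thesis using d z1(2) by (simp add: ip_simps)
  qed
  obtain x z where "x \<in> VV" "z \<in> DD" "u\<^sub>0 = x + z" by (rule decomp)
  then have "e = 0" using e_br 0[OF _ z0] DD_abelian[OF _ z0] by (simp add: br_simps)
  then show False using e_nonzero by simp
qed

lemma br_z1_pos: assumes "x \<in> VV" "x \<notin> KK" shows "ip (br x z\<^sub>1) (br x z\<^sub>1) > 0"
  using nonpos_on_line[OF br_perp_e(1)[OF z1(1)]] assms by (force simp: KK_def)

text \<open>The Geodesic Lemma for \<open>x + s *\<^sub>R z\<close>, tested on \<open>DD\<close> and
  on \<open>VV\<close> separately. On \<open>DD\<close> the factor \<open>s\<close> cancels and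
  \<open>D z = - br x z\<close> results; on \<open>VV\<close> it remains. As \<open>ip x x\<close>
  is positive, one of \<open>s = 1\<close> and \<open>s = 2\<close> avoids null vectors.\<close>

lemma geodesic_derivation:
  assumes x: "x \<in> VV" "x \<noteq> 0" and z: "z \<in> DD"
  obtains D s where "s \<noteq> 0" "linear D" "\<And>u v. D (br u v) = br (D u) v + br u (D v)"
    "\<And>u v. ip (D u) v = - ip u (D v)" "\<And>w. w \<in> VV \<Longrightarrow> D w \<in> VV"
    "D z = - br x z" "\<And>w. w \<in> VV \<Longrightarrow> s * ip (br x w) z = ip w (D x)"
proof -
  have "\<exists>s. s \<noteq> 0 \<and> ip (x + s *\<^sub>R z) (x + s *\<^sub>R z) \<noteq> 0"
  proof (rule ccontr)
    assume *: "\<not> ?thesis"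
    have e: "ip (x + s *\<^sub>R z) (x + s *\<^sub>R z) = ip x x + s * s * ip z z" for s
      using VV_DD[OF x(1) z] by (simp add: ip_simps)
    have "ip x x + s * s * ip z z = 0" if "s \<noteq> 0" for s
      using * that e[of s] by metis
    from this[of 1] this[of 2] show False using VV_pos[OF x] by simp
  qed
  then obtain s where s: "s \<noteq> 0" "ip (x + s *\<^sub>R z) (x + s *\<^sub>R z) \<noteq> 0" by blast
  obtain D where D: "linear D" "\<And>u v. D (br u v) = br (D u) v + br u (D v)"
    "\<And>u v. ip (D u) v = - ip u (D v)" "\<And>w. ip (br (x + s *\<^sub>R z) w + D w) (x + s *\<^sub>R z) = 0"
    using geodesic_nonnull[OF s(2)] by metis
  have DV: "D w \<in> VV" if "w \<in> VV" for w
    using D(3)[of w] VV_DD[OF that derivation_DD[OF D(1,2)]] by (simp add: VV_def)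
  have "br x z + D z = 0"
  proof (rule DD_eq_0)
    show "br x z + D z \<in> DD"
      using br_in_DD derivation_DD[OF D(1,2) z] subspace_add[OF subspace_DD] by blast
    fix w assume w: "w \<in> DD"
    have "ip (D w) x = 0" "ip (br x w) x = 0"
      using derivation_DD[OF D(1,2) w] br_in_DD x VV_DD by blast+
    then have "s * (ip (br x w) z + ip (D w) z) = 0"
      using D(4)[of w] by (simp add: ip_simps br_simps DD_abelian[OF z w] algebra_simps)
    then show "ip (br x z + D z) w = 0"
      using s(1) skew[OF w z, of x] D(3)[of w z] by (simp add: ip_simps ip_sym[of w])
  qed
  moreover have "s * ip (br x w) z = ip w (D x)" if w: "w \<in> VV" for w
  proof -
    have "ip (br x w) x = 0" "ip (br z w) x = 0" "ip (D w) z = 0"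
      using br_in_DD x z DV[OF w] VV_DD by blast+
    moreover have "ip (br z w) z = 0" using skew_VV_diag[OF w z] br_anti[of z w] by (simp add: ip_simps)
    ultimately show ?thesis using D(4)[of w] D(3)[of w x] by (simp add: ip_simps br_simps algebra_simps)
  qed
  ultimately show ?thesis using that[OF s(1) D(1-3) DV] by (simp add: eq_neg_iff_add_eq_0 add.commute)
qed

text \<open>It is enough that \<open>D\<close> preserves the line of \<open>e\<close>: then it
  preserves \<open>KK\<close>, and by skewness the complement. For nonzero \<open>y\<close> in
  \<open>V1\<close> the double bracket of \<open>y\<close> with \<open>z\<^sub>1\<close> is a
  nonzero multiple of \<open>e\<close>, and \<open>D\<close> maps it to a sum of double brackets
  with elements of \<open>DD\<close>, all of which lie on the line.\<close>

lemma derivation_V1: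
  assumes D: "linear D" "\<And>u v. D (br u v) = br (D u) v + br u (D v)"
    "\<And>u v. ip (D u) v = - ip u (D v)" "\<And>w. w \<in> VV \<Longrightarrow> D w \<in> VV"
    and x: "x \<in> V1"
  shows "D x \<in> V1"
proof -
  obtain y where y: "y \<in> V1" "y \<noteq> 0" by (rule V1_nonzero)
  then have yK: "y \<in> VV" "y \<notin> KK" using KK_V1_eq_0 by (auto simp: V1_def)
  have line: "on_line (br u (br v w))" if "w \<in> DD" for u v w
    using that br_on_line br_in_DD br_perp_e by blast
  obtain c where c: "br y (br y z\<^sub>1) = c *\<^sub>R e" using line[OF z1(1)] by (auto simp: on_line_def)
  have "c = ip (br y (br y z\<^sub>1)) z\<^sub>1" using z1(2) by (simp add: c ip_simps)
  also have "\<dots> = - ip (br y z\<^sub>1) (br y z\<^sub>1)" using skew[OF br_in_DD z1(1)] by simp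
  finally have "c \<noteq> 0" using br_z1_pos[OF yK] by simp
  have "c *\<^sub>R D e = D (br y (br y z\<^sub>1))" by (simp add: c linear_scale[OF D(1)])
  also have "\<dots> = br (D y) (br y z\<^sub>1) + (br y (br (D y) z\<^sub>1) + br y (br y (D z\<^sub>1)))"
    by (simp add: D(2) br_simps)
  finally have "on_line (c *\<^sub>R D e)"
    using line z1(1) derivation_DD[OF D(1,2) z1(1)] by (simp add: on_line_intros)
  then have De: "on_line (D e)" using \<open>c \<noteq> 0\<close> on_line_scaleD by blast
  have "D w \<in> KK" if w: "w \<in> KK" for w
  proof -
    obtain a where a: "br w z\<^sub>1 = a *\<^sub>R e" using w by (auto simp: KK_def on_line_def)
    have "on_line (br w (D z\<^sub>1))"
      using br_mod_line[OF derivation_DD[OF D(1,2) z1(1)], of w] w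
        on_line_intros(2)[of "br w (D z\<^sub>1) - ip e (D z\<^sub>1) *\<^sub>R br w z\<^sub>1" "ip e (D z\<^sub>1) *\<^sub>R br w z\<^sub>1"]
      by (simp add: KK_def on_line_intros)
    moreover have "br (D w) z\<^sub>1 = a *\<^sub>R D e - br w (D z\<^sub>1)"
      using D(2)[of w z\<^sub>1] by (simp add: a linear_scale[OF D(1)])
    ultimately have "on_line (br (D w) z\<^sub>1)" using De by (simp add: on_line_intros)
    then show ?thesis using w D(4) by (simp add: KK_def)
  qed
  then show ?thesis using x D(3,4) by (simp add: V1_def)
qed

text \<open>For every \<open>z\<close> in \<open>DD\<close> the number \<open>ip (br x w) z\<close>
  is proportional to \<open>ip w (D x)\<close>, and \<open>D x\<close> lies again in
  \<open>V1\<close>, which is orthogonal to \<open>w\<close>.\<close>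

lemma br_V1_KK: assumes x: "x \<in> V1" and w: "w \<in> KK" shows "br x w = 0"
proof (cases "x = 0")
  case False
  show ?thesis
  proof (rule DD_eq_0[OF br_in_DD])
    fix z assume z: "z \<in> DD"
    have "x \<in> VV" "w \<in> VV" using x w by (auto simp: V1_def KK_def)
    obtain D s where D: "s \<noteq> 0" "linear D" "\<And>u v. D (br u v) = br (D u) v + br u (D v)"
      "\<And>u v. ip (D u) v = - ip u (D v)" "\<And>w. w \<in> VV \<Longrightarrow> D w \<in> VV"
      "D z = - br x z" "\<And>w. w \<in> VV \<Longrightarrow> s * ip (br x w) z = ip w (D x)"
      using geodesic_derivation[OF \<open>x \<in> VV\<close> False z] by metis
    have "D x \<in> V1" by (rule derivation_V1[OF D(2-5) x])
    then have "ip w (D x) = 0" using w by (simp add: V1_def ip_sym)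
    then show "ip (br x w) z = 0" using D(1) D(7)[OF \<open>w \<in> VV\<close>] by simp
  qed
qed (simp add: br_simps)

text \<open>In \<open>om_cyclic\<close> with a third vector \<open>y\<close> of \<open>V1\<close>
  two terms vanish by \<open>br_V1_KK\<close>; the remaining one would put \<open>y\<close> into
  \<open>KK\<close>.\<close>

lemma om_KK: assumes "v \<in> KK" "w \<in> KK" shows "om v w = 0"
proof (rule ccontr)
  assume *: "om v w \<noteq> 0"
  obtain y where y: "y \<in> V1" "y \<noteq> 0" by (rule V1_nonzero)
  have "om w y = 0" "om y v = 0"
    using br_V1_KK[OF y(1)] assms om_anti[of w y] by (simp_all add: om_def ip_simps)
  then have "on_line (om v w *\<^sub>R br y z\<^sub>1)" using om_cyclic[of v w y] by simp
  then have "y \<in> KK" using * on_line_scaleD y(1) by (auto simp: KK_def V1_def)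
  then show False using y KK_V1_eq_0 by blast
qed

lemma contradiction: False
proof -
  obtain x y where xy: "x \<in> VV" "y \<in> VV" "om x y \<noteq> 0" by (rule om_nonzero)
  obtain a v where a: "a \<in> V1" "v \<in> KK" "x = a + v" using V1_decomp[OF xy(1)] by blast
  obtain b' w where b': "b' \<in> V1" "w \<in> KK" "y = b' + w" using V1_decomp[OF xy(2)] by blast
  have "om a w = 0" "om b' v = 0" using br_V1_KK a b' by (simp_all add: om_def ip_simps)
  then have omab': "om a b' \<noteq> 0"
    using xy(3) om_KK[OF a(2) b'(2)] om_anti[of v b'] by (simp add: a(3) b'(3) om_simps)
  then have "a \<noteq> 0" by (auto simp: om_simps)
  have aV: "a \<in> VV" using a(1) by (simp add: V1_def)
  have aa: "ip a a > 0" using VV_pos aV \<open>a \<noteq> 0\<close> by blast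
  \<comment> \<open>Orthogonalization; subtracting a multiple of \<open>a\<close> does not change
    \<open>om a b'\<close>.\<close>
  define b where "b = b' - (ip a b' / ip a a) *\<^sub>R a"
  have b: "b \<in> V1"
    unfolding b_def using a(1) b'(1) by (intro subspace_diff[OF subspace_V1] subspace_scale[OF subspace_V1])
  have om: "om a b \<noteq> 0" using omab' by (simp add: b_def om_simps)
  then have "b \<noteq> 0" by (auto simp: om_def br_simps ip_simps)
  then have bb: "ip b b > 0" using VV_pos b by (simp add: V1_def)
  have ab: "ip a b = 0" using aa by (simp add: b_def ip_simps)
  have span: "\<exists>r s. t = r *\<^sub>R a + s *\<^sub>R b" if t: "t \<in> V1" for t
  proof -
    \<comment> \<open>The combination from \<open>om_cyclic\<close> for \<open>b\<close>,
      \<open>t\<close>, \<open>a\<close>, with \<open>br _ z\<^sub>1\<close> taken off: it lies in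
      \<open>KK\<close> and in \<open>V1\<close>, so it is zero and expresses \<open>t\<close>
      through \<open>a\<close> and \<open>b\<close>.\<close>
    define q where "q = om b t *\<^sub>R a + om t a *\<^sub>R b + om a b *\<^sub>R t"
    have "q \<in> V1"
      unfolding q_def using a(1) b t
      by (intro subspace_add[OF subspace_V1] subspace_scale[OF subspace_V1])
    moreover have "on_line (br q z\<^sub>1)" using om_cyclic[of b t a] by (simp add: q_def br_simps)
    ultimately have "q = 0" using KK_V1_eq_0 by (auto simp: KK_def V1_def)
    then have "om a b *\<^sub>R t = (- om b t) *\<^sub>R a + (- om t a) *\<^sub>R b"
      unfolding q_def by (simp add: add_eq_0_iff2 algebra_simps)
    then have "t = (1 / om a b) *\<^sub>R ((- om b t) *\<^sub>R a + (- om t a) *\<^sub>R b)"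
      using om by (metis divide_self_if scaleR_one scaleR_scaleR times_divide_eq_left mult_1)
    then show ?thesis unfolding scaleR_add_right scaleR_scaleR by blast
  qed
  obtain D s where D: "s \<noteq> 0" "linear D" "\<And>u v. D (br u v) = br (D u) v + br u (D v)"
    "\<And>u v. ip (D u) v = - ip u (D v)" "\<And>w. w \<in> VV \<Longrightarrow> D w \<in> VV"
    "D (br a b) = - br a (br a b)" "\<And>w. w \<in> VV \<Longrightarrow> s * ip (br a w) (br a b) = ip w (D a)"
    using geodesic_derivation[OF aV \<open>a \<noteq> 0\<close> br_in_DD[of a b]] by metis
  have D0: "ip (D t) t = 0" for t using D(4)[of t t] ip_sym[of t "D t"] by simp
  obtain r1 s1 where 1: "D a = r1 *\<^sub>R a + s1 *\<^sub>R b" using span derivation_V1[OF D(2-5) a(1)] by blast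
  obtain r2 s2 where 2: "D b = r2 *\<^sub>R a + s2 *\<^sub>R b" using span derivation_V1[OF D(2-5) b] by blast
  have "r1 = 0" using D0[of a] aa ab ip_sym[of b a] by (simp add: 1 ip_simps)
  moreover have "s2 = 0" using D0[of b] bb ab by (simp add: 2 ip_simps)
  \<comment> \<open>By skewness \<open>D a\<close> is a multiple of \<open>b\<close> and
    \<open>D b\<close> a multiple of \<open>a\<close>, so both terms of the derivation rule are
    brackets of parallel vectors.\<close>
  ultimately have "D (br a b) = 0" by (simp add: D(3) 1 2 br_simps br_self)
  then have "br a (br a b) = 0" using D(6) by simp
  \<comment> \<open>Modulo \<open>e\<close>, the vanishing bracket \<open>br a (br a b)\<close> is
    \<open>om a b\<close> times \<open>br a z\<^sub>1\<close>.\<close>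
  then have "on_line (om a b *\<^sub>R br a z\<^sub>1)"
    using on_line_intros(5)[OF br_mod_line[OF br_in_DD, of a a b]] by (simp add: om_def)
  then have "a \<in> KK" using om on_line_scaleD aV by (auto simp: KK_def)
  then show False using KK_V1_eq_0 a(1) \<open>a \<noteq> 0\<close> by blast
qed

end

text \<open>Take a nonzero nested bracket ending in \<open>DD\<close> of maximal length. Every
  further bracket kills it, so it is central; the length is at least one by assumption, so it is
  itself a bracket with an element of \<open>DD\<close>.\<close>

theorem (in lorentz_go_algebra) two_step: assumes z: "z \<in> DD" shows "br u z = 0"
proof (rule ccontr)
  assume nz: "br u z \<noteq> 0"
  define J where "J = {j. \<exists>us z. length us = j \<and> z \<in> DD \<and> foldr br us z \<noteq> 0}"
  have "J \<subseteq> {..k}" using foldr_long by (auto simp: J_def) (meson nat_le_linear)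
  then have fin: "finite J" using finite_subset by blast
  have 1: "1 \<in> J" unfolding J_def using z nz by (intro CollectI exI[of _ "[u]"] exI[of _ z]) simp
  have "Max J \<in> J" using fin 1 by (intro Max_in) auto
  then obtain us y where us: "length us = Max J" "y \<in> DD" "foldr br us y \<noteq> 0" by (auto simp: J_def)
  moreover have "Max J \<ge> 1" using fin 1 by simp
  ultimately obtain u0 us' where "us = u0 # us'" by (cases us) auto
  have "br w (foldr br us y) = 0" for w
  proof (rule ccontr)
    assume *: "br w (foldr br us y) \<noteq> 0"
    have "length (w # us) \<in> J" unfolding J_def
      using us(2) * by (intro CollectI exI[of _ "w # us"] exI[of _ y]) simp
    then have "Suc (Max J) \<le> Max J" using Max_ge[OF fin] us(1) by simp
    then show False by simp
  qed
  then interpret lorentz_go_counterexample br ip k "foldr br us y" u0 "foldr br us' y"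
    using us foldr_DD[OF us(2)] by unfold_locales (simp_all add: \<open>us = u0 # us'\<close>)
  show False by (rule contradiction)
qed

section \<open>Lie groups in a chart around the identity\<close>

text \<open>The topological part of \<open>smooth_atlas\<close> for a single chart, separated so
  that it can be proved for product charts.\<close>

definition chart_ok :: "('a::topological_space, 'e::euclidean_space) chart \<Rightarrow> bool" where
  "chart_ok c \<longleftrightarrow> open (fst c) \<and> open (snd c ` fst c) \<and>
     homeomorphism (fst c) (snd c ` fst c) (snd c) (chart_inv c)"

text \<open>Passing from \<open>smooth_on\<close> to \<open>smooth_at\<close> needs an open set: the
  coordinate image of the overlap is open as a preimage under \<open>chart_inv c\<close>.\<close>

lemma smooth_map_charts:
  assumes f: "smooth_map A B f" and c: "c \<in> A" "chart_ok c" and d: "d \<in> B" "open (fst d)"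
    and p: "p \<in> fst c" "f p \<in> fst d"
  shows "smooth_at (\<lambda>x. snd d (f (chart_inv c x))) (snd c p)"
proof -
  let ?S = "fst c \<inter> f -` fst d"
  have h: "homeomorphism (fst c) (snd c ` fst c) (snd c) (chart_inv c)" and o: "open (fst c)" "open (snd c ` fst c)"
    using c(2) by (simp_all add: chart_ok_def)
  have "open (f -` fst d)"
    using f d(2) by (auto simp: smooth_map_def continuous_on_open_vimage[OF open_UNIV])
  then have "open ?S" using o by blast
  have "open (chart_inv c -` ?S \<inter> snd c ` fst c)"
    using continuous_on_open_vimage[OF o(2)] homeomorphism_cont2[OF h] \<open>open ?S\<close> by blast
  moreover have "chart_inv c -` ?S \<inter> snd c ` fst c = snd c ` ?S"
    using homeomorphism_apply1[OF h] by force
  ultimately have "open (snd c ` ?S)" by simp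
  moreover have "smooth_on (snd c ` ?S) (snd d \<circ> f \<circ> chart_inv c)"
    using f c d by (auto simp: smooth_map_def)
  ultimately have "smooth_at (snd d \<circ> f \<circ> chart_inv c) (snd c p)"
    using p by (intro smooth_on_imp_smooth_at) auto
  then show ?thesis by (simp add: o_def)
qed

lemma chart_inv_prod:
  assumes "chart_ok c" "chart_ok d" "x \<in> snd c ` fst c" "y \<in> snd d ` fst d"
  shows "chart_inv (fst c \<times> fst d, map_prod (snd c) (snd d)) (x, y) = (chart_inv c x, chart_inv d y)"
proof -
  obtain p r where pr: "p \<in> fst c" "x = snd c p" "r \<in> fst d" "y = snd d r" using assms(3,4) by blast
  have inj: "inj_on (snd c) (fst c)" "inj_on (snd d) (fst d)"
    using assms(1,2) unfolding chart_ok_def by (metis homeomorphism_apply1 inj_on_inverseI)+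
  then have "inj_on (map_prod (snd c) (snd d)) (fst c \<times> fst d)" by (rule map_prod_inj_on)
  from inv_into_f_f[OF this, of "(p, r)"] show ?thesis
    using pr inj by (simp add: chart_inv_def)
qed

lemma chart_ok_prod:
  assumes "chart_ok c" "chart_ok d"
  shows "chart_ok (fst c \<times> fst d, map_prod (snd c) (snd d))"
proof -
  let ?c = "(fst c \<times> fst d, map_prod (snd c) (snd d))"
  have h: "homeomorphism (fst c) (snd c ` fst c) (snd c) (chart_inv c)"
    "homeomorphism (fst d) (snd d ` fst d) (snd d) (chart_inv d)"
    using assms by (simp_all add: chart_ok_def)
  have im: "map_prod (snd c) (snd d) ` (fst c \<times> fst d) = (snd c ` fst c) \<times> (snd d ` fst d)"
    by (rule map_prod_surj_on) auto
  have inv: "chart_inv ?c p = (chart_inv c (fst p), chart_inv d (snd p))"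
    if "p \<in> (snd c ` fst c) \<times> (snd d ` fst d)" for p
    using chart_inv_prod[OF assms, of "fst p" "snd p"] that by (cases p) auto
  have "homeomorphism (fst c \<times> fst d) ((snd c ` fst c) \<times> (snd d ` fst d))
      (map_prod (snd c) (snd d)) (\<lambda>p. (chart_inv c (fst p), chart_inv d (snd p)))"
    unfolding homeomorphism_def
  proof (intro conjI ballI)
    show "continuous_on (fst c \<times> fst d) (map_prod (snd c) (snd d))"
      unfolding map_prod_def case_prod_unfold
      by (intro continuous_on_Pair continuous_on_compose2[OF homeomorphism_cont1[OF h(1)]]
          continuous_on_compose2[OF homeomorphism_cont1[OF h(2)]] continuous_on_fst continuous_on_snd
          continuous_on_id) auto
    show "continuous_on ((snd c ` fst c) \<times> (snd d ` fst d)) (\<lambda>p. (chart_inv c (fst p), chart_inv d (snd p)))"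
      by (intro continuous_on_Pair continuous_on_compose2[OF homeomorphism_cont2[OF h(1)]]
          continuous_on_compose2[OF homeomorphism_cont2[OF h(2)]] continuous_on_fst continuous_on_snd
          continuous_on_id) auto
    show "map_prod (snd c) (snd d) ` (fst c \<times> fst d) = (snd c ` fst c) \<times> (snd d ` fst d)" by (rule im)
    show "(\<lambda>p. (chart_inv c (fst p), chart_inv d (snd p))) ` ((snd c ` fst c) \<times> (snd d ` fst d)) = fst c \<times> fst d"
      using map_prod_surj_on[OF homeomorphism_image2[OF h(1)] homeomorphism_image2[OF h(2)]]
      by (simp add: map_prod_def case_prod_unfold)
  qed (use homeomorphism_apply1[OF h(1)] homeomorphism_apply2[OF h(1)]
      homeomorphism_apply1[OF h(2)] homeomorphism_apply2[OF h(2)] in auto)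
  then have "homeomorphism (fst c \<times> fst d) ((snd c ` fst c) \<times> (snd d ` fst d))
      (map_prod (snd c) (snd d)) (chart_inv ?c)"
    by (rule homeomorphism_cong) (use inv in auto)
  then show ?thesis
    unfolding chart_ok_def fst_conv snd_conv im
    using assms by (simp add: chart_ok_def open_Times)
qed

lemma smooth_map_prod_charts:
  assumes F: "smooth_map (prod_atlas A B) C (\<lambda>(a, b). F a b)"
    and c: "c \<in> A" "chart_ok c" "p \<in> fst c" and d: "d \<in> B" "chart_ok d" "r \<in> fst d"
    and k: "k \<in> C" "open (fst k)" "F p r \<in> fst k"
  shows "smooth_at (\<lambda>x. snd k (F (chart_inv c (fst x)) (chart_inv d (snd x)))) (snd c p, snd d r)"
proof (rule smooth_at_cong)
  let ?c = "(fst c \<times> fst d, map_prod (snd c) (snd d))"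
  have "?c \<in> prod_atlas A B" using c d unfolding prod_atlas_def by blast
  from smooth_map_charts[OF F this chart_ok_prod[OF c(2) d(2)] k(1,2), of "(p, r)"]
  show "smooth_at (\<lambda>x. snd k (case chart_inv ?c x of (a, b) \<Rightarrow> F a b)) (snd c p, snd d r)"
    using c d k by simp
  have "\<forall>\<^sub>F x in nhds (snd c p, snd d r). x \<in> (snd c ` fst c) \<times> (snd d ` fst d)"
    using c d by (intro eventually_nhds_in_open open_Times) (auto simp: chart_ok_def)
  then show "\<forall>\<^sub>F x in nhds (snd c p, snd d r). snd k (case chart_inv ?c x of (a, b) \<Rightarrow> F a b)
      = snd k (F (chart_inv c (fst x)) (chart_inv d (snd x)))"
  proof eventually_elim
    case (elim x)
    then show ?case using chart_inv_prod[OF c(2) d(2), of "fst x" "snd x"] by auto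
  qed
qed

lemma frechet_derivative_partial:
  assumes "smooth_at f (g z)" "(g has_derivative g') (at z)"
    "\<forall>\<^sub>F x in nhds z. h x = f (g x)"
  shows "(h has_derivative (\<lambda>u. frechet_derivative f (at (g z)) (g' u))) (at z)"
proof (rule has_derivative_cong_nhds)
  show "((\<lambda>x. f (g x)) has_derivative (\<lambda>u. frechet_derivative f (at (g z)) (g' u))) (at z)"
    by (rule has_derivative_compose[OF assms(2) smooth_at_has_derivative[OF assms(1)]])
  show "\<forall>\<^sub>F x in nhds z. f (g x) = h x" using assms(3) by eventually_elim simp
qed

section \<open>The group law in a chart around the identity\<close>

locale lie_group_chart =
  fixes N :: "('a::topological_space) monoid" (structure)
    and A :: "('a, 'e::euclidean_space) chart set" and c :: "('a, 'e) chart"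
  assumes lie: "lie_group N A" and c_in: "c \<in> A" and one_in: "\<one> \<in> fst c"
begin

lemma grp: "group N" and carrier: "carrier N = UNIV"
  and mult_smooth: "smooth_map (prod_atlas A A) A (\<lambda>(a, b). a \<otimes> b)"
  and inv_smooth: "smooth_map A A (\<lambda>a. inv a)" and atlas: "smooth_atlas A"
  using lie by (auto simp: lie_group_def)

interpretation group N by (rule grp)

text \<open>Since the carrier is \<open>UNIV\<close>, the laws hold without side conditions and
  bring words in the group to a normal form.\<close>

lemma group_simps: "a \<otimes> b \<otimes> d = a \<otimes> (b \<otimes> d)" "\<one> \<otimes> a = a" "a \<otimes> \<one> = a" "inv a \<otimes> a = \<one>" "a \<otimes> inv a = \<one>"
  "inv (inv a) = a" "inv (a \<otimes> b) = inv b \<otimes> inv a" "inv a \<otimes> (a \<otimes> b) = b" "a \<otimes> (inv a \<otimes> b) = b" "inv \<one> = \<one>"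
  using carrier by (simp_all add: m_assoc inv_mult_group) (simp_all flip: m_assoc)

lemma continuous_on_mult:
  assumes "continuous_on S f" "continuous_on S g"
  shows "continuous_on S (\<lambda>x. f x \<otimes> g x)"
proof -
  have "continuous_on UNIV (\<lambda>(a, b). a \<otimes> b)" using mult_smooth by (simp add: smooth_map_def)
  from continuous_on_compose2[OF this continuous_on_Pair[OF assms]] show ?thesis by simp
qed

lemma continuous_on_inv:
  assumes "continuous_on S f" shows "continuous_on S (\<lambda>x. inv (f x))"
proof -
  have "continuous_on UNIV (\<lambda>a. inv a)" using inv_smooth by (simp add: smooth_map_def)
  from continuous_on_compose2[OF this assms] show ?thesis by simp
qed

lemmas cont_intros = continuous_on_mult continuous_on_inv continuous_on_const continuous_on_id

abbreviation "U \<equiv> fst c"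
abbreviation "X \<equiv> snd c"
abbreviation "q \<equiv> chart_inv c"
definition "V = X ` U"
definition "\<epsilon> = X \<one>"

lemma chart_ok: "chart_ok c" using atlas c_in by (auto simp: smooth_atlas_def chart_ok_def)

lemma open_U: "open U" and open_V: "open V" and homeo: "homeomorphism U V X q"
  using chart_ok by (simp_all add: chart_ok_def V_def)

lemma qX: "p \<in> U \<Longrightarrow> q (X p) = p" and Xq: "x \<in> V \<Longrightarrow> X (q x) = x"
  and q_in: "x \<in> V \<Longrightarrow> q x \<in> U" and X_in: "p \<in> U \<Longrightarrow> X p \<in> V"
  using homeo by (auto simp: homeomorphism_def)

lemma eps: "\<epsilon> \<in> V" "q \<epsilon> = \<one>" using X_in one_in qX by (auto simp: \<epsilon>_def)

lemma eventually_V: "x \<in> V \<Longrightarrow> \<forall>\<^sub>F y in nhds x. y \<in> V"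
  using open_V by (rule eventually_nhds_in_open)

lemma tendsto_q: "x \<in> V \<Longrightarrow> filterlim q (nhds (q x)) (nhds x)"
  using continuous_on_eq_continuous_at[OF open_V, of q] homeomorphism_cont2[OF homeo]
  by (simp add: isCont_def tendsto_at_iff_tendsto_nhds)

lemma eventually_q:
  assumes "x \<in> V" "continuous_on UNIV f" "f (q x) \<in> S" "open S"
  shows "\<forall>\<^sub>F y in nhds x. f (q y) \<in> S"
proof -
  have "open (f -` S)" using assms(2,4) continuous_on_open_vimage[OF open_UNIV] by auto
  then have "\<forall>\<^sub>F p in nhds (q x). f p \<in> S" using assms(3) eventually_nhds_in_open[of "f -` S"] by simp
  then show ?thesis using tendsto_q[OF assms(1)] by (rule eventually_compose_filterlim)
qed

text \<open>Side conditions saying that some word in the group stays in the chart are discharged by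
  evaluating the word at \<open>\<one>\<close>.\<close>

lemma eventually_q_eps:
  assumes "continuous_on UNIV f" "f \<one> \<in> U"
  shows "\<forall>\<^sub>F y in nhds \<epsilon>. f (q y) \<in> U"
  using eventually_q[OF eps(1) assms(1) _ open_U] assms(2) by (simp add: eps(2))

text \<open>Multiplication and inversion in coordinates. \<open>M\<close> is meaningful only where
  the product stays in \<open>U\<close>, as \<open>X\<close> is arbitrary outside; \<open>V1\<close>
  is the set on which \<open>J\<close> is meaningful.\<close>

definition "M p = X (q (fst p) \<otimes> q (snd p))"
definition "J x = X (inv (q x))"
definition "V1 = {x \<in> V. inv (q x) \<in> U}"

lemma smooth_chart:
  assumes "smooth_map A A f" "x \<in> V" "f (q x) \<in> U"
  shows "smooth_at (\<lambda>x. X (f (q x))) x"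
  using smooth_map_charts[OF assms(1) c_in chart_ok c_in open_U q_in[OF assms(2)] assms(3)]
  by (simp add: Xq[OF assms(2)])

lemma M_smooth:
  assumes "x \<in> V" "y \<in> V" "q x \<otimes> q y \<in> U" shows "smooth_at M (x, y)"
  using smooth_map_prod_charts[OF mult_smooth c_in chart_ok q_in[OF assms(1)] c_in chart_ok q_in[OF assms(2)]
      c_in open_U assms(3)]
  by (simp add: Xq assms M_def[abs_def])

lemma J_smooth: "y \<in> V1 \<Longrightarrow> smooth_at J y"
  unfolding J_def[abs_def] by (rule smooth_chart[OF inv_smooth]) (auto simp: V1_def)

lemma V1D: "y \<in> V1 \<Longrightarrow> y \<in> V" "y \<in> V1 \<Longrightarrow> J y \<in> V" "y \<in> V1 \<Longrightarrow> q (J y) = inv (q y)" "y \<in> V1 \<Longrightarrow> inv (q y) \<in> U"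
  by (auto simp: V1_def J_def X_in qX)

lemma eps_V1: "\<epsilon> \<in> V1" by (auto simp: V1_def eps one_in group_simps)

lemma eventually_V1: assumes "x \<in> V1" shows "\<forall>\<^sub>F y in nhds x. y \<in> V1"
proof -
  have "x \<in> V" "inv (q x) \<in> U" using assms by (auto simp: V1_def)
  have "\<forall>\<^sub>F y in nhds x. inv (q y) \<in> U"
    by (rule eventually_q[where f = "\<lambda>p. inv p", OF \<open>x \<in> V\<close> _ \<open>inv (q x) \<in> U\<close> open_U]) (intro cont_intros)
  with eventually_V[OF \<open>x \<in> V\<close>] show ?thesis by eventually_elim (simp add: V1_def)
qed

lemma J_eps: "J \<epsilon> = \<epsilon>" by (simp add: J_def eps group_simps) (simp add: \<epsilon>_def)

lemma M_eps: "y \<in> V \<Longrightarrow> M (y, \<epsilon>) = y" "y \<in> V \<Longrightarrow> M (\<epsilon>, y) = y"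
  by (simp_all add: M_def eps group_simps Xq)

lemma M_J: "y \<in> V1 \<Longrightarrow> M (J y, y) = \<epsilon>" "y \<in> V1 \<Longrightarrow> M (y, J y) = \<epsilon>"
  by (simp_all add: M_def V1D group_simps) (simp_all add: \<epsilon>_def)

lemma M_smooth_eps: "y \<in> V \<Longrightarrow> smooth_at M (y, \<epsilon>)" "y \<in> V \<Longrightarrow> smooth_at M (\<epsilon>, y)"
  by (auto intro!: M_smooth simp: eps group_simps q_in)

lemma M_smooth_J: "y \<in> V1 \<Longrightarrow> smooth_at M (J y, y)" "y \<in> V1 \<Longrightarrow> smooth_at M (y, J y)"
  by (auto intro!: M_smooth simp: V1D group_simps one_in)

text \<open>
  \<open>R y\<close> is the differential at the identity of left translation by \<open>q y\<close>, and \<open>Lt y\<close> the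
  differential at \<open>q y\<close> of the inverse translation. As \<open>M (x, \<epsilon>) = M (\<epsilon>, x) = x\<close>, the mixed part
  \<open>\<beta>\<close> is the whole second derivative of the multiplication; its antisymmetrization is the bracket.
\<close>

abbreviation "DM p \<equiv> frechet_derivative M (at p)"
definition "R y v = DM (y, \<epsilon>) (0, v)"
definition "Lt y v = DM (J y, y) (0, v)"
definition "\<beta> u v = second_derivative M (\<epsilon>, \<epsilon>) (u, 0) (0, v)"

lemma Pair_right_deriv: "((\<lambda>z. (y, z)) has_derivative (\<lambda>u. (0, u))) (at x)"
  and Pair_left_deriv: "((\<lambda>z. (z, y)) has_derivative (\<lambda>u. (u, 0))) (at x)"
  by (auto intro!: derivative_eq_intros)

lemma R_deriv: "y \<in> V \<Longrightarrow> ((\<lambda>z. M (y, z)) has_derivative R y) (at \<epsilon>)"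
  unfolding R_def by (rule frechet_derivative_partial[where g = "\<lambda>z. (y, z)"])
    (auto intro: M_smooth_eps Pair_right_deriv)

lemma Lt_deriv: "y \<in> V1 \<Longrightarrow> ((\<lambda>z. M (J y, z)) has_derivative Lt y) (at y)"
  unfolding Lt_def by (rule frechet_derivative_partial[where g = "\<lambda>z. (J y, z)"])
    (auto intro: M_smooth_J Pair_right_deriv)

text \<open>The recurring device: write one germ in two ways and compare the derivatives.\<close>

lemma has_derivative_unique_nhds:
  assumes "(f has_derivative D) (at z)" "(g has_derivative E) (at z)" "\<forall>\<^sub>F x in nhds z. f x = g x"
  shows "D u = E u"
  using has_derivative_unique[OF has_derivative_cong_nhds[OF assms(1,3)] assms(2)] by simp

lemma M_cancel:
  assumes "y \<in> V1" "z \<in> V" "q y \<otimes> q z \<in> U" shows "M (J y, M (y, z)) = z"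
  using assms by (simp add: M_def V1D qX group_simps Xq)

lemma M_cancel':
  assumes "y \<in> V1" "z \<in> V" "inv (q y) \<otimes> q z \<in> U" shows "M (y, M (J y, z)) = z"
  using assms by (simp add: M_def V1D qX group_simps Xq)

lemma Lt_R: assumes "y \<in> V1" shows "Lt y (R y v) = v"
proof (rule has_derivative_unique_nhds[where D = "\<lambda>u. Lt y (R y u)" and E = "\<lambda>u. u"])
  have y: "y \<in> V" using assms V1D by blast
  show "((\<lambda>z. M (J y, M (y, z))) has_derivative (\<lambda>u. Lt y (R y u))) (at \<epsilon>)"
    using Lt_deriv[OF assms] by (intro has_derivative_compose[OF R_deriv[OF y], where g = "\<lambda>z. M (J y, z)"])
      (simp add: M_eps y)
  show "((\<lambda>z. z) has_derivative (\<lambda>u. u)) (at \<epsilon>)" by (rule has_derivative_ident)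
  show "\<forall>\<^sub>F z in nhds \<epsilon>. M (J y, M (y, z)) = z"
  proof -
    have "\<forall>\<^sub>F z in nhds \<epsilon>. q y \<otimes> q z \<in> U"
      by (rule eventually_q_eps) (auto intro!: cont_intros simp: group_simps q_in[OF y])
    with eventually_V[OF eps(1)] show ?thesis by eventually_elim (rule M_cancel[OF assms])
  qed
qed

lemma R_Lt: assumes "y \<in> V1" shows "R y (Lt y v) = v"
proof (rule has_derivative_unique_nhds[where D = "\<lambda>u. R y (Lt y u)" and E = "\<lambda>u. u"])
  have y: "y \<in> V" using assms V1D by blast
  show "((\<lambda>z. M (y, M (J y, z))) has_derivative (\<lambda>u. R y (Lt y u))) (at y)"
    using R_deriv[OF y] by (intro has_derivative_compose[OF Lt_deriv[OF assms], where g = "\<lambda>z. M (y, z)"])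
      (simp add: M_J assms)
  show "((\<lambda>z. z) has_derivative (\<lambda>u. u)) (at y)" by (rule has_derivative_ident)
  show "\<forall>\<^sub>F z in nhds y. M (y, M (J y, z)) = z"
  proof -
    have "\<forall>\<^sub>F z in nhds y. inv (q y) \<otimes> q z \<in> U"
      by (rule eventually_q[OF y _ _ open_U]) (auto intro!: cont_intros one_in simp: group_simps)
    with eventually_V[OF y] show ?thesis by eventually_elim (rule M_cancel'[OF assms])
  qed
qed

lemma DM_linear: "smooth_at M p \<Longrightarrow> linear (DM p)" by (rule smooth_at_linear)

lemma linear_R: "y \<in> V \<Longrightarrow> linear (R y)" using R_deriv has_derivative_linear by blast
lemma linear_Lt: "y \<in> V1 \<Longrightarrow> linear (Lt y)" using Lt_deriv has_derivative_linear by blast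

lemma DM_left: assumes "y \<in> V" shows "DM (y, \<epsilon>) (u, 0) = u"
proof (rule has_derivative_unique_nhds[where D = "\<lambda>u. DM (y, \<epsilon>) (u, 0)" and E = "\<lambda>u. u"])
  show "((\<lambda>z. M (z, \<epsilon>)) has_derivative (\<lambda>u. DM (y, \<epsilon>) (u, 0))) (at y)"
    by (rule frechet_derivative_partial[where g = "\<lambda>z. (z, \<epsilon>)"])
       (auto intro: M_smooth_eps assms Pair_left_deriv)
  show "((\<lambda>z. z) has_derivative (\<lambda>u. u)) (at y)" by (rule has_derivative_ident)
  show "\<forall>\<^sub>F z in nhds y. M (z, \<epsilon>) = z" using eventually_V[OF assms] by eventually_elim (rule M_eps)
qed

lemma DM_right: assumes "y \<in> V" shows "DM (\<epsilon>, y) (0, u) = u"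
proof (rule has_derivative_unique_nhds[where D = "\<lambda>u. DM (\<epsilon>, y) (0, u)" and E = "\<lambda>u. u"])
  show "((\<lambda>z. M (\<epsilon>, z)) has_derivative (\<lambda>u. DM (\<epsilon>, y) (0, u))) (at y)"
    by (rule frechet_derivative_partial[where g = "\<lambda>z. (\<epsilon>, z)"])
       (auto intro: M_smooth_eps assms Pair_right_deriv)
  show "((\<lambda>z. z) has_derivative (\<lambda>u. u)) (at y)" by (rule has_derivative_ident)
  show "\<forall>\<^sub>F z in nhds y. M (\<epsilon>, z) = z" using eventually_V[OF assms] by eventually_elim (rule M_eps)
qed

lemma DM_eps: "DM (\<epsilon>, \<epsilon>) (u, v) = u + v"
  using linear_add[OF DM_linear[OF M_smooth_eps(1)[OF eps(1)]], of "(u, 0)" "(0, v)"]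
  by (simp add: DM_left DM_right eps(1))

lemma R_eps: "R \<epsilon> v = v" by (simp add: R_def DM_eps)
lemma Lt_eps: "Lt \<epsilon> v = v" by (simp add: Lt_def J_eps DM_eps)

text \<open>Differentiate \<open>M (z, J z) = \<epsilon>\<close>, using that the differential of
  \<open>M\<close> at the identity is addition.\<close>

lemma J_deriv: "(J has_derivative (\<lambda>u. - u)) (at \<epsilon>)"
proof -
  let ?J = "frechet_derivative J (at \<epsilon>)"
  have d: "(J has_derivative ?J) (at \<epsilon>)" by (rule smooth_at_has_derivative[OF J_smooth[OF eps_V1]])
  have "u + ?J u = 0" for u
  proof (rule has_derivative_unique_nhds[where D = "\<lambda>u. u + ?J u" and E = "\<lambda>u. 0"])
    show "((\<lambda>z. M (z, J z)) has_derivative (\<lambda>u. u + ?J u)) (at \<epsilon>)"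
      using frechet_derivative_partial[of M "\<lambda>z. (z, J z)", OF _ has_derivative_Pair[OF has_derivative_ident d]]
      by (simp add: J_eps M_smooth_eps eps DM_eps)
    show "((\<lambda>z. \<epsilon>) has_derivative (\<lambda>u. 0)) (at \<epsilon>)" by (rule has_derivative_const)
    show "\<forall>\<^sub>F z in nhds \<epsilon>. M (z, J z) = \<epsilon>" using eventually_V1[OF eps_V1] by eventually_elim (rule M_J)
  qed
  then have "?J = (\<lambda>u. - u)" by (auto simp: fun_eq_iff add_eq_0_iff)
  with d show ?thesis by simp
qed

lemma M2_left: "second_derivative M (\<epsilon>, \<epsilon>) (u, 0) (v, 0) = 0"
proof (rule has_derivative_unique_nhds[where D = "\<lambda>u. second_derivative M (\<epsilon>, \<epsilon>) (u, 0) (v, 0)" and E = "\<lambda>u. 0"])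
  show "((\<lambda>y. DM (y, \<epsilon>) (v, 0)) has_derivative (\<lambda>u. second_derivative M (\<epsilon>, \<epsilon>) (u, 0) (v, 0))) (at \<epsilon>)"
    using has_derivative_frechet_along[of "\<lambda>y. (y, \<epsilon>)", OF Pair_left_deriv _ has_derivative_const, of M \<epsilon> "(v, 0)"]
    by (simp add: M_smooth_eps eps linear_0[OF DM_linear])
  show "((\<lambda>y. v) has_derivative (\<lambda>u. 0)) (at \<epsilon>)" by (rule has_derivative_const)
  show "\<forall>\<^sub>F y in nhds \<epsilon>. DM (y, \<epsilon>) (v, 0) = v" using eventually_V[OF eps(1)] by eventually_elim (rule DM_left)
qed

lemma M2_right: "second_derivative M (\<epsilon>, \<epsilon>) (0, u) (0, v) = 0"
proof (rule has_derivative_unique_nhds[where D = "\<lambda>u. second_derivative M (\<epsilon>, \<epsilon>) (0, u) (0, v)" and E = "\<lambda>u. 0"])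
  show "((\<lambda>y. DM (\<epsilon>, y) (0, v)) has_derivative (\<lambda>u. second_derivative M (\<epsilon>, \<epsilon>) (0, u) (0, v))) (at \<epsilon>)"
    using has_derivative_frechet_along[of "\<lambda>y. (\<epsilon>, y)", OF Pair_right_deriv _ has_derivative_const, of M \<epsilon> "(0, v)"]
    by (simp add: M_smooth_eps eps linear_0[OF DM_linear])
  show "((\<lambda>y. v) has_derivative (\<lambda>u. 0)) (at \<epsilon>)" by (rule has_derivative_const)
  show "\<forall>\<^sub>F y in nhds \<epsilon>. DM (\<epsilon>, y) (0, v) = v" using eventually_V[OF eps(1)] by eventually_elim (rule DM_right)
qed

lemma M2: "second_derivative M (\<epsilon>, \<epsilon>) (a, b) (u, v) = \<beta> a v + \<beta> u b"
proof -
  have s: "smooth_at M (\<epsilon>, \<epsilon>)" using M_smooth_eps eps by blast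
  let ?D = "second_derivative M (\<epsilon>, \<epsilon>)"
  have "?D (a, b) (u, v) = ?D (a, b) (u, 0) + ?D (a, b) (0, v)"
    using linear_add[OF second_derivative_linear_right[OF s], of "(a, b)" "(u, 0)" "(0, v)"] by simp
  also have "?D (a, b) (u, 0) = ?D (a, 0) (u, 0) + ?D (0, b) (u, 0)"
    using linear_add[OF second_derivative_linear_left[OF s, of "(u, 0)"], of "(a, 0)" "(0, b)"] by simp
  also have "?D (a, b) (0, v) = ?D (a, 0) (0, v) + ?D (0, b) (0, v)"
    using linear_add[OF second_derivative_linear_left[OF s, of "(0, v)"], of "(a, 0)" "(0, b)"] by simp
  \<comment> \<open>Symmetry of second derivatives is what allows a single form
    \<open>\<beta>\<close> to describe both mixed blocks.\<close>
  also have "?D (0, b) (u, 0) = ?D (u, 0) (0, b)" by (rule second_derivative_commute[OF s])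
  finally show ?thesis by (simp add: M2_left M2_right \<beta>_def)
qed

lemma bilinear_\<beta>: "bilinear \<beta>"
proof -
  have s: "smooth_at M (\<epsilon>, \<epsilon>)" using M_smooth_eps eps by blast
  have "linear (\<lambda>u. (u, 0 :: 'e))" "linear (\<lambda>v. (0 :: 'e, v))" by (simp_all add: linear_iff)
  from linear_compose[OF this(1) second_derivative_linear_left[OF s]]
    linear_compose[OF this(2) second_derivative_linear_right[OF s]]
  show ?thesis by (simp add: bilinear_def \<beta>_def[abs_def] o_def)
qed

lemmas \<beta>_simps = bilinear_ladd[OF bilinear_\<beta>] bilinear_lmul[OF bilinear_\<beta>] bilinear_radd[OF bilinear_\<beta>]
  bilinear_rmul[OF bilinear_\<beta>] bilinear_lneg[OF bilinear_\<beta>] bilinear_rneg[OF bilinear_\<beta>]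
  bilinear_lzero[OF bilinear_\<beta>] bilinear_rzero[OF bilinear_\<beta>]

lemma R_deriv_base: "((\<lambda>y. R y v) has_derivative (\<lambda>u. \<beta> u v)) (at \<epsilon>)"
  using has_derivative_frechet_along[of "\<lambda>y. (y, \<epsilon>)", OF Pair_left_deriv _ has_derivative_const, of M \<epsilon> "(0, v)"]
  by (simp add: M_smooth_eps eps linear_0[OF DM_linear] M2 \<beta>_simps R_def)

text \<open>The sign comes from the derivative of \<open>J\<close>; moving the second slot
  contributes nothing, as there is no pure second derivative.\<close>

lemma Lt_deriv_base: "((\<lambda>y. Lt y v) has_derivative (\<lambda>u. - \<beta> u v)) (at \<epsilon>)"
  using has_derivative_frechet_along[of "\<lambda>y. (J y, y)", OF has_derivative_Pair[OF J_deriv has_derivative_ident]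
      _ has_derivative_const, of M "(0, v)"]
  by (simp add: M_smooth_eps eps J_eps linear_0[OF DM_linear] M2 \<beta>_simps Lt_def)

lemma Lt_smooth:
  assumes "smooth_at p z" "p z \<in> V1" "smooth_at w z"
  shows "smooth_at (\<lambda>x. Lt (p x) (w x)) z"
  unfolding Lt_def
  using assms
  by (intro smooth_at_frechet smooth_at_Pair smooth_at_const M_smooth_J
      smooth_at_compose[OF assms(1) J_smooth])

lemma R_smooth:
  assumes "smooth_at p z" "p z \<in> V" "smooth_at w z"
  shows "smooth_at (\<lambda>x. R (p x) (w x)) z"
  unfolding R_def
  using assms by (intro smooth_at_frechet smooth_at_Pair smooth_at_const M_smooth_eps)

end

lemma isCont_filterlim: "isCont f z \<Longrightarrow> filterlim f (nhds (f z)) (nhds z)"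
  by (simp add: isCont_def tendsto_at_iff_tendsto_nhds)

section \<open>Conjugation, the adjoint representation and the bracket\<close>

context lie_group_chart
begin

interpretation group N by (rule grp)

text \<open>For \<open>b = inv a\<close> this is conjugation; other pairs occur in
  \<open>chart_hom_id\<close>.\<close>

definition "sandwich a b t = X (a \<otimes> q t \<otimes> b)"

lemma sandwich:
  assumes "a \<in> U" "b \<in> U" "a \<otimes> b \<in> U"
  shows sandwich_deriv: "(sandwich a b has_derivative (\<lambda>v. DM (X a, X b) (R (X a) v, 0))) (at \<epsilon>)"
    and sandwich_smooth: "smooth_at (sandwich a b) \<epsilon>"
proof -
  have X: "X a \<in> V" "X b \<in> V" "q (X a) = a" "q (X b) = b" using assms X_in qX by auto
  have "\<forall>\<^sub>F t in nhds \<epsilon>. a \<otimes> q t \<in> U"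
    by (rule eventually_q_eps) (auto intro!: cont_intros simp: group_simps assms)
  then have ev: "\<forall>\<^sub>F t in nhds \<epsilon>. sandwich a b t = M (M (X a, t), X b)"
    by eventually_elim (simp add: sandwich_def M_def X qX)
  have m: "smooth_at M (X a, X b)" using assms X by (intro M_smooth) auto
  show "(sandwich a b has_derivative (\<lambda>v. DM (X a, X b) (R (X a) v, 0))) (at \<epsilon>)"
    using m frechet_derivative_partial[of M "\<lambda>t. (M (X a, t), X b)", OF _
        has_derivative_Pair[OF R_deriv[OF X(1)] has_derivative_const] ev]
    by (simp add: M_eps X)
  have "smooth_at (\<lambda>t. M (X a, t)) \<epsilon>"
    by (rule smooth_at_compose[OF smooth_at_Pair[OF smooth_at_const smooth_at_id] M_smooth_eps(1)[OF X(1)]])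
  then have "smooth_at (\<lambda>t. M (M (X a, t), X b)) \<epsilon>"
    by (rule smooth_at_compose[OF smooth_at_Pair[OF _ smooth_at_const]]) (simp add: M_eps X m)
  then show "smooth_at (sandwich a b) \<epsilon>"
    by (rule smooth_at_cong) (use ev in \<open>eventually_elim, simp\<close>)
qed

abbreviation "br \<equiv> lie_bracket N c"
abbreviation "C y \<equiv> sandwich (q y) (inv (q y))"
abbreviation "Ad y \<equiv> Ad_map N c (q y)"

lemma C_eps: "C y \<epsilon> = \<epsilon>"
  by (simp add: sandwich_def eps group_simps) (simp add: \<epsilon>_def)

lemma Ad_eq: assumes "y \<in> V1" shows "Ad y = (\<lambda>v. DM (y, J y) (R y v, 0))"
  and C_deriv: "(C y has_derivative Ad y) (at \<epsilon>)"
proof -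
  have q: "q y \<in> U" "inv (q y) \<in> U" "q y \<otimes> inv (q y) \<in> U" "X (q y) = y" "X (inv (q y)) = J y"
    using assms V1D q_in Xq by (auto simp: group_simps one_in J_def)
  have "(C y has_derivative (\<lambda>v. DM (y, J y) (R y v, 0))) (at \<epsilon>)"
    using sandwich_deriv[OF q(1-3)] by (simp add: q)
  moreover have "Ad y = frechet_derivative (C y) (at \<epsilon>)"
    by (simp add: Ad_map_def tangent_map_def sandwich_def[abs_def] o_def \<epsilon>_def)
  ultimately show "Ad y = (\<lambda>v. DM (y, J y) (R y v, 0))" "(C y has_derivative Ad y) (at \<epsilon>)"
    using frechet_derivativeI[of "C y" _ \<epsilon>] by simp_all
qed

lemma linear_Ad: "y \<in> V1 \<Longrightarrow> linear (Ad y)"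
  using C_deriv has_derivative_linear by blast

lemma Ad_smooth: assumes "y \<in> V1" shows "smooth_at (\<lambda>y. Ad y v) y"
proof (rule smooth_at_cong)
  show "smooth_at (\<lambda>y. DM (y, J y) (R y v, 0)) y"
    using assms V1D
    by (intro smooth_at_frechet smooth_at_Pair smooth_at_const smooth_at_id J_smooth M_smooth_J R_smooth) auto
  show "\<forall>\<^sub>F y in nhds y. DM (y, J y) (R y v, 0) = Ad y v"
    using eventually_V1[OF assms] by eventually_elim (simp add: Ad_eq)
qed

text \<open>Moving the left factor \<open>y\<close> gives \<open>\<beta> u v\<close>; moving the
  right factor \<open>J y\<close>, whose derivative is \<open>- u\<close>, gives
  \<open>- \<beta> v u\<close>.\<close>

lemma Ad_deriv_\<beta>: "((\<lambda>y. Ad y v) has_derivative (\<lambda>u. \<beta> u v - \<beta> v u)) (at \<epsilon>)"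
proof (rule has_derivative_cong_nhds)
  show "((\<lambda>y. DM (y, J y) (R y v, 0)) has_derivative (\<lambda>u. \<beta> u v - \<beta> v u)) (at \<epsilon>)"
    using has_derivative_frechet_along[of "\<lambda>y. (y, J y)", OF has_derivative_Pair[OF has_derivative_ident J_deriv]
      _ has_derivative_Pair[OF R_deriv_base has_derivative_const], of M v 0]
    by (simp add: J_eps M_smooth_eps eps M2 \<beta>_simps DM_eps R_eps algebra_simps)
  show "\<forall>\<^sub>F y in nhds \<epsilon>. DM (y, J y) (R y v, 0) = Ad y v"
    using eventually_V1[OF eps_V1] by eventually_elim (simp add: Ad_eq)
qed

lemma br_eq: "br u v = \<beta> u v - \<beta> v u"
  using frechet_derivativeI[OF Ad_deriv_\<beta>] by (simp add: lie_bracket_def flip: \<epsilon>_def)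

lemma Ad_deriv: "((\<lambda>y. Ad y v) has_derivative (\<lambda>u. br u v)) (at \<epsilon>)"
  using Ad_deriv_\<beta> by (simp add: br_eq)

lemma Ad_eps: "Ad \<epsilon> v = v"
  by (simp add: Ad_eq[OF eps_V1] J_eps DM_eps R_eps)

lemma bilinear_br: "bilinear br"
  unfolding bilinear_def
  by (auto simp: br_eq \<beta>_simps algebra_simps intro!: linearI)

lemma br_self: "br u u = 0" by (simp add: br_eq)

text \<open>Differentiability is asked at the identity only. The instances are conjugations and the
  automorphisms in \<open>H\<close>.\<close>

definition chart_hom :: "('a \<Rightarrow> 'a) \<Rightarrow> ('e \<Rightarrow> 'e) \<Rightarrow> bool" where
  "chart_hom f P \<longleftrightarrow> continuous_on UNIV f \<and> (\<forall>a b. f (a \<otimes> b) = f a \<otimes> f b) \<and>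
     ((\<lambda>x. X (f (q x))) has_derivative P) (at \<epsilon>)"

lemma chart_hom_one: assumes "chart_hom f P" shows "f \<one> = \<one>"
proof -
  have "f (\<one> \<otimes> \<one>) = f \<one> \<otimes> f \<one>" using assms by (simp only: chart_hom_def)
  then have "f \<one> \<otimes> f \<one> = f \<one> \<otimes> \<one>" by (simp add: group_simps)
  then have "inv (f \<one>) \<otimes> (f \<one> \<otimes> f \<one>) = inv (f \<one>) \<otimes> (f \<one> \<otimes> \<one>)" by simp
  then show ?thesis by (simp add: group_simps)
qed

lemma chart_hom_inv: assumes "chart_hom f P" shows "f (inv a) = inv (f a)"
proof -
  have "f (inv a) \<otimes> f a = \<one>"
    using assms chart_hom_one[OF assms] group_simps(4)[of a] by (metis chart_hom_def)
  then have "f (inv a) \<otimes> f a \<otimes> inv (f a) = \<one> \<otimes> inv (f a)" by simp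
  then show ?thesis by (simp add: group_simps)
qed

lemma chart_hom_tendsto:
  assumes "chart_hom f P"
  shows "filterlim (\<lambda>x. X (f (q x))) (nhds \<epsilon>) (nhds \<epsilon>)"
proof -
  have "isCont (\<lambda>x. X (f (q x))) \<epsilon>"
    using assms has_derivative_continuous unfolding chart_hom_def by blast
  then have "filterlim (\<lambda>x. X (f (q x))) (nhds (X (f (q \<epsilon>)))) (nhds \<epsilon>)"
    by (rule isCont_filterlim)
  then show ?thesis by (simp add: eps chart_hom_one[OF assms] flip: \<epsilon>_def)
qed

lemma chart_hom_Ad:
  assumes f: "chart_hom f P" and y: "y \<in> V1" "f (q y) \<in> U" "X (f (q y)) \<in> V1"
  shows "P (Ad y v) = Ad (X (f (q y))) (P v)"
proof (rule has_derivative_unique_nhds[where D = "\<lambda>v. P (Ad y v)" and E = "\<lambda>v. Ad (X (f (q y))) (P v)"])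
  let ?f = "\<lambda>x. X (f (q x))"
  have fd: "(?f has_derivative P) (at \<epsilon>)" and fc: "continuous_on UNIV f" and fh: "\<And>a b. f (a \<otimes> b) = f a \<otimes> f b"
    using f by (auto simp: chart_hom_def)
  have f1: "?f \<epsilon> = \<epsilon>" by (simp add: eps chart_hom_one[OF f]) (simp add: \<epsilon>_def)
  show "((\<lambda>x. ?f (C y x)) has_derivative (\<lambda>v. P (Ad y v))) (at \<epsilon>)"
    using has_derivative_compose[OF C_deriv[OF y(1)], of ?f P] fd by (simp add: C_eps)
  show "((\<lambda>x. C (?f y) (?f x)) has_derivative (\<lambda>v. Ad (?f y) (P v))) (at \<epsilon>)"
    using has_derivative_compose[OF fd, of "C (?f y)"] C_deriv[OF y(3)] by (simp only: f1)
  have "\<forall>\<^sub>F x in nhds \<epsilon>. f (q x) \<in> U"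
    by (rule eventually_q_eps) (use fc chart_hom_one[OF f] one_in in auto)
  moreover have "\<forall>\<^sub>F x in nhds \<epsilon>. q y \<otimes> q x \<otimes> inv (q y) \<in> U"
    by (rule eventually_q_eps) (auto intro!: cont_intros simp: group_simps one_in)
  ultimately show "\<forall>\<^sub>F x in nhds \<epsilon>. ?f (C y x) = C (?f y) (?f x)"
    by eventually_elim (simp add: sandwich_def qX y fh chart_hom_inv[OF f])
qed

text \<open>Differentiating \<open>f\<close> after conjugation gives \<open>chart_hom_Ad\<close>;
  differentiating that identity in \<open>y\<close> gives the bracket.\<close>

lemma chart_hom_br:
  assumes f: "chart_hom f P" shows "P (br u v) = br (P u) (P v)"
proof (rule has_derivative_unique_nhds[where D = "\<lambda>u. P (br u v)" and E = "\<lambda>u. br (P u) (P v)"])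
  let ?f = "\<lambda>x. X (f (q x))"
  have fd: "(?f has_derivative P) (at \<epsilon>)" and fc: "continuous_on UNIV f" using f by (auto simp: chart_hom_def)
  have f1: "?f \<epsilon> = \<epsilon>" by (simp add: eps chart_hom_one[OF f]) (simp add: \<epsilon>_def)
  show "((\<lambda>y. P (Ad y v)) has_derivative (\<lambda>u. P (br u v))) (at \<epsilon>)"
    by (rule bounded_linear.has_derivative[OF has_derivative_bounded_linear[OF fd] Ad_deriv])
  show "((\<lambda>y. Ad (?f y) (P v)) has_derivative (\<lambda>u. br (P u) (P v))) (at \<epsilon>)"
    using has_derivative_compose[OF fd, of "\<lambda>y. Ad y (P v)" "\<lambda>u. br u (P v)"] Ad_deriv by (simp only: f1)
  have "\<forall>\<^sub>F x in nhds \<epsilon>. f (q x) \<in> U"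
    by (rule eventually_q_eps) (use fc chart_hom_one[OF f] one_in in auto)
  moreover have "\<forall>\<^sub>F x in nhds \<epsilon>. ?f x \<in> V1"
    by (rule eventually_compose_filterlim[OF eventually_V1[OF eps_V1] chart_hom_tendsto[OF f]])
  ultimately show "\<forall>\<^sub>F y in nhds \<epsilon>. P (Ad y v) = Ad (?f y) (P v)"
    using eventually_V1[OF eps_V1] by eventually_elim (rule chart_hom_Ad[OF f])
qed

lemma chart_hom_conj: assumes "y \<in> V1" shows "chart_hom (\<lambda>x. q y \<otimes> x \<otimes> inv (q y)) (Ad y)"
  using C_deriv[OF assms] unfolding chart_hom_def sandwich_def[abs_def]
  by (auto intro!: cont_intros simp: group_simps)

lemma bounded_bilinear_br: "bounded_bilinear br"
  using bilinear_br by (simp add: bilinear_conv_bounded_bilinear)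

text \<open>\<open>Ad y\<close> preserves the bracket because conjugation is a homomorphism; the
  derivative of this at the identity is the Jacobi identity.\<close>

lemma jacobi: "br w (br u v) = br (br w u) v + br u (br w v)"
proof (rule has_derivative_unique_nhds[where D = "\<lambda>w. br w (br u v)" and E = "\<lambda>w. br (br w u) v + br u (br w v)"])
  show "((\<lambda>y. Ad y (br u v)) has_derivative (\<lambda>w. br w (br u v))) (at \<epsilon>)" by (rule Ad_deriv)
  show "((\<lambda>y. br (Ad y u) (Ad y v)) has_derivative (\<lambda>w. br (br w u) v + br u (br w v))) (at \<epsilon>)"
    using bounded_bilinear.FDERIV[OF bounded_bilinear_br Ad_deriv Ad_deriv, of u v]
    by (simp add: Ad_eps add.commute)
  show "\<forall>\<^sub>F y in nhds \<epsilon>. Ad y (br u v) = br (Ad y u) (Ad y v)"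
    using eventually_V1[OF eps_V1] by eventually_elim (rule chart_hom_br[OF chart_hom_conj])
qed

text \<open>
  Commutators with \<open>q y\<close> show that \<open>Ad y - 1\<close> moves \<open>tangent_lcs j\<close> into \<open>tangent_lcs (Suc j)\<close>.
  Differentiating in \<open>y\<close> turns \<open>Ad y - 1\<close> into \<open>ad\<close>, so nilpotency passes from the group to the bracket.
\<close>

definition tangent_lcs :: "nat \<Rightarrow> 'e set" where
  "tangent_lcs j = {P v |f P v. continuous_on UNIV f \<and> f \<one> = \<one> \<and>
     (\<forall>x. f x \<in> lower_central_series N j) \<and> ((\<lambda>x. X (f (q x))) has_derivative P) (at \<epsilon>)}"

lemma tangent_lcs_0: "w \<in> tangent_lcs 0"
proof -
  have "((\<lambda>x. X (q x)) has_derivative (\<lambda>v. v)) (at \<epsilon>)"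
    by (rule has_derivative_cong_nhds[OF has_derivative_ident])
       (use eventually_V[OF eps(1)] in \<open>eventually_elim, simp add: Xq\<close>)
  then show ?thesis unfolding tangent_lcs_def
    by (intro CollectI exI[of _ "\<lambda>x. x"] exI[of _ "\<lambda>v. v"] exI[of _ w]) (auto simp: carrier)
qed

lemma tangent_lcs_trivial:
  assumes "lower_central_series N j = {\<one>}" "w \<in> tangent_lcs j" shows "w = 0"
proof -
  obtain f P v where f: "\<And>x. f x = \<one>" "((\<lambda>x. X (f (q x))) has_derivative P) (at \<epsilon>)" "w = P v"
    using assms unfolding tangent_lcs_def by auto
  have "P = (\<lambda>_. 0)" using has_derivative_unique[OF f(2)] f(1) by simp
  then show ?thesis using f(3) by simp
qed

lemma tangent_lcs_Suc:
  assumes w: "w \<in> tangent_lcs j" and y: "y \<in> V1"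
  shows "Ad y w - w \<in> tangent_lcs (Suc j)"
proof -
  obtain f P v where f: "continuous_on UNIV f" "f \<one> = \<one>" "\<And>x. f x \<in> lower_central_series N j"
    and fd: "((\<lambda>x. X (f (q x))) has_derivative P) (at \<epsilon>)" and v: "w = P v"
    using w unfolding tangent_lcs_def by auto
  let ?f = "\<lambda>x. X (f (q x))"
  \<comment> \<open>The commutator with \<open>q y\<close> is a generator of the next term of the
    series. In coordinates it is the product of \<open>C y (f x)\<close> with the inverse of
    \<open>f x\<close>, so its differential is \<open>Ad y\<close> minus the identity, applied to
    \<open>P\<close>.\<close>
  define g where "g x = q y \<otimes> f x \<otimes> inv (q y) \<otimes> inv (f x)" for x
  have f1: "?f \<epsilon> = \<epsilon>" by (simp add: eps f) (simp add: \<epsilon>_def)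
  have "continuous_on UNIV g" unfolding g_def[abs_def] by (intro cont_intros f)
  moreover have "g \<one> = \<one>" by (simp add: g_def f group_simps)
  moreover have "g x \<in> lower_central_series N (Suc j)" for x
    unfolding g_def using f(3) carrier by (auto intro!: generate.incl)
  moreover have "((\<lambda>x. X (g (q x))) has_derivative (\<lambda>v. Ad y (P v) + - P v)) (at \<epsilon>)"
  proof -
    have "\<forall>\<^sub>F x in nhds \<epsilon>. f (q x) \<in> U" "\<forall>\<^sub>F x in nhds \<epsilon>. inv (f (q x)) \<in> U"
      "\<forall>\<^sub>F x in nhds \<epsilon>. q y \<otimes> f (q x) \<otimes> inv (q y) \<in> U"
      by (rule eventually_q_eps; use one_in in \<open>auto intro!: cont_intros f(1) simp: group_simps f(2)\<close>)+
    then have ev: "\<forall>\<^sub>F x in nhds \<epsilon>. X (g (q x)) = M (C y (?f x), J (?f x))"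
      by eventually_elim (simp add: g_def M_def J_def sandwich_def qX)
    have "((\<lambda>x. C y (?f x)) has_derivative (\<lambda>v. Ad y (P v))) (at \<epsilon>)"
      using has_derivative_compose[OF fd, of "C y"] C_deriv[OF y] by (simp only: f1)
    moreover have "((\<lambda>x. J (?f x)) has_derivative (\<lambda>v. - P v)) (at \<epsilon>)"
      using has_derivative_compose[OF fd, of J] J_deriv by (simp only: f1)
    ultimately have d: "((\<lambda>x. (C y (?f x), J (?f x))) has_derivative (\<lambda>v. (Ad y (P v), - P v))) (at \<epsilon>)"
      by (rule has_derivative_Pair)
    show ?thesis
      using frechet_derivative_partial[OF _ d ev] M_smooth_eps(1)[OF eps(1)] by (simp only: f1 C_eps J_eps DM_eps)
  qed
  ultimately show ?thesis unfolding tangent_lcs_def v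
    by (intro CollectI exI[of _ g] exI[of _ "\<lambda>v. Ad y (P v) + - P v"] exI[of _ v]) auto
qed

text \<open>\<open>tangent_lcs\<close> is not shown to be closed under limits, so
  \<open>br u w\<close> is not placed in the next one. Instead the linear map
  \<open>foldr br vs\<close> kills \<open>Ad y w - w\<close> for all \<open>y\<close> near the
  identity, and this equation is differentiated in \<open>y\<close>.\<close>

lemma foldr_br_zero:
  assumes k: "lower_central_series N k = {\<one>}"
  shows "i \<le> k \<Longrightarrow> length us = i \<Longrightarrow> w \<in> tangent_lcs (k - i) \<Longrightarrow> foldr br us w = 0"
proof (induction i arbitrary: us w)
  case 0
  then show ?case using tangent_lcs_trivial[OF k] by simp
next
  case (Suc i)
  obtain vs u where us: "us = vs @ [u]" "length vs = i"
    using Suc.prems(2) by (metis length_Suc_conv_rev)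
  have lin: "bounded_linear (foldr br vs)"
    using linear_foldr[OF bilinear_br] linear_conv_bounded_linear by blast
  have "foldr br vs (br u w) = 0"
  proof (rule has_derivative_unique_nhds[where D = "\<lambda>u. foldr br vs (br u w)" and E = "\<lambda>u. 0"])
    have "((\<lambda>y. Ad y w - w) has_derivative (\<lambda>u. br u w)) (at \<epsilon>)"
      using has_derivative_diff[OF Ad_deriv has_derivative_const, of w w] by simp
    then show "((\<lambda>y. foldr br vs (Ad y w - w)) has_derivative (\<lambda>u. foldr br vs (br u w))) (at \<epsilon>)"
      by (rule bounded_linear.has_derivative[OF lin])
    show "((\<lambda>y. 0) has_derivative (\<lambda>u. 0)) (at \<epsilon>)" by (rule has_derivative_const)
    have "Suc (k - Suc i) = k - i" using Suc.prems(1) by simp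
    then have "foldr br vs (Ad y w - w) = 0" if "y \<in> V1" for y
      using Suc.IH[OF _ us(2)] tangent_lcs_Suc[OF Suc.prems(3) that] Suc.prems(1) by simp
    then show "\<forall>\<^sub>F y in nhds \<epsilon>. foldr br vs (Ad y w - w) = 0"
      using eventually_V1[OF eps_V1] by (auto elim: eventually_mono)
  qed
  then show ?case by (simp add: us)
qed

lemma br_nilpotent:
  assumes "lower_central_series N k = {\<one>}" "length us = k"
  shows "foldr br us w = 0"
  using foldr_br_zero[OF assms(1) order_refl assms(2)] tangent_lcs_0 by simp


section \<open>From vanishing bracket to commutative group\<close>

lemma open_subgroup_UNIV:
  assumes conn: "connected (UNIV :: 'a set)"
    and S: "\<And>a b. a \<in> S \<Longrightarrow> b \<in> S \<Longrightarrow> a \<otimes> b \<in> S" "\<And>a. a \<in> S \<Longrightarrow> inv a \<in> S"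
    and nbhd: "\<forall>\<^sub>F y in nhds \<epsilon>. q y \<in> S"
  shows "a \<in> S"
proof -
  obtain T where T: "open T" "\<epsilon> \<in> T" "\<And>y. y \<in> T \<Longrightarrow> q y \<in> S"
    using nbhd by (auto simp: eventually_nhds)
  define W where "W = X -` T \<inter> U"
  have W: "open W" "\<one> \<in> W" "W \<subseteq> S"
    using continuous_on_open_vimage[OF open_U] homeomorphism_cont1[OF homeo] T(1) T(2) one_in T(3) qX
    by (auto simp: W_def \<epsilon>_def) metis
  have oW: "open ((\<lambda>p. inv a \<otimes> p) -` W)" for a
    using continuous_on_open_vimage[OF open_UNIV, of "\<lambda>p. inv a \<otimes> p"] W(1) by (auto intro!: cont_intros)
  have "open S"
  proof (subst open_subopen, rule ballI)
    fix a assume a: "a \<in> S"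
    have "p \<in> S" if "inv a \<otimes> p \<in> W" for p
      using S(1)[OF a] W(3) that group_simps(9)[of a p] by (metis subsetD)
    then show "\<exists>T. open T \<and> a \<in> T \<and> T \<subseteq> S"
      using W(2) oW by (intro exI[of _ "(\<lambda>p. inv a \<otimes> p) -` W"]) (auto simp: group_simps)
  qed
  moreover have "open (- S)"
  proof (subst open_subopen, rule ballI)
    fix a assume a: "a \<in> - S"
    have "p \<notin> S" if "inv a \<otimes> p \<in> W" for p
    proof
      assume "p \<in> S"
      \<comment> \<open>This product is \<open>a\<close>: the translate of the neighbourhood
        \<open>W\<close> to a point outside \<open>S\<close> misses \<open>S\<close>.\<close>
      then have "p \<otimes> inv (inv a \<otimes> p) \<in> S" using S W(3) that by blast
      then show False using a by (simp add: group_simps)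
    qed
    then show "\<exists>T. open T \<and> a \<in> T \<and> T \<subseteq> - S"
      using W(2) oW by (intro exI[of _ "(\<lambda>p. inv a \<otimes> p) -` W"]) (auto simp: group_simps)
  qed
  ultimately have "S = {} \<or> - S = {}" using connectedD[OF conn, of S "- S"] by auto
  then show ?thesis using W by auto
qed

lemma Ad_mult:
  assumes "y \<in> V1" shows "\<forall>\<^sub>F z in nhds \<epsilon>. Ad (M (y, z)) v = Ad y (Ad z v)"
proof -
  have y: "q y \<in> U" "inv (q y) \<in> U" using assms V1D q_in by auto
  have "\<forall>\<^sub>F z in nhds \<epsilon>. q y \<otimes> q z \<in> U" "\<forall>\<^sub>F z in nhds \<epsilon>. inv (q y \<otimes> q z) \<in> U"
    by (rule eventually_q_eps; use y in \<open>auto intro!: cont_intros simp: group_simps\<close>)+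
  with eventually_V1[OF eps_V1] show ?thesis
  proof eventually_elim
    case (elim z)
    have yz: "M (y, z) \<in> V1" "q (M (y, z)) = q y \<otimes> q z" using elim by (auto simp: V1_def M_def X_in qX)
    show ?case
    proof (rule has_derivative_unique_nhds[where D = "\<lambda>v. Ad (M (y, z)) v" and E = "\<lambda>v. Ad y (Ad z v)"])
      show "(C (M (y, z)) has_derivative Ad (M (y, z))) (at \<epsilon>)" by (rule C_deriv[OF yz(1)])
      show "((\<lambda>x. C y (C z x)) has_derivative (\<lambda>v. Ad y (Ad z v))) (at \<epsilon>)"
        using has_derivative_compose[OF C_deriv[OF elim(1)], of "C y"] C_deriv[OF assms] by (simp only: C_eps)
      have "\<forall>\<^sub>F x in nhds \<epsilon>. q z \<otimes> q x \<otimes> inv (q z) \<in> U"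
        by (rule eventually_q_eps) (auto intro!: cont_intros simp: group_simps one_in)
      then show "\<forall>\<^sub>F x in nhds \<epsilon>. C (M (y, z)) x = C y (C z x)"
        unfolding yz(2) by eventually_elim (simp add: sandwich_def qX group_simps)
    qed
  qed
qed

text \<open>The bracket is the derivative of \<open>Ad\<close> at the identity. By multiplicativity,
  and since \<open>R y\<close> is onto, its vanishing spreads to every \<open>y\<close> in
  \<open>V1\<close>; so \<open>Ad\<close> is constant on a ball.\<close>

lemma Ad_trivial:
  assumes br0: "\<And>u v. br u v = 0"
  shows "\<forall>\<^sub>F y in nhds \<epsilon>. Ad y = (\<lambda>v. v)"
proof -
  have d0: "((\<lambda>y. Ad y v) has_derivative (\<lambda>u. 0)) (at y)" if y: "y \<in> V1" for y v
  proof -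
    let ?D = "frechet_derivative (\<lambda>y. Ad y v) (at y)"
    have d: "((\<lambda>y. Ad y v) has_derivative ?D) (at y)" by (rule smooth_at_has_derivative[OF Ad_smooth[OF y]])
    have yV: "y \<in> V" using y V1D by blast
    have "?D (R y w) = 0" for w
    proof (rule has_derivative_unique_nhds[where D = "\<lambda>w. ?D (R y w)" and E = "\<lambda>w. 0"])
      show "((\<lambda>z. Ad (M (y, z)) v) has_derivative (\<lambda>w. ?D (R y w))) (at \<epsilon>)"
        using has_derivative_compose[OF R_deriv[OF yV], of "\<lambda>y. Ad y v"] d by (simp only: M_eps(1)[OF yV])
      have "bounded_linear (Ad y)" using linear_Ad[OF y] linear_conv_bounded_linear by blast
      from bounded_linear.has_derivative[OF this Ad_deriv, of v]
      show "((\<lambda>z. Ad y (Ad z v)) has_derivative (\<lambda>w. 0)) (at \<epsilon>)"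
        by (simp add: br0 linear_0[OF linear_Ad[OF y]])
    qed (rule Ad_mult[OF y])
    then have "?D u = 0" for u using R_Lt[OF y, of u] by metis
    then have "?D = (\<lambda>u. 0)" by auto
    with d show ?thesis by simp
  qed
  obtain r where r: "r > 0" "ball \<epsilon> r \<subseteq> V1"
    using eventually_V1[OF eps_V1] by (auto simp: eventually_nhds_metric dist_commute subset_iff)
  have "Ad y v = v" if "y \<in> ball \<epsilon> r" for y v
  proof -
    have "((\<lambda>y. Ad y v) has_derivative (\<lambda>u. 0)) (at x within ball \<epsilon> r)" if "x \<in> ball \<epsilon> r" for x
      by (rule has_derivative_at_withinI[OF d0[OF subsetD[OF r(2) that]]])
    from has_derivative_zero_unique[OF convex_ball this that, of \<epsilon>] r(1) show ?thesis
      by (simp add: Ad_eps)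
  qed
  then show ?thesis using eventually_nhds_in_open[OF open_ball, of \<epsilon> \<epsilon> r] r(1)
    by (auto elim!: eventually_mono)
qed

text \<open>The quotient \<open>F x\<close> of \<open>f x\<close> by \<open>x\<close> has derivative
  zero at the identity. The relation between \<open>F y\<close> and \<open>F\<close> at
  \<open>inv (q x) \<otimes> q y\<close>, conjugated by \<open>f (q x)\<close> on the left and
  \<open>inv (q x)\<close> on the right, carries this to all nearby points, so \<open>F\<close> is
  constant there.\<close>

lemma chart_hom_id:
  assumes f: "chart_hom f (\<lambda>v. v)"
  shows "\<forall>\<^sub>F x in nhds \<epsilon>. f (q x) = q x"
proof -
  have fd: "((\<lambda>x. X (f (q x))) has_derivative (\<lambda>v. v)) (at \<epsilon>)" and fc: "continuous_on UNIV f"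
    and fh: "\<And>a b. f (a \<otimes> b) = f a \<otimes> f b"
    using f by (auto simp: chart_hom_def)
  note f1 = chart_hom_one[OF f] and fc' = continuous_on_compose2[OF fc]
  define F where "F x = X (f (q x) \<otimes> inv (q x))" for x
  have F1: "F \<epsilon> = \<epsilon>" by (simp add: F_def eps f1 group_simps) (simp add: \<epsilon>_def)
  have ev: "\<forall>\<^sub>F x in nhds \<epsilon>. x \<in> V1" "\<forall>\<^sub>F x in nhds \<epsilon>. f (q x) \<in> U"
    "\<forall>\<^sub>F x in nhds \<epsilon>. f (q x) \<otimes> inv (q x) \<in> U"
    by (rule eventually_V1[OF eps_V1],
        (rule eventually_q_eps; use one_in in \<open>auto intro!: cont_intros fc simp: group_simps f1\<close>)+)
  have F0: "(F has_derivative (\<lambda>v. 0)) (at \<epsilon>)"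
  proof -
    have e: "\<forall>\<^sub>F x in nhds \<epsilon>. F x = M (X (f (q x)), J x)"
      using ev by eventually_elim (simp add: F_def M_def qX V1D)
    have "X (f (q \<epsilon>)) = \<epsilon>" by (simp add: eps f1) (simp add: \<epsilon>_def)
    then show ?thesis
      using frechet_derivative_partial[OF _ has_derivative_Pair[OF fd J_deriv] e]
      by (simp add: J_eps M_smooth_eps eps(1) DM_eps)
  qed
  have "\<forall>\<^sub>F x in nhds \<epsilon>. (F has_derivative (\<lambda>v. 0)) (at x) \<and> f (q x) \<otimes> inv (q x) \<in> U"
    using ev
  proof eventually_elim
    case (elim x)
    have x: "x \<in> V" "q x \<in> U" using elim V1D q_in by auto
    let ?G = "sandwich (f (q x)) (inv (q x))"
    have "(?G has_derivative frechet_derivative ?G (at \<epsilon>)) (at \<epsilon>)"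
      using elim V1D by (intro smooth_at_has_derivative sandwich_smooth) auto
    then have G: "(?G has_derivative frechet_derivative ?G (at \<epsilon>)) (at (F (M (J x, x))))"
      by (simp add: M_J elim F1)
    have F0': "(F has_derivative (\<lambda>v. 0)) (at (M (J x, x)))" using F0 by (simp add: M_J elim)
    have "((\<lambda>y. ?G (F (M (J x, y)))) has_derivative (\<lambda>v. frechet_derivative ?G (at \<epsilon>) 0)) (at x)"
      using has_derivative_compose[OF has_derivative_compose[OF Lt_deriv[OF elim(1)] F0'] G] .
    moreover have "frechet_derivative ?G (at \<epsilon>) 0 = 0"
      using elim V1D by (intro linear_0 smooth_at_linear sandwich_smooth) auto
    ultimately have "((\<lambda>y. ?G (F (M (J x, y)))) has_derivative (\<lambda>v. 0)) (at x)" by simp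
    moreover have "\<forall>\<^sub>F y in nhds x. ?G (F (M (J x, y))) = F y"
    proof -
      have "\<forall>\<^sub>F y in nhds x. inv (q x) \<otimes> q y \<in> U"
        by (rule eventually_q[OF x(1) _ _ open_U]) (auto intro!: cont_intros one_in simp: group_simps)
      moreover have "\<forall>\<^sub>F y in nhds x. f (inv (q x) \<otimes> q y) \<otimes> inv (inv (q x) \<otimes> q y) \<in> U"
        by (rule eventually_q[OF x(1) _ _ open_U])
          (auto intro!: cont_intros fc' one_in simp: group_simps f1)
      ultimately show ?thesis
        by eventually_elim (simp add: F_def M_def V1D[OF elim(1)] qX sandwich_def fh group_simps chart_hom_inv[OF f])
    qed
    ultimately have "(F has_derivative (\<lambda>v. 0)) (at x)" by (rule has_derivative_cong_nhds)
    with elim show ?case by simp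
  qed
  then obtain r where r: "r > 0" "\<And>x. x \<in> ball \<epsilon> r \<Longrightarrow> (F has_derivative (\<lambda>v. 0)) (at x)"
    "\<And>x. x \<in> ball \<epsilon> r \<Longrightarrow> f (q x) \<otimes> inv (q x) \<in> U"
    by (auto simp: eventually_nhds_metric dist_commute)
  have "f (q x) = q x" if x: "x \<in> ball \<epsilon> r" for x
  proof -
    have "F x = F \<epsilon>"
      using has_derivative_zero_unique[OF convex_ball, of \<epsilon> r F x \<epsilon>] r x by (auto intro: has_derivative_at_withinI)
    then have "q (X (f (q x) \<otimes> inv (q x))) = \<one>" unfolding F1 by (simp add: F_def eps)
    then have "f (q x) \<otimes> inv (q x) \<otimes> q x = \<one> \<otimes> q x" using qX r(3)[OF x] by simp
    then show ?thesis by (simp add: group_simps)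
  qed
  then show ?thesis using eventually_nhds_in_open[OF open_ball, of \<epsilon> \<epsilon> r] r(1)
    by (auto elim!: eventually_mono)
qed

text \<open>Connectedness is used twice: the fixed points of conjugation by a \<open>q y\<close>
  near the identity form an open subgroup, and so, as a consequence, does the centre.\<close>

lemma commutative:
  assumes conn: "connected (UNIV :: 'a set)" and br0: "\<And>u v. br u v = 0"
  shows "comm_group N"
proof -
  have central: "q y \<otimes> b = b \<otimes> q y" if y: "y \<in> V1" "Ad y = (\<lambda>v. v)" for y b
  proof -
    have f: "chart_hom (\<lambda>x. q y \<otimes> x \<otimes> inv (q y)) (\<lambda>v. v)" using chart_hom_conj[OF y(1)] y(2) by simp
    have "b \<in> {x. q y \<otimes> x \<otimes> inv (q y) = x}"
    proof (rule open_subgroup_UNIV[OF conn])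
      show "\<forall>\<^sub>F x in nhds \<epsilon>. q x \<in> {x. q y \<otimes> x \<otimes> inv (q y) = x}"
        using chart_hom_id[OF f] by simp
      show "a \<otimes> b \<in> {x. q y \<otimes> x \<otimes> inv (q y) = x}"
        if "a \<in> {x. q y \<otimes> x \<otimes> inv (q y) = x}" "b \<in> {x. q y \<otimes> x \<otimes> inv (q y) = x}" for a b
        using f that unfolding chart_hom_def by simp
      show "inv a \<in> {x. q y \<otimes> x \<otimes> inv (q y) = x}"
        if "a \<in> {x. q y \<otimes> x \<otimes> inv (q y) = x}" for a
        using chart_hom_inv[OF f, of a] that by simp
    qed
    then have "q y \<otimes> b \<otimes> inv (q y) \<otimes> q y = b \<otimes> q y" by simp
    then show ?thesis by (simp add: group_simps)
  qed
  have "a \<in> {a. \<forall>b. a \<otimes> b = b \<otimes> a}" for a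
  proof (rule open_subgroup_UNIV[OF conn])
    show "\<forall>\<^sub>F y in nhds \<epsilon>. q y \<in> {a. \<forall>b. a \<otimes> b = b \<otimes> a}"
      using Ad_trivial[OF br0] eventually_V1[OF eps_V1] by eventually_elim (use central in blast)
    show "a \<otimes> a' \<in> {a. \<forall>b. a \<otimes> b = b \<otimes> a}"
      if "a \<in> {a. \<forall>b. a \<otimes> b = b \<otimes> a}" "a' \<in> {a. \<forall>b. a \<otimes> b = b \<otimes> a}" for a a'
    proof (intro CollectI allI)
      fix b
      have "a \<otimes> a' \<otimes> b = a \<otimes> (a' \<otimes> b)" by (simp add: group_simps)
      also have "\<dots> = a \<otimes> (b \<otimes> a')" using that by simp
      also have "\<dots> = a \<otimes> b \<otimes> a'" by (simp add: group_simps)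
      also have "\<dots> = b \<otimes> a \<otimes> a'" using that by simp
      finally show "a \<otimes> a' \<otimes> b = b \<otimes> (a \<otimes> a')" by (simp add: group_simps)
    qed
    show "inv a \<in> {a. \<forall>b. a \<otimes> b = b \<otimes> a}" if "a \<in> {a. \<forall>b. a \<otimes> b = b \<otimes> a}" for a
    proof (intro CollectI allI)
      fix b
      have "inv (inv b \<otimes> a) = inv (a \<otimes> inv b)" using that by simp
      then show "inv a \<otimes> b = b \<otimes> inv a" by (simp add: group_simps)
    qed
  qed
  then show ?thesis by (intro group_comm_groupI) simp
qed

end

lemma smooth_at_second_derivative:
  fixes f :: "'b::euclidean_space \<Rightarrow> 'c::real_normed_vector"
  assumes "smooth_at p z" "smooth_at f (p z)" "smooth_at u z" "smooth_at v z"
  shows "smooth_at (\<lambda>x. second_derivative f (p x) (u x) (v x)) z"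
proof (rule smooth_at_cong)
  show "smooth_at (\<lambda>x. \<Sum>b\<in>Basis. (v x \<bullet> b) *\<^sub>R second_derivative f (p x) (u x) b) z"
    unfolding second_derivative_def
    using assms
    by (intro smooth_at_sum smooth_at_scaleR smooth_at_inner smooth_at_const smooth_at_frechet smooth_at_directional)
  have "\<forall>\<^sub>F x in nhds z. smooth_at f (p x)"
    by (rule eventually_compose_filterlim[OF smooth_at_eventually[OF assms(2)] smooth_at_tendsto[OF assms(1)]])
  then show "\<forall>\<^sub>F x in nhds z. (\<Sum>b\<in>Basis. (v x \<bullet> b) *\<^sub>R second_derivative f (p x) (u x) b)
      = second_derivative f (p x) (u x) (v x)"
    by eventually_elim (rule linear_euclidean_expand[symmetric, OF second_derivative_linear_right])
qed

lemma has_derivative_imp_vector_derivative: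
  "(f has_derivative D) (at t) \<Longrightarrow> (f has_vector_derivative D 1) (at t)" for f :: "real \<Rightarrow> 'a::real_normed_vector"
proof -
  assume D: "(f has_derivative D) (at t)"
  then have "D x = x *\<^sub>R D 1" for x using linear_scale[OF has_derivative_linear, of f D "at t" x 1] by simp
  then have "(\<lambda>x. x *\<^sub>R D 1) = D" by (intro ext, rule sym)
  with D show ?thesis by (simp only: has_vector_derivative_def)
qed

lemma smooth_at_vector_derivative:
  "smooth_at f t \<Longrightarrow> (f has_vector_derivative frechet_derivative f (at t) 1) (at t)"
  for f :: "real \<Rightarrow> 'a::real_normed_vector"
  by (rule has_derivative_imp_vector_derivative[OF smooth_at_has_derivative])

lemma has_vector_derivative_unique_nhds:
  assumes "(f has_vector_derivative a) (at t)" "(g has_vector_derivative b) (at t)"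
    "\<forall>\<^sub>F s in nhds t. f s = g s"
  shows "a = b"
proof -
  have "(g has_vector_derivative a) (at t)"
    using assms(1,3) has_derivative_cong_nhds unfolding has_vector_derivative_def by blast
  then show ?thesis using assms(2) by (rule vector_derivative_unique_at)
qed

text \<open>Raising an index: \<open>S\<close> inverts the map that represents \<open>ip s\<close>
  by a vector in the Euclidean structure.\<close>

lemma sharp_exists:
  fixes ip :: "'e::euclidean_space \<Rightarrow> 'e \<Rightarrow> real"
  assumes ip: "bilinear ip" and nd: "\<And>u. (\<And>v. ip u v = 0) \<Longrightarrow> u = 0"
  obtains S where "linear S" "\<And>u w. ip (S u) w = u \<bullet> w"
proof -
  define f where "f s = (\<Sum>b\<in>Basis. ip s b *\<^sub>R b)" for s
  have lin: "linear f"
    unfolding f_def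
    by (intro linearI) (simp_all add: bilinear_ladd[OF ip] bilinear_lmul[OF ip] scaleR_add_left
        sum.distrib scaleR_sum_right)
  have f: "f s \<bullet> w = ip s w" for s w
  proof -
    have "linear (ip s)" using ip by (simp add: bilinear_def)
    from linear_euclidean_expand[OF this, of w] show ?thesis
      by (simp add: f_def inner_sum_left inner_commute[of w] mult.commute)
  qed
  have "inj f"
    unfolding linear_injective_0[OF lin] using f nd by (metis inner_zero_left)
  then obtain S where "linear S" "\<And>x. f (S x) = x"
    using linear_injective_isomorphism[OF lin] by blast
  then show ?thesis using that f by metis
qed

section \<open>The geodesic equation of a left-invariant metric\<close>

context lie_group_chart
begin

interpretation group N by (rule grp)

text \<open>The derivative of \<open>Lt y w\<close> in the direction \<open>u\<close> of
  \<open>y\<close>, written through \<open>M\<close> and \<open>J\<close> so that its smoothness in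
  all arguments is visible.\<close>

definition "DL y u w = second_derivative M (J y, y) (frechet_derivative J (at y) u, u) (0, w)"

lemma Lt_deriv_point:
  assumes "y \<in> V1" shows "((\<lambda>z. Lt z w) has_derivative (\<lambda>u. DL y u w)) (at y)"
  using has_derivative_frechet_along[of "\<lambda>y. (J y, y)", OF has_derivative_Pair[OF
      smooth_at_has_derivative[OF J_smooth[OF assms]] has_derivative_ident]
      _ has_derivative_const, of M "(0, w)"]
  by (simp add: M_smooth_J assms linear_0[OF DM_linear] Lt_def DL_def)

lemma DL_eps: "DL \<epsilon> u w = - \<beta> u w"
  using has_derivative_unique[OF Lt_deriv_point[OF eps_V1] Lt_deriv_base] by metis

lemma linear_DL_right: assumes "y \<in> V1" shows "linear (DL y u)"
proof -
  have "linear (\<lambda>w. (0 :: 'e, w))" by (simp add: linear_iff)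
  from linear_compose[OF this second_derivative_linear_right[OF M_smooth_J(1)[OF assms]]]
  show ?thesis by (simp add: DL_def[abs_def] o_def)
qed

lemma linear_DL_left: assumes "y \<in> V1" shows "linear (\<lambda>u. DL y u w)"
  using Lt_deriv_point[OF assms] has_derivative_linear by blast

lemma DL_smooth:
  assumes "smooth_at p z" "p z \<in> V1" "smooth_at u z" "smooth_at w z"
  shows "smooth_at (\<lambda>x. DL (p x) (u x) (w x)) z"
  unfolding DL_def
  using assms by (intro smooth_at_second_derivative smooth_at_Pair smooth_at_const M_smooth_J
      smooth_at_frechet smooth_at_compose[OF assms(1) J_smooth] J_smooth)

end

locale lie_group_metric = lie_group_chart N A c
  for N :: "('a::topological_space) monoid" (structure)
    and A :: "('a, 'e::euclidean_space) chart set" and c +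
  fixes ip :: "'e \<Rightarrow> 'e \<Rightarrow> real"
  assumes ip: "bilinear ip" and ip_sym: "ip u v = ip v u"
    and ip_nondegenerate: "(\<And>v. ip u v = 0) \<Longrightarrow> u = 0"
begin

interpretation group N by (rule grp)

abbreviation "g \<equiv> left_invariant_metric N c ip"

lemmas ip_simps = bilinear_ladd[OF ip] bilinear_lmul[OF ip] bilinear_radd[OF ip] bilinear_rmul[OF ip]
  bilinear_lneg[OF ip] bilinear_rneg[OF ip] bilinear_lzero[OF ip] bilinear_rzero[OF ip]
  bilinear_lsub[OF ip] bilinear_rsub[OF ip]

lemma bounded_bilinear_ip: "bounded_bilinear ip"
  using ip by (simp add: bilinear_conv_bounded_bilinear)

lemma metric_eq: assumes "y \<in> V1" shows "g c (q y) u v = ip (Lt y u) (Lt y v)"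
proof -
  have y: "y \<in> V" using assms V1D by blast
  have "(\<lambda>z. X (inv (q y) \<otimes> q z)) = (\<lambda>z. M (J y, z))"
    using assms by (simp add: M_def V1D)
  then have "tangent_map c c (\<lambda>x. inv (q y) \<otimes> x) (q y) = Lt y"
    using frechet_derivativeI[OF Lt_deriv[OF assms]] by (simp add: tangent_map_def o_def Xq y)
  then show ?thesis by (simp add: left_invariant_metric_def)
qed

lemma metric_eps: "g c \<one> u v = ip u v"
  using metric_eq[OF eps_V1] by (simp add: eps Lt_eps)

lemma metric_deriv:
  assumes "y \<in> V1"
  shows "frechet_derivative (\<lambda>z. g c (q z) v w) (at (X (q y))) u = ip (DL y u v) (Lt y w) + ip (Lt y v) (DL y u w)"
proof -
  have y: "X (q y) = y" using assms V1D Xq by blast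
  have "((\<lambda>z. ip (Lt z v) (Lt z w)) has_derivative (\<lambda>u. ip (Lt y v) (DL y u w) + ip (DL y u v) (Lt y w))) (at y)"
    by (rule bounded_bilinear.FDERIV[OF bounded_bilinear_ip Lt_deriv_point Lt_deriv_point]; rule assms)
  then have "((\<lambda>z. g c (q z) v w) has_derivative (\<lambda>u. ip (Lt y v) (DL y u w) + ip (DL y u v) (Lt y w))) (at y)"
    by (rule has_derivative_cong_nhds)
       (use eventually_V1[OF assms] in \<open>eventually_elim, simp add: metric_eq\<close>)
  from frechet_derivativeI[OF this] show ?thesis by (simp add: y)
qed

lemma christoffel_eq:
  assumes "y \<in> V1"
  shows "christoffel g c (q y) v v w
    = ip (DL y v v) (Lt y w) + ip (Lt y v) (DL y v w) - ip (Lt y v) (DL y w v)"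
  by (simp add: christoffel_def metric_deriv[OF assms] ip_sym[of "DL y w v"])

definition "sharp = (SOME S. linear S \<and> (\<forall>u w. ip (S u) w = u \<bullet> w))"

lemma sharp: "linear sharp" "ip (sharp u) w = u \<bullet> w"
proof -
  have "\<exists>S. linear S \<and> (\<forall>u w. ip (S u) w = u \<bullet> w)"
    using sharp_exists[OF ip ip_nondegenerate] by metis
  from someI_ex[OF this] show "linear sharp" "ip (sharp u) w = u \<bullet> w"
    unfolding sharp_def by blast+
qed

text \<open>
  In the chart the geodesic equation reads \<open>g(x'', w) = - chr x x' w\<close>; \<open>acc\<close> solves it for \<open>x''\<close>.
\<close>

definition "chr y v w = ip (DL y v v) (Lt y w) + ip (Lt y v) (DL y v w) - ip (Lt y v) (DL y w v)"

definition "acc y v = - R y (sharp (\<Sum>b\<in>Basis. chr y v (R y b) *\<^sub>R b))"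

lemma linear_chr: assumes "y \<in> V1" shows "linear (chr y v)"
  unfolding chr_def
  by (intro linearI) (simp_all add: ip_simps linear_add[OF linear_Lt[OF assms]] linear_scale[OF linear_Lt[OF assms]]
      linear_add[OF linear_DL_left[OF assms]] linear_scale[OF linear_DL_left[OF assms]]
      linear_add[OF linear_DL_right[OF assms]] linear_scale[OF linear_DL_right[OF assms]] algebra_simps)

lemma acc_eq: assumes "y \<in> V1" shows "ip (Lt y (acc y v)) (Lt y w) = - chr y v w"
proof -
  have lin: "linear (\<lambda>u. chr y v (R y u))"
    using linear_compose[OF linear_R linear_chr[OF assms], of y v] V1D[of y] assms by (simp add: o_def)
  have "ip (Lt y (acc y v)) (Lt y w) = - ((\<Sum>b\<in>Basis. chr y v (R y b) *\<^sub>R b) \<bullet> Lt y w)"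
    by (simp add: acc_def linear_neg[OF linear_Lt[OF assms]] Lt_R[OF assms] ip_simps sharp)
  also have "(\<Sum>b\<in>Basis. chr y v (R y b) *\<^sub>R b) \<bullet> Lt y w = chr y v (R y (Lt y w))"
    using linear_euclidean_expand[OF lin, of "Lt y w"]
    by (simp add: inner_sum_left inner_commute[of "Lt y w"] mult.commute)
  finally show ?thesis by (simp add: R_Lt[OF assms])
qed

text \<open>The vector field on position and velocity whose integral curves are the geodesics in the
  chart.\<close>

lemma acc_smooth: "smooth_at (\<lambda>x. (snd x, acc (fst x) (snd x))) (\<epsilon>, T)"
proof -
  have 1: "smooth_at fst (\<epsilon>, T)" "smooth_at snd (\<epsilon>, T)"
    by (intro smooth_at_bounded_linear bounded_linear_fst bounded_linear_snd)+
  note [simp] = eps_V1 eps(1)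
  have "smooth_at (\<lambda>x. sharp (\<Sum>b\<in>Basis. chr (fst x) (snd x) (R (fst x) b) *\<^sub>R b)) (\<epsilon>, T)"
  proof (rule smooth_at_compose[of _ _ sharp])
    show "smooth_at (\<lambda>x. \<Sum>b\<in>Basis. chr (fst x) (snd x) (R (fst x) b) *\<^sub>R b) (\<epsilon>, T)"
      unfolding chr_def
      by (intro smooth_at_sum smooth_at_scaleR smooth_at_add smooth_at_diff
          smooth_at_bilinear[OF bounded_bilinear_ip] DL_smooth Lt_smooth R_smooth smooth_at_const 1) simp_all
    show "smooth_at sharp z" for z
      using sharp(1) by (intro smooth_at_bounded_linear) (simp add: linear_conv_bounded_linear)
  qed
  then show ?thesis
    unfolding acc_def by (intro smooth_at_Pair smooth_at_minus R_smooth 1) simp_all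
qed

lemma geodesic_exists:
  obtains h x v where "h > 0" "x 0 = \<epsilon>" "v 0 = T" "\<And>t. t \<in> {-h<..<h} \<Longrightarrow> x t \<in> V1"
    "\<And>t. t \<in> {-h<..<h} \<Longrightarrow> (x has_vector_derivative v t) (at t)"
    "\<And>t. t \<in> {-h<..<h} \<Longrightarrow> (v has_vector_derivative acc (x t) (v t)) (at t)"
    "geodesic_on A g {-h<..<h} (\<lambda>t. q (x t))"
proof -
  have "\<forall>\<^sub>F p in nhds (\<epsilon>, T). fst p \<in> V1"
    using eventually_compose_filterlim[OF eventually_V1[OF eps_V1], of fst "nhds (\<epsilon>, T)"]
      isCont_filterlim[of "(\<epsilon>, T)" fst] by simp
  from ode_exists[OF acc_smooth this] obtain h Y where h: "h > 0" "Y 0 = (\<epsilon>, T)"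
    "\<And>t. t \<in> {-h<..<h} \<Longrightarrow> (Y has_vector_derivative (snd (Y t), acc (fst (Y t)) (snd (Y t)))) (at t)"
    "\<And>t. t \<in> {-h<..<h} \<Longrightarrow> fst (Y t) \<in> V1" by metis
  define x v where "x t = fst (Y t)" and "v t = snd (Y t)" for t
  have xV: "x t \<in> V1" if "t \<in> {-h<..<h}" for t using h(4)[OF that] by (simp add: x_def)
  have dx: "(x has_vector_derivative v t) (at t)" if "t \<in> {-h<..<h}" for t
    using bounded_linear.has_vector_derivative[OF bounded_linear_fst h(3)[OF that]] by (simp add: x_def[abs_def] v_def)
  have dv: "(v has_vector_derivative acc (x t) (v t)) (at t)" if "t \<in> {-h<..<h}" for t
    using bounded_linear.has_vector_derivative[OF bounded_linear_snd h(3)[OF that]] by (simp add: x_def v_def[abs_def])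
  show ?thesis
  proof (rule that[OF h(1) _ _ xV dx dv])
    show "x 0 = \<epsilon>" "v 0 = T" using h(2) by (simp_all add: x_def v_def)
    have Vx: "x t \<in> V" if "t \<in> {-h<..<h}" for t using xV[OF that] V1D by blast
    show "geodesic_on A g {-h<..<h} (\<lambda>t. q (x t))"
      unfolding geodesic_on_def
    proof (intro conjI ballI)
      have "continuous_on {-h<..<h} x"
        using dx has_vector_derivative_continuous continuous_at_imp_continuous_on by blast
      then show "continuous_on {-h<..<h} (\<lambda>t. q (x t))"
        using continuous_on_compose2[OF homeomorphism_cont2[OF homeo]] Vx by blast
      fix t assume t: "t \<in> {-h<..<h}"
      have ev: "\<forall>\<^sub>F s in nhds t. s \<in> {-h<..<h}" using t by (intro eventually_nhds_in_open) auto
      have "\<forall>\<^sub>F s in nhds t. ((\<lambda>r. X (q (x r))) has_vector_derivative v s) (at s)"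
        using ev
      proof eventually_elim
        case (elim s)
        show ?case
          by (rule has_vector_derivative_transform_within_open[OF dx[OF elim], of "{-h<..<h}"])
             (use elim Xq[OF Vx] in auto)
      qed
      moreover have "g c (q (x t)) (acc (x t) (v t)) w + christoffel g c (q (x t)) (v t) (v t) w = 0" for w
        by (simp add: metric_eq christoffel_eq xV[OF t] acc_eq) (simp add: chr_def)
      ultimately show "\<exists>c\<in>A. q (x t) \<in> fst c \<and> (\<exists>x' x''.
          (\<forall>\<^sub>F s in nhds t. ((\<lambda>r. snd c (q (x r))) has_vector_derivative x' s) (at s)) \<and>
          (x' has_vector_derivative x'') (at t) \<and>
          (\<forall>w. g c (q (x t)) x'' w + christoffel g c (q (x t)) (x' t) (x' t) w = 0))"
        using c_in q_in[OF Vx[OF t]] dv[OF t] by blast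
    qed
  qed
qed

text \<open>
  The orbit of \<open>\<one>\<close> under a one-parameter group \<open>\<phi>\<close> of transformations \<open>x \<mapsto> a(s) h\<^sub>s(x)\<close>:
  the derivation \<open>D\<close> is the derivative at \<open>s = 0\<close> of the differential of \<open>h\<^sub>s\<close> at \<open>\<one>\<close>.
\<close>

lemma orbit_derivation:
  assumes sm: "smooth_map (prod_atlas real_atlas A) A (\<lambda>(s, p). \<phi> s p)"
    and add: "\<And>s t. \<phi> (s + t) = \<phi> s \<circ> \<phi> t" and zero: "\<phi> 0 = id"
    and split: "\<And>s. \<exists>h. isometry_of A g h \<and> (\<forall>a b. h (a \<otimes> b) = h a \<otimes> h b) \<and> (\<forall>x. \<phi> s x = \<phi> s \<one> \<otimes> h x)"
  obtains D V a' where "linear D" "\<And>u v. D (br u v) = br (D u) v + br u (D v)"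
    "\<And>u v. ip (D u) v = - ip u (D v)"
    "\<forall>\<^sub>F s in nhds 0. ((\<lambda>s. X (\<phi> s \<one>)) has_vector_derivative a' s) (at s)"
    "a' 0 = V" "(a' has_vector_derivative D V + \<beta> V V) (at 0)"
proof -
  define F where "F p = X (\<phi> (fst p) (q (snd p)))" for p
  define a where "a s = F (s, \<epsilon>)" for s
  define Q where "Q s v = frechet_derivative F (at (s, \<epsilon>)) (0, v)" for s v
  \<comment> \<open>\<open>Q s\<close> is the differential of \<open>\<phi> s\<close> at the
    identity; translating back by the inverse of \<open>\<phi> s \<one>\<close> leaves the
    differential of the automorphism.\<close>
  define P where "P s v = Lt (a s) (Q s v)" for s v
  have rc: "(UNIV, id) \<in> real_atlas" "chart_ok (UNIV :: real set, id :: real \<Rightarrow> real)" "chart_inv (UNIV :: real set, id :: real \<Rightarrow> real) = id"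
  proof -
    show i: "chart_inv (UNIV :: real set, id :: real \<Rightarrow> real) = id"
      by (simp add: chart_inv_def fun_eq_iff)
    show "chart_ok (UNIV :: real set, id :: real \<Rightarrow> real)" unfolding chart_ok_def i
      by (simp add: homeomorphism_def)
  qed (simp add: real_atlas_def)
  have smF: "smooth_at F (0, \<epsilon>)"
    using smooth_map_prod_charts[OF sm rc(1,2) _ c_in chart_ok one_in c_in open_U, of 0]
    by (simp add: rc(3) F_def[abs_def] zero one_in flip: \<epsilon>_def)
  have pair: "smooth_at (\<lambda>s :: real. (s, \<epsilon>)) 0" by (intro smooth_at_Pair smooth_at_id smooth_at_const)
  have sma: "smooth_at a 0" unfolding a_def[abs_def] by (rule smooth_at_compose[OF pair smF])
  have smQ: "smooth_at (\<lambda>s. Q s v) 0" for v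
    unfolding Q_def by (intro smooth_at_frechet pair smF smooth_at_const)
  have a0: "a 0 = \<epsilon>" by (simp add: a_def F_def zero eps) (simp add: \<epsilon>_def)
  have evF: "\<forall>\<^sub>F s in nhds 0. smooth_at F (s, \<epsilon>)"
    by (rule eventually_compose_filterlim[OF smooth_at_eventually[OF smF] smooth_at_tendsto[OF pair]])
  have contF: "continuous_on UNIV (\<lambda>(s, p). \<phi> s p)" using sm by (simp add: smooth_map_def)
  have cont\<phi>: "continuous_on UNIV (\<phi> s)" for s
    using continuous_on_compose2[OF contF continuous_on_Pair[OF continuous_on_const continuous_on_id], where s = UNIV] by simp
  have cont1: "continuous_on UNIV (\<lambda>s. \<phi> s \<one>)"
    using continuous_on_compose2[OF contF continuous_on_Pair[OF continuous_on_id continuous_on_const], where s = UNIV] by simp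
  have ev1: "\<forall>\<^sub>F s in nhds 0. \<phi> s \<one> \<in> U \<and> inv (\<phi> s \<one>) \<in> U"
  proof -
    have "open ((\<lambda>s. \<phi> s \<one>) -` U \<inter> (\<lambda>s. inv (\<phi> s \<one>)) -` U)"
      using open_U by (intro open_Int open_vimage cont1 continuous_on_inv)
    from eventually_nhds_in_open[OF this, of 0] show ?thesis by (simp add: zero one_in group_simps)
  qed
  have Fd: "((\<lambda>z. F (s, z)) has_derivative Q s) (at \<epsilon>)" if "smooth_at F (s, \<epsilon>)" for s
    unfolding Q_def by (rule frechet_derivative_partial[where g = "\<lambda>z. (s, z)"])
      (auto intro: that Pair_right_deriv)
  have hom: "chart_hom h (P s) \<and> isometry_of A g h"
    if s: "smooth_at F (s, \<epsilon>)" "\<phi> s \<one> \<in> U" "inv (\<phi> s \<one>) \<in> U"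
      and h: "isometry_of A g h" "\<And>a b. h (a \<otimes> b) = h a \<otimes> h b" "\<And>x. \<phi> s x = \<phi> s \<one> \<otimes> h x" for s h
  proof -
    have as: "a s = X (\<phi> s \<one>)" "q (a s) = \<phi> s \<one>" "a s \<in> V1"
      using s by (simp_all add: a_def F_def eps V1_def X_in qX)
    have hx: "h x = inv (\<phi> s \<one>) \<otimes> \<phi> s x" for x using h(3)[of x] by (simp add: group_simps)
    have "((\<lambda>z. M (J (a s), F (s, z))) has_derivative P s) (at \<epsilon>)"
      unfolding P_def
      using has_derivative_compose[OF Fd[OF s(1)], of "\<lambda>z. M (J (a s), z)"] Lt_deriv[OF as(3)]
      by (simp add: a_def)
    moreover have "\<forall>\<^sub>F z in nhds \<epsilon>. \<phi> s (q z) \<in> U"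
      by (rule eventually_q_eps[OF cont\<phi> s(2)])
    then have "\<forall>\<^sub>F z in nhds \<epsilon>. M (J (a s), F (s, z)) = X (h (q z))"
      by eventually_elim (use V1D(3)[OF as(3)] in \<open>simp add: M_def as(2) hx F_def qX\<close>)
    ultimately have "((\<lambda>z. X (h (q z))) has_derivative P s) (at \<epsilon>)" by (rule has_derivative_cong_nhds)
    then show ?thesis using h by (simp add: chart_hom_def isometry_of_def smooth_map_def)
  qed
  have evP: "\<forall>\<^sub>F s in nhds 0. linear (P s) \<and> (\<forall>u v. P s (br u v) = br (P s u) (P s v)) \<and>
      (\<forall>u v. ip (P s u) (P s v) = ip u v)"
    using evF ev1
  proof eventually_elim
    case (elim s)
    obtain h where h: "isometry_of A g h" "\<And>a b. h (a \<otimes> b) = h a \<otimes> h b" "\<And>x. \<phi> s x = \<phi> s \<one> \<otimes> h x"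
      using split[of s] by blast
    from hom[OF elim(1) _ _ h] elim(2) have ch: "chart_hom h (P s)" by blast
    then have hd: "((\<lambda>z. X (h (q z))) has_derivative P s) (at \<epsilon>)" by (simp add: chart_hom_def)
    have "tangent_map c c h \<one> = P s"
      using frechet_derivativeI[OF hd] by (simp add: tangent_map_def o_def \<epsilon>_def)
    moreover have "h \<one> = \<one>" by (rule chart_hom_one[OF ch])
    ultimately have "ip (P s u) (P s v) = ip u v" for u v
      using h(1) c_in one_in unfolding isometry_of_def by (metis metric_eps)
    then show ?case using chart_hom_br[OF ch] has_derivative_linear[OF hd] by blast
  qed
  have smP: "smooth_at (\<lambda>s. P s v) 0" for v
    unfolding P_def using a0 eps_V1 by (intro Lt_smooth sma smQ) simp
  define D where "D v = frechet_derivative (\<lambda>s. P s v) (at 0) 1" for v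
  have dP: "((\<lambda>s. P s v) has_vector_derivative D v) (at 0)" for v
    unfolding D_def by (rule smooth_at_vector_derivative[OF smP])
  have Q0: "Q 0 v = v" for v
  proof (rule has_derivative_unique_nhds[where D = "Q 0" and E = "\<lambda>v. v"])
    show "((\<lambda>z. F (0, z)) has_derivative Q 0) (at \<epsilon>)" by (rule Fd[OF smF])
    show "((\<lambda>z. z) has_derivative (\<lambda>v. v)) (at \<epsilon>)" by (rule has_derivative_ident)
    show "\<forall>\<^sub>F z in nhds \<epsilon>. F (0, z) = z"
      using eventually_V[OF eps(1)] by eventually_elim (simp add: F_def zero Xq)
  qed
  have P0: "P 0 v = v" for v by (simp add: P_def a0 Q0 Lt_eps)
  have linD: "linear D"
  proof (rule linearI)
    show "D (u + v) = D u + D v" for u v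
      by (rule has_vector_derivative_unique_nhds[OF dP has_vector_derivative_add[OF dP dP]])
         (use evP in \<open>eventually_elim, simp add: linear_add\<close>)
    show "D (r *\<^sub>R v) = r *\<^sub>R D v" for r v
      by (rule has_vector_derivative_unique_nhds[OF dP bounded_linear.has_vector_derivative[OF bounded_linear_scaleR_right dP]])
         (use evP in \<open>eventually_elim, simp add: linear_scale\<close>)
  qed
  have derD: "D (br u v) = br (D u) v + br u (D v)" for u v
  proof (rule has_vector_derivative_unique_nhds[OF dP])
    show "((\<lambda>s. br (P s u) (P s v)) has_vector_derivative br (D u) v + br u (D v)) (at 0)"
      using bounded_bilinear.has_vector_derivative[OF bounded_bilinear_br dP[of u] dP[of v]]
      by (simp add: P0 add.commute)
    show "\<forall>\<^sub>F s in nhds 0. P s (br u v) = br (P s u) (P s v)" using evP by eventually_elim simp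
  qed
  have skD: "ip (D u) v = - ip u (D v)" for u v
  proof -
    have "ip (D u) v + ip u (D v) = 0"
    proof (rule has_vector_derivative_unique_nhds)
      show "((\<lambda>s. ip (P s u) (P s v)) has_vector_derivative ip (D u) v + ip u (D v)) (at 0)"
        using bounded_bilinear.has_vector_derivative[OF bounded_bilinear_ip dP[of u] dP[of v]]
        by (simp add: P0 add.commute)
      show "((\<lambda>s. ip u v) has_vector_derivative 0) (at 0)" by (rule has_vector_derivative_const)
      show "\<forall>\<^sub>F s in nhds 0. ip (P s u) (P s v) = ip u v" using evP by eventually_elim simp
    qed
    then show ?thesis by simp
  qed
  define V where "V = frechet_derivative a (at 0) 1"
  have da0: "(a has_vector_derivative V) (at 0)" unfolding V_def by (rule smooth_at_vector_derivative[OF sma])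
  \<comment> \<open>By the addition law the orbit near time \<open>s\<close> is the image under
    \<open>\<phi> s\<close> of the orbit near time zero, so its velocity is
    \<open>Q s V\<close>.\<close>
  have da: "\<forall>\<^sub>F s in nhds 0. (a has_vector_derivative Q s V) (at s)"
    using evF
  proof eventually_elim
    case (elim s)
    have "((\<lambda>t. F (s, a t)) has_vector_derivative Q s V) (at 0)"
      using vector_derivative_diff_chain_within[OF da0, of "\<lambda>z. F (s, z)" "Q s"] Fd[OF elim]
      by (simp add: a0 o_def has_derivative_at_withinI)
    moreover have "\<forall>\<^sub>F t in nhds 0. F (s, a t) = a (s + t)"
    proof -
      have "\<forall>\<^sub>F t in nhds 0. \<phi> t \<one> \<in> U" using ev1 by eventually_elim simp
      then show ?thesis by eventually_elim (simp add: F_def a_def eps qX add)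
    qed
    ultimately have "((\<lambda>t. a (s + t)) has_vector_derivative Q s V) (at 0)"
      unfolding has_vector_derivative_def by (rule has_derivative_cong_nhds)
    then have "(((\<lambda>t. a (s + t)) \<circ> (\<lambda>r. r - s)) has_vector_derivative 1 *\<^sub>R Q s V) (at s)"
      by (intro vector_diff_chain_at) (auto intro!: derivative_eq_intros)
    then show ?case by (simp add: o_def)
  qed
  define W where "W = frechet_derivative (\<lambda>s. Q s V) (at 0) 1"
  have dQ: "((\<lambda>s. Q s V) has_vector_derivative W) (at 0)" unfolding W_def by (rule smooth_at_vector_derivative[OF smQ])
  \<comment> \<open>A second expression for the derivative of \<open>P s V\<close>, whose derivative
    is \<open>D V\<close> by definition; comparing the two determines the acceleration
    \<open>W\<close> of the orbit.\<close>
  have "((\<lambda>s. P s V) has_vector_derivative - \<beta> V V + W) (at 0)"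
  proof -
    have 1: "(a has_derivative (\<lambda>t. t *\<^sub>R V)) (at 0)" "((\<lambda>s. Q s V) has_derivative (\<lambda>t. t *\<^sub>R W)) (at 0)"
      using da0 dQ by (simp_all add: has_vector_derivative_def)
    have 2: "((\<lambda>s. J (a s)) has_derivative (\<lambda>t. - (t *\<^sub>R V))) (at 0)"
      using has_derivative_compose[OF 1(1), of J] J_deriv by (simp add: a0)
    have "((\<lambda>s. P s V) has_derivative (\<lambda>t. - \<beta> (t *\<^sub>R V) V + t *\<^sub>R W)) (at 0)"
      using has_derivative_frechet_along[OF has_derivative_Pair[OF 2 1(1)] _ has_derivative_Pair[OF has_derivative_const 1(2)], of M 0]
      by (simp add: a0 J_eps M_smooth_eps eps M2 \<beta>_simps DM_eps Q0 P_def Lt_def)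
    then show ?thesis
      by (simp add: has_vector_derivative_def \<beta>_simps algebra_simps)
  qed
  then have "D V = - \<beta> V V + W" by (rule vector_derivative_unique_at[OF dP])
  then have "((\<lambda>s. Q s V) has_vector_derivative D V + \<beta> V V) (at 0)" using dQ by simp
  moreover have "\<forall>\<^sub>F s in nhds 0. ((\<lambda>s. X (\<phi> s \<one>)) has_vector_derivative Q s V) (at s)"
    using da by (simp add: a_def[abs_def] F_def eps)
  ultimately show ?thesis using that[OF linD derD skD, of "\<lambda>s. Q s V" V] Q0 by simp
qed


text \<open>The coordinate acceleration at the identity is computed twice, from the geodesic
  equation and from the orbit.\<close>

theorem geodesic_lemma:
  assumes H: "subgroup H (AutoGroup N)" and iso: "\<forall>h\<in>H. isometry_of A g h"
    and GO: "geodesic_orbit A g (semidirect_transformations N H)"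
  shows "\<exists>D k. linear D \<and> (\<forall>u v. D (br u v) = br (D u) v + br u (D v)) \<and>
    (\<forall>u v. ip (D u) v = - ip u (D v)) \<and> (\<forall>w. ip (br T w + D w) T = k * ip T w)"
proof -
  obtain h x v where h: "h > 0" "x 0 = \<epsilon>" "v 0 = T" "\<And>t. t \<in> {-h<..<h} \<Longrightarrow> x t \<in> V1"
    and dx: "\<And>t. t \<in> {-h<..<h} \<Longrightarrow> (x has_vector_derivative v t) (at t)"
    and dv: "\<And>t. t \<in> {-h<..<h} \<Longrightarrow> (v has_vector_derivative acc (x t) (v t)) (at t)"
    and geo: "geodesic_on A g {-h<..<h} (\<lambda>t. q (x t))"
    using geodesic_exists[of T] by metis
  have I: "open {-h<..<h}" "is_interval {-h<..<h}" "0 \<in> {-h<..<h}"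
    using h(1) by (auto simp: is_interval_oo)
  obtain S \<sigma> \<phi> p where S: "open S" "0 \<in> S" "S \<subseteq> {-h<..<h}"
    and \<sigma>: "smooth_on S \<sigma>" "\<forall>t\<in>S. deriv \<sigma> t \<noteq> 0"
    and \<phi>: "one_parameter_subgroup A (semidirect_transformations N H) \<phi>"
    and orbit: "\<forall>t\<in>S. q (x t) = \<phi> (\<sigma> t) p"
    using GO[unfolded geodesic_orbit_def, THEN spec, THEN spec, THEN mp, THEN bspec,
        OF conjI[OF I(1) conjI[OF I(2) geo]] I(3)] by auto
  have add: "\<And>s t. \<phi> (s + t) = \<phi> s \<circ> \<phi> t"
    and sm: "smooth_map (prod_atlas real_atlas A) A (\<lambda>(t, p). \<phi> t p)"
    and G: "\<phi> s \<in> semidirect_transformations N H" for s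
    using \<phi> by (auto simp: one_parameter_subgroup_def)
  have aut: "k \<in> H \<Longrightarrow> (\<forall>a b. k (a \<otimes> b) = k a \<otimes> k b) \<and> inj k" for k
    using subgroup.subset[OF H] carrier
    by (auto simp: AutoGroup_def auto_def hom_def Bij_def bij_betw_def)
  have split: "\<exists>k. k \<in> H \<and> (\<forall>x. \<phi> s x = \<phi> s \<one> \<otimes> k x)" for s
  proof -
    obtain a k where ak: "k \<in> H" "\<And>x. \<phi> s x = a \<otimes> k x"
      using G[of s] by (auto simp: semidirect_transformations_def)
    have "k (\<one> \<otimes> \<one>) = k \<one> \<otimes> k \<one>" using aut[OF ak(1)] by blast
    then have "inv (k \<one>) \<otimes> k \<one> = inv (k \<one>) \<otimes> (k \<one> \<otimes> k \<one>)" by (simp add: group_simps)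
    then have "k \<one> = \<one>" by (simp add: group_simps)
    then show ?thesis using ak by (auto simp: group_simps)
  qed
  \<comment> \<open>Only the addition law is part of \<open>one_parameter_subgroup\<close>. It makes
    \<open>\<phi> 0\<close> idempotent, and an injective idempotent map is the identity.\<close>
  have zero: "\<phi> 0 = id"
  proof
    fix y
    obtain k where k: "k \<in> H" "\<And>x. \<phi> 0 x = \<phi> 0 \<one> \<otimes> k x" using split by blast
    have "\<phi> 0 (\<phi> 0 y) = \<phi> 0 y" using add[of 0 0] by (metis add_0 comp_apply)
    then have "inv (\<phi> 0 \<one>) \<otimes> (\<phi> 0 \<one> \<otimes> k (\<phi> 0 y)) = inv (\<phi> 0 \<one>) \<otimes> (\<phi> 0 \<one> \<otimes> k y)"
      using k(2) by metis
    then have "k (\<phi> 0 y) = k y" by (simp add: group_simps)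
    then show "\<phi> 0 y = id y" using aut[OF k(1)] by (simp add: inj_eq)
  qed
  have iso_split: "\<exists>k. isometry_of A g k \<and> (\<forall>a b. k (a \<otimes> b) = k a \<otimes> k b) \<and> (\<forall>x. \<phi> s x = \<phi> s \<one> \<otimes> k x)" for s
    using split[of s] aut iso by blast
  obtain D V a' where D: "linear D"
    "\<And>u v. D (br u v) = br (D u) v + br u (D v)" "\<And>u v. ip (D u) v = - ip u (D v)"
    and da: "\<forall>\<^sub>F s in nhds 0. ((\<lambda>s. X (\<phi> s \<one>)) has_vector_derivative a' s) (at s)"
    and a': "a' 0 = V" "(a' has_vector_derivative D V + \<beta> V V) (at 0)"
    by (rule orbit_derivation[OF sm add zero iso_split]) (rule that; assumption)
  \<comment> \<open>The geodesic starts at \<open>\<one>\<close>, so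
    \<open>\<phi> (\<sigma> 0) p = \<one>\<close> and shifting time turns it into the orbit of
    \<open>\<one>\<close>.\<close>
  define \<tau> where "\<tau> t = \<sigma> t - \<sigma> 0" for t
  have x: "x t = X (\<phi> (\<tau> t) \<one>)" if "t \<in> S" for t
  proof -
    have "\<phi> (\<sigma> 0) p = \<one>" using orbit S(2) h(2) eps(2) by metis
    then have "q (x t) = \<phi> (\<tau> t) \<one>"
      using orbit that add[of "\<tau> t" "\<sigma> 0"] by (simp add: \<tau>_def)
    moreover have "X (q (x t)) = x t" using Xq[OF V1D(1)[OF h(4)]] S(3) that by blast
    ultimately show ?thesis by simp
  qed
  define \<sigma>' where "\<sigma>' t = frechet_derivative \<sigma> (at t) 1" for t
  have sm\<sigma>: "smooth_at \<sigma> t" if "t \<in> S" for t using smooth_on_imp_smooth_at[OF \<sigma>(1) S(1) that] .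
  have d\<tau>: "(\<tau> has_vector_derivative \<sigma>' t) (at t)" if "t \<in> S" for t
    using has_vector_derivative_diff[OF smooth_at_vector_derivative[OF sm\<sigma>[OF that]] has_vector_derivative_const]
    by (simp add: \<tau>_def[abs_def] \<sigma>'_def)
  have "deriv \<sigma> 0 = \<sigma>' 0"
    using smooth_at_vector_derivative[OF sm\<sigma>[OF S(2)]]
    by (intro DERIV_imp_deriv) (simp add: has_real_derivative_iff_has_vector_derivative \<sigma>'_def)
  then have c0: "\<sigma>' 0 \<noteq> 0" using \<sigma>(2) S(2) by metis
  define \<sigma>'' where "\<sigma>'' = frechet_derivative \<sigma>' (at 0) 1"
  have d\<sigma>': "(\<sigma>' has_vector_derivative \<sigma>'') (at 0)"
    unfolding \<sigma>''_def \<sigma>'_def[abs_def]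
    by (intro smooth_at_vector_derivative smooth_at_directional sm\<sigma> S)
  have \<tau>0: "\<tau> 0 = 0" by (simp add: \<tau>_def)
  have "isCont \<tau> 0" using d\<tau>[OF S(2)] by (rule has_vector_derivative_continuous)
  then have "filterlim \<tau> (nhds 0) (nhds 0)" using isCont_filterlim \<tau>0 by metis
  then have "\<forall>\<^sub>F t in nhds 0. ((\<lambda>s. X (\<phi> s \<one>)) has_vector_derivative a' (\<tau> t)) (at (\<tau> t))"
    by (rule eventually_compose_filterlim[OF da])
  then have v: "\<forall>\<^sub>F t in nhds 0. v t = \<sigma>' t *\<^sub>R a' (\<tau> t)"
    using eventually_nhds_in_open[OF S(1,2)]
  proof eventually_elim
    case (elim t)
    show ?case
    proof (rule has_vector_derivative_unique_nhds)
      show "(x has_vector_derivative v t) (at t)" using dx elim(2) S(3) by blast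
      show "((\<lambda>s. X (\<phi> s \<one>)) \<circ> \<tau> has_vector_derivative \<sigma>' t *\<^sub>R a' (\<tau> t)) (at t)"
        by (rule vector_diff_chain_at[OF d\<tau>[OF elim(2)] elim(1)])
      show "\<forall>\<^sub>F s in nhds t. x s = ((\<lambda>s. X (\<phi> s \<one>)) \<circ> \<tau>) s"
        using eventually_nhds_in_open[OF S(1) elim(2)] by eventually_elim (simp add: x)
    qed
  qed
  have T: "T = \<sigma>' 0 *\<^sub>R V" using eventually_nhds_x_imp_x[OF v] h(3) a'(1) \<tau>0 by simp
  have acc: "acc \<epsilon> T = \<sigma>' 0 *\<^sub>R \<sigma>' 0 *\<^sub>R (D V + \<beta> V V) + \<sigma>'' *\<^sub>R V"
  proof (rule has_vector_derivative_unique_nhds[OF _ _ v])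
    show "(v has_vector_derivative acc \<epsilon> T) (at 0)" using dv[OF I(3)] h by simp
    have "(a' \<circ> \<tau> has_vector_derivative \<sigma>' 0 *\<^sub>R (D V + \<beta> V V)) (at 0)"
      using a'(2) by (intro vector_diff_chain_at[OF d\<tau>[OF S(2)]]) (simp add: \<tau>0)
    from bounded_bilinear.has_vector_derivative[OF bounded_bilinear_scaleR d\<sigma>' this]
    show "((\<lambda>t. \<sigma>' t *\<^sub>R a' (\<tau> t)) has_vector_derivative
        \<sigma>' 0 *\<^sub>R \<sigma>' 0 *\<^sub>R (D V + \<beta> V V) + \<sigma>'' *\<^sub>R V) (at 0)"
      by (simp add: o_def \<tau>0 a'(1))
  qed
  \<comment> \<open>The orbit has velocity \<open>V\<close>, the geodesic \<open>T\<close>, which is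
    \<open>\<sigma>' 0\<close> times \<open>V\<close>; the derivation is rescaled
    accordingly.\<close>
  define E where "E w = \<sigma>' 0 *\<^sub>R D w" for w
  have "linear E" unfolding E_def using D(1) by (intro linear_compose_scale_right)
  moreover have "E (br u w) = br (E u) w + br u (E w)" for u w
    by (simp add: E_def D(2) bilinear_lmul[OF bilinear_br] bilinear_rmul[OF bilinear_br] scaleR_add_right)
  moreover have skE: "ip (E u) w = - ip u (E w)" for u w
    by (simp add: E_def ip_simps D(3))
  moreover have "ip (br T w + E w) T = \<sigma>'' / \<sigma>' 0 * ip T w" for w
  proof -
    \<comment> \<open>The chart-dependent term \<open>\<beta> T T\<close> also occurs in the
      acceleration of the orbit and cancels; what remains depends only on the bracket.\<close>
    have "ip (acc \<epsilon> T) w = ip (\<beta> T T) w + ip T (br T w)"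
      using acc_eq[OF eps_V1, of T w] by (simp add: chr_def DL_eps Lt_eps ip_simps br_eq)
    moreover have "E T + \<beta> T T = \<sigma>' 0 *\<^sub>R \<sigma>' 0 *\<^sub>R (D V + \<beta> V V)"
      unfolding T E_def by (simp add: \<beta>_simps scaleR_add_right linear_scale[OF D(1)])
    then have "acc \<epsilon> T = E T + \<beta> T T + \<sigma>'' *\<^sub>R V" by (simp add: acc)
    ultimately have "ip (E T) w + \<sigma>'' * ip V w = ip T (br T w)" by (simp add: ip_simps)
    moreover have "ip (E w) T = - ip (E T) w" using skE[of T w] ip_sym[of "E w" T] by simp
    moreover have "\<sigma>'' / \<sigma>' 0 * ip T w = \<sigma>'' * ip V w" using c0 by (simp add: T ip_simps)
    ultimately show ?thesis by (simp add: ip_simps ip_sym[of "br T w"])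
  qed
  ultimately show ?thesis by blast
qed

end

theorem theorem2:
  fixes N :: "('a::{t2_space, second_countable_topology}) monoid"
    and A :: "('a, 'e::euclidean_space) chart set"
    and e :: "('a, 'e) chart"
    and ip :: "'e \<Rightarrow> 'e \<Rightarrow> real"
    and H :: "('a \<Rightarrow> 'a) set"
  assumes "lie_group N A"
    and "connected (UNIV :: 'a set)"
    and "nilpotent_group N"
    and "e \<in> A" and "\<one>\<^bsub>N\<^esub> \<in> fst e"
    and "lorentz_inner_product ip"
    and "subgroup H (AutoGroup N)"
    and "\<forall>h\<in>H. isometry_of A (left_invariant_metric N e ip) h"
    and "geodesic_orbit A (left_invariant_metric N e ip) (semidirect_transformations N H)"
    and "nondegenerate_on (derived_algebra (lie_bracket N e)) ip"
  shows "comm_group N \<or> two_step_nilpotent (lie_bracket N e)"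
proof -
  have ip: "bilinear ip" "\<And>u v. ip u v = ip v u"
    using assms(6) by (auto simp: lorentz_inner_product_def)
  interpret lie_group_metric N A e ip
  proof
    show "u = 0" if "\<And>v. ip u v = 0" for u by (rule lorentz_nondegenerate[OF assms(6) that])
  qed (use assms ip in auto)
  obtain k where k: "lower_central_series N k = {\<one>\<^bsub>N\<^esub>}"
    using assms(3) by (auto simp: nilpotent_group_def)
  interpret alg: lorentz_go_algebra "lie_bracket N e" ip k
    by unfold_locales
       (use bilinear_br br_self jacobi br_nilpotent[OF k] assms(6,10) geodesic_lemma[OF assms(7-9)] in blast)+
  show ?thesis
  proof (cases "derived_algebra (lie_bracket N e) = {0}")
    \<comment> \<open>The conclusion is about the group itself, so the vanishing bracket has to be
      integrated over the connected \<open>N\<close>.\<close>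
    case True
    then have "lie_bracket N e u v = 0" for u v using alg.br_in_DD by blast
    then show ?thesis using commutative[OF assms(2)] by blast
  next
    case False
    have "{lie_bracket N e u v |u v. u \<in> UNIV \<and> v \<in> derived_algebra (lie_bracket N e)} \<subseteq> {0}"
      using alg.two_step by blast
    from span_minimal[OF this subspace_single_0]
    have "bracket_span (lie_bracket N e) UNIV (derived_algebra (lie_bracket N e)) = {0}"
      unfolding bracket_span_def[of _ _ "derived_algebra _"] using span_zero by blast
    with False show ?thesis by (simp add: two_step_nilpotent_def)
  qed
qed

end
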